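(* Let $\pi\in S_n$ be a permutation. The following are equivalent: (i) the essential minors of $\pi$ form a Gröbner basis of $I_\pi$ under some diagonal term order; (ii) the essential minors of $\pi$ form a Gröbner basis of $I_\pi$ under every diagonal term order; (iii) $\pi$ is vexillary.
   Context: Let $\mathbb k$ be a field and $\mathbb k[\mathbf z]$ the polynomial ring in the entries of the generic matrix $\mathbf z=(z_{ij})_{i,j=1}^n$; $\mathbf z_{p\times q}$ denotes the northwest $p\times q$ submatrix. For $\pi\in S_n$ let $r^\pi_{pq}=\#\{i\le p:\pi(i)\le q\}$, and let $I_\pi\subseteq\mathbb k[\mathbf z]$ be the ideal generated by all minors of size $1+r^\pi_{pq}$ in $\mathbf z_{p\times q}$ over all $p,q$. The diagram is $D(\pi)=\{(p,q)\in\{1,\dots,n\}^2:\pi(p)>q,\ \pi^{-1}(q)>p\}$ and the essential set is $\mathcal Ess(\pi)=\{(p,q)\in D(\pi):(p+1,q)\notin D(\pi),\ (p,q+1)\notin D(\pi)\}$. The essential minors of $\pi$ are the minors of size $1+r^\pi_{pq}$ in $\mathbf z_{p\times q}$ for $(p,q)\in\mathcal Ess(\pi)$; they generate $I_\pi$. A term order on $\mathbb k[\mathbf z]$ is diagonal if the leading term of every minor of $\mathbf z$ is its diagonal term. $\pi$ is vexillary if there are no $a<b<c<d$ with $\pi(b)<\pi(a)<\pi(d)<\pi(c)$. *)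

theory Defs
  imports
    "HOL-Library.Poly_Mapping"
    "HOL-Combinatorics.Permutations"
    "HOL-Algebra.Ideal"
    "Jordan_Normal_Form.Determinant"
    "Jordan_Normal_Form.DL_Submatrix"
begin

text \<open>
  Polynomials are finitely supported functions from monomials to coefficients, and monomials are
  finitely supported exponent functions; the pair \<open>(i, j)\<close> names the variable \<open>z\<^sub>i\<^sub>j\<close>.  The
  types provide variables for all pairs of natural numbers, so the polynomial ring of the generic
  \<open>n \<times> n\<close> matrix is the explicit subring \<open>zring n\<close>, and ideals are taken in that ring.
\<close>

type_synonym zmonom = "(nat \<times> nat) \<Rightarrow>\<^sub>0 nat"
type_synonym 'k zpoly = "zmonom \<Rightarrow>\<^sub>0 'k"

definition zmonoms :: "nat \<Rightarrow> zmonom set" where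
  "zmonoms n = {m. Poly_Mapping.keys m \<subseteq> {1..n} \<times> {1..n}}"

definition zring :: "nat \<Rightarrow> 'k::field zpoly ring" where
  "zring n = \<lparr>carrier = {f. Poly_Mapping.keys f \<subseteq> zmonoms n},
     monoid.mult = (*), one = 1, zero = 0, add = (+)\<rparr>"

definition zvar :: "nat \<Rightarrow> nat \<Rightarrow> 'k::field zpoly" where
  "zvar i j = Poly_Mapping.single (Poly_Mapping.single (i, j) 1) 1"

text \<open>
  \<open>zmat p q\<close> is the northwest \<open>p \<times> q\<close> submatrix of the generic matrix.  Entries of the matrix
  type are indexed from \<open>0\<close>, whereas the variables are indexed from \<open>1\<close>.
\<close>

definition zmat :: "nat \<Rightarrow> nat \<Rightarrow> 'k::field zpoly mat" where
  "zmat p q = mat p q (\<lambda>(i, j). zvar (i + 1) (j + 1))"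

definition square_submatrices :: "nat \<Rightarrow> 'a mat \<Rightarrow> 'a mat set" where
  "square_submatrices s A =
     {submatrix A I J | I J. I \<subseteq> {0..<dim_row A} \<and> J \<subseteq> {0..<dim_col A} \<and> card I = s \<and> card J = s}"

definition minors :: "nat \<Rightarrow> 'a::comm_ring_1 mat \<Rightarrow> 'a set" where
  "minors s A = det ` square_submatrices s A"

definition perm_rank :: "(nat \<Rightarrow> nat) \<Rightarrow> nat \<Rightarrow> nat \<Rightarrow> nat" where
  "perm_rank \<pi> p q = card {i. 1 \<le> i \<and> i \<le> p \<and> \<pi> i \<le> q}"

definition schubert_ideal :: "nat \<Rightarrow> (nat \<Rightarrow> nat) \<Rightarrow> 'k::field zpoly set" where
  "schubert_ideal n \<pi> =
     Idl\<^bsub>zring n\<^esub> (\<Union>p\<in>{1..n}. \<Union>q\<in>{1..n}. minors (1 + perm_rank \<pi> p q) (zmat p q))"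

definition perm_diagram :: "nat \<Rightarrow> (nat \<Rightarrow> nat) \<Rightarrow> (nat \<times> nat) set" where
  "perm_diagram n \<pi> =
     {(p, q). p \<in> {1..n} \<and> q \<in> {1..n} \<and> \<pi> p > q \<and> inv_into UNIV \<pi> q > p}"

definition essential_set :: "nat \<Rightarrow> (nat \<Rightarrow> nat) \<Rightarrow> (nat \<times> nat) set" where
  "essential_set n \<pi> =
     {(p, q) \<in> perm_diagram n \<pi>.
        (p + 1, q) \<notin> perm_diagram n \<pi> \<and> (p, q + 1) \<notin> perm_diagram n \<pi>}"

definition essential_minors :: "nat \<Rightarrow> (nat \<Rightarrow> nat) \<Rightarrow> 'k::field zpoly set" where
  "essential_minors n \<pi> =
     (\<Union>(p, q)\<in>essential_set n \<pi>. minors (1 + perm_rank \<pi> p q) (zmat p q))"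

definition vexillary :: "nat \<Rightarrow> (nat \<Rightarrow> nat) \<Rightarrow> bool" where
  "vexillary n \<pi> \<longleftrightarrow>
     \<not> (\<exists>a\<in>{1..n}. \<exists>b\<in>{1..n}. \<exists>c\<in>{1..n}. \<exists>d\<in>{1..n}.
          a < b \<and> b < c \<and> c < d \<and> \<pi> b < \<pi> a \<and> \<pi> a < \<pi> d \<and> \<pi> d < \<pi> c)"

text \<open>Here \<open>(a, b) \<in> R\<close> means that \<open>a\<close> is at most \<open>b\<close>; multiplication of monomials is addition
  of exponents, and the monomial \<open>1\<close> is \<open>0\<close>.\<close>

definition term_order :: "nat \<Rightarrow> zmonom rel \<Rightarrow> bool" where
  "term_order n R \<longleftrightarrow>
     linear_order_on (zmonoms n) R \<and>
     (\<forall>a\<in>zmonoms n. (0, a) \<in> R) \<and>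
     (\<forall>a\<in>zmonoms n. \<forall>b\<in>zmonoms n. \<forall>c\<in>zmonoms n. (a, b) \<in> R \<longrightarrow> (a + c, b + c) \<in> R)"

definition lead_monom :: "zmonom rel \<Rightarrow> 'k::field zpoly \<Rightarrow> zmonom" where
  "lead_monom R f =
     (THE m. m \<in> Poly_Mapping.keys f \<and> (\<forall>m'\<in>Poly_Mapping.keys f. (m', m) \<in> R))"

definition lead_term :: "zmonom rel \<Rightarrow> 'k::field zpoly \<Rightarrow> 'k zpoly" where
  "lead_term R f =
     (if f = 0 then 0
      else Poly_Mapping.single (lead_monom R f) (Poly_Mapping.lookup f (lead_monom R f)))"

text \<open>The type argument names the coefficient field, whose minors are the ones tested.\<close>

definition diagonal_term_order :: "'k::field itself \<Rightarrow> nat \<Rightarrow> zmonom rel \<Rightarrow> bool" where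
  "diagonal_term_order _ n R \<longleftrightarrow>
     term_order n R \<and>
     (\<forall>s. \<forall>A \<in> square_submatrices s (zmat n n :: 'k zpoly mat).
        lead_term R (det A) = prod_list (diag_mat A))"

definition groebner_basis ::
  "nat \<Rightarrow> zmonom rel \<Rightarrow> 'k::field zpoly set \<Rightarrow> 'k zpoly set \<Rightarrow> bool" where
  "groebner_basis n R G I \<longleftrightarrow>
     finite G \<and> G \<subseteq> I \<and>
     Idl\<^bsub>zring n\<^esub> (lead_term R ` G) = Idl\<^bsub>zring n\<^esub> (lead_term R ` I)"

end

theory Submission
  imports Defs "HOL-Library.Product_Lexorder" "HOL-Computational_Algebra.Fraction_Field"
begin

text \<open>
  Call a monomial standard if no diagonal term of an essential minor divides it.  For vexillary
  \<open>\<pi>\<close> no two essential boxes are strictly northwest-southeast of each other.  For any finite set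
  \<open>S\<close> of rank conditions with this property there is a point \<open>\<sigma>\<close> over a field extension that
  satisfies \<open>S\<close> and at which no nonzero combination of standard monomials vanishes.  The
  construction decomposes at the variable \<open>y\<close> of a southeast corner: the minors through \<open>y\<close> have
  the form \<open>y g + r\<close>, deleting them gives a smaller set \<open>N\<close> of conditions, and replacing them
  by the \<open>g\<close> gives a smaller set \<open>C\<close>.  If \<open>g\<close> does not vanish at the generic point of \<open>N\<close> and
  \<open>r\<close> does not vanish at that of \<open>C\<close>, then setting \<open>y = - r / g\<close> on the generic point of \<open>N\<close>
  works: the leading coefficient in \<open>y\<close> of a polynomial vanishing there must vanish at the generic
  point of \<open>C\<close>.  Both nonvanishing statements are checked at permutation-like \<open>0/1\<close> matrices.
  Reducing the tail of an element of the ideal then shows that its leading monomial is not standard.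

  If \<open>\<pi>\<close> is not vexillary, take essential boxes \<open>(i, j)\<close> strictly northwest of \<open>(p, q)\<close>.
  Some minor for \<open>(p, q)\<close> is not in the ideal of the other essential minors although its diagonal
  term is divisible by one of theirs; reducing it by the other essential minors inside its
  multidegree yields an element of the ideal with standard leading monomial.
\<close>

section \<open>Minors at a point\<close>

text \<open>For vexillary \<pi> the crux is that standard monomials are linearly independent modulo
  I_\<pi>. One point over an extension field settles this: the kernel of evaluation there contains
  I_\<pi>, and genericity says that no nonzero standard combination lies in that kernel. The sets N
  and C produced at a corner need not come from a permutation, which is why the induction runs over
  finite sets of triples (p, q, s), read as: all s-minors of the northwest p x q block vanish. The
  fraction field of the polynomial ring is large enough throughout: with no conditions the variables
  themselves are a generic point, and each corner step only divides by a nonzero element. Reduction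
  terminates for a reason independent of the term order: with weight i * j on z_ij, the
  rearrangement inequality makes the diagonal term of a minor its strictly heaviest term. The same
  reduction can therefore carry along any relation that its steps respect: descent in a given
  diagonal order for one implication, equality of multidegrees for the other.\<close>

definition gen_minor :: "(nat \<times> nat \<Rightarrow> 'a::comm_ring_1) \<Rightarrow> nat \<Rightarrow> (nat \<Rightarrow> nat) \<Rightarrow> (nat \<Rightarrow> nat) \<Rightarrow> 'a" where
  "gen_minor \<tau> s f h = det (mat s s (\<lambda>(i, j). \<tau> (f i, h j)))"

lemma gen_minor_cong:
  assumes "\<And>i j. i < s \<Longrightarrow> j < s \<Longrightarrow> \<tau> (f i, h j) = \<tau>' (f' i, h' j)"
  shows "gen_minor \<tau> s f h = gen_minor \<tau>' s f' h'"
proof -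
  have "mat s s (\<lambda>(i, j). \<tau> (f i, h j)) = mat s s (\<lambda>(i, j). \<tau>' (f' i, h' j))"
    using assms by (intro eq_matI) auto
  then show ?thesis by (simp add: gen_minor_def)
qed

lemma gen_minor_0 [simp]: "gen_minor \<tau> 0 f h = 1"
  by (simp add: gen_minor_def)

lemma gen_minor_1: "gen_minor \<tau> (Suc 0) f h = \<tau> (f 0, h 0)"
  unfolding gen_minor_def by (subst det_single) auto

lemma gen_minor_hom:
  assumes "comm_ring_hom \<phi>"
  shows "gen_minor (\<lambda>v. \<phi> (\<tau> v)) s f h = \<phi> (gen_minor \<tau> s f h)"
proof -
  interpret comm_ring_hom \<phi> by fact
  have "mat s s (\<lambda>(i, j). \<phi> (\<tau> (f i, h j))) = map_mat \<phi> (mat s s (\<lambda>(i, j). \<tau> (f i, h j)))"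
    by (intro eq_matI) auto
  then show ?thesis by (simp add: gen_minor_def)
qed

text \<open>Each later statement about columns is the statement about rows at the point with swapped
  indices.\<close>

lemma gen_minor_swap: "gen_minor (\<lambda>v. \<tau> (prod.swap v)) s h f = gen_minor \<tau> s f h"
proof -
  have "mat s s (\<lambda>(i, j). \<tau> (f j, h i)) = transpose_mat (mat s s (\<lambda>(i, j). \<tau> (f i, h j)))"
    by (intro eq_matI) auto
  then show ?thesis
    by (simp add: gen_minor_def det_transpose[of _ s])
qed

text \<open>Composition with \<open>insert_index\<close> deletes an index. Since index lists are
  plain functions, with repetitions allowed, every cofactor is again a
  \<open>gen_minor\<close>.\<close>

lemma gen_minor_expand_row:
  assumes "k < Suc s"
  shows "gen_minor \<tau> (Suc s) f h = (\<Sum>j<Suc s. \<tau> (f k, h j) * ((-1) ^ (k + j) *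
     gen_minor \<tau> s (f \<circ> insert_index k) (h \<circ> insert_index j)))"
proof -
  let ?A = "mat (Suc s) (Suc s) (\<lambda>(i, j). \<tau> (f i, h j))"
  have "det ?A = (\<Sum>j<Suc s. ?A $$ (k, j) * cofactor ?A k j)"
    by (rule laplace_expansion_row[OF _ assms]) auto
  also have "\<dots> = (\<Sum>j<Suc s. \<tau> (f k, h j) * ((-1) ^ (k + j) *
     gen_minor \<tau> s (f \<circ> insert_index k) (h \<circ> insert_index j)))"
  proof (intro sum.cong refl)
    fix j assume j: "j \<in> {..<Suc s}"
    have "mat_delete ?A k j = mat s s (\<lambda>(i, j'). \<tau> ((f \<circ> insert_index k) i, (h \<circ> insert_index j) j'))"
      by (intro eq_matI) (auto simp: mat_delete_def insert_index_def)
    then show "?A $$ (k, j) * cofactor ?A k j = \<tau> (f k, h j) * ((-1) ^ (k + j) *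
     gen_minor \<tau> s (f \<circ> insert_index k) (h \<circ> insert_index j))"
      using j assms by (simp add: cofactor_def gen_minor_def)
  qed
  finally show ?thesis by (simp add: gen_minor_def)
qed

lemma gen_minor_eq_0_if_rows_eq:
  assumes "i < s" "j < s" "i \<noteq> j" "f i = f j"
  shows "gen_minor \<tau> s f h = 0"
  unfolding gen_minor_def
  by (rule det_identical_rows[of _ s i j]) (use assms in \<open>auto intro!: eq_vecI\<close>)

lemma gen_minor_eq_0_if_not_inj:
  assumes "\<not> inj_on f {..<s}"
  shows "gen_minor \<tau> s f h = 0"
  using assms gen_minor_eq_0_if_rows_eq[of _ s _ f] unfolding inj_on_def by blast

text \<open>The cofactors do not see row \<open>k\<close>, hence the dependence on \<open>x\<close> is linear.\<close>

lemma gen_minor_row_linear: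
  assumes "k < Suc s"
  shows "gen_minor \<tau> (Suc s) (f(k := x)) h = (\<Sum>j<Suc s. \<tau> (x, h j) * ((-1) ^ (k + j) *
     gen_minor \<tau> s (f \<circ> insert_index k) (h \<circ> insert_index j)))"
proof -
  have "f(k := x) \<circ> insert_index k = f \<circ> insert_index k"
    by (auto simp: fun_eq_iff insert_index_def)
  then show ?thesis
    using gen_minor_expand_row[OF assms, of \<tau> "f(k := x)" h] by simp
qed

text \<open>The hypotheses make the southeast entry occur only once in the submatrix, so the minor
  has degree one in it. This is the form \<open>y g + r\<close> used at a corner.\<close>

lemma gen_minor_corner:
  assumes "\<And>i. i < s \<Longrightarrow> f i \<noteq> f s" and "\<And>j. j < s \<Longrightarrow> h j \<noteq> h s"
  shows "gen_minor \<tau> (Suc s) f h =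
    \<tau> (f s, h s) * gen_minor \<tau> s f h + gen_minor (\<tau>((f s, h s) := 0)) (Suc s) f h"
    (is "_ = _ + gen_minor ?\<tau> _ _ _")
proof -
  have sub: "gen_minor ?\<tau> s (f \<circ> insert_index s) (h \<circ> insert_index j) =
     gen_minor \<tau> s (f \<circ> insert_index s) (h \<circ> insert_index j)" for j
    by (rule gen_minor_cong) (use assms in \<open>auto simp: insert_index_def\<close>)
  have last: "gen_minor \<tau> s (f \<circ> insert_index s) (h \<circ> insert_index s) = gen_minor \<tau> s f h"
    by (rule gen_minor_cong) (auto simp: insert_index_def)
  have "gen_minor \<tau> (Suc s) f h - gen_minor ?\<tau> (Suc s) f h = (\<Sum>j<Suc s. (\<tau> (f s, h j) - ?\<tau> (f s, h j)) * ((-1) ^ (s + j) *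
     gen_minor \<tau> s (f \<circ> insert_index s) (h \<circ> insert_index j)))"
    using gen_minor_expand_row[of s s \<tau> f h] gen_minor_expand_row[of s s ?\<tau> f h]
    unfolding sub by (simp only: lessI sum_subtractf[symmetric] left_diff_distrib)
  also have "\<dots> = \<tau> (f s, h s) * gen_minor \<tau> s f h"
    using assms(2) by (simp add: last)
  finally show ?thesis by (simp add: algebra_simps)
qed


text \<open>Allowing all index functions instead of increasing ones changes nothing: a repeated
  index gives 0 and a reordering changes only the sign. Over a field this says that the block has
  rank less than \<open>s\<close>.\<close>

definition minors_vanish :: "(nat \<times> nat \<Rightarrow> 'a::comm_ring_1) \<Rightarrow> nat \<Rightarrow> nat \<Rightarrow> nat \<Rightarrow> bool" where
  "minors_vanish \<tau> p q s \<longleftrightarrow>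
     (\<forall>f h. (\<forall>i<s. f i \<in> {1..p} \<and> h i \<in> {1..q}) \<longrightarrow> gen_minor \<tau> s f h = 0)"

lemma minors_vanishD:
  assumes "minors_vanish \<tau> p q s" "\<And>i. i < s \<Longrightarrow> f i \<in> {1..p}" "\<And>i. i < s \<Longrightarrow> h i \<in> {1..q}"
  shows "gen_minor \<tau> s f h = 0"
  using assms unfolding minors_vanish_def by blast

lemma minors_vanish_cong:
  assumes "\<And>i j. i \<in> {1..p} \<Longrightarrow> j \<in> {1..q} \<Longrightarrow> \<tau> (i, j) = \<tau>' (i, j)"
  shows "minors_vanish \<tau> p q s = minors_vanish \<tau>' p q s"
proof -
  have "gen_minor \<tau> s f h = gen_minor \<tau>' s f h" if "\<forall>i<s. f i \<in> {1..p} \<and> h i \<in> {1..q}" for f h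
    using assms that by (intro gen_minor_cong) blast
  then show ?thesis unfolding minors_vanish_def by auto
qed

lemma minors_vanish_swap: "minors_vanish (\<lambda>v. \<tau> (prod.swap v)) q p s = minors_vanish \<tau> p q s"
proof -
  have "minors_vanish (\<lambda>v. \<tau> (prod.swap v)) q p s" if "minors_vanish \<tau> p q s" for \<tau> :: "nat \<times> nat \<Rightarrow> 'a" and p q
    unfolding minors_vanish_def using minors_vanishD[OF that] by (auto simp: gen_minor_swap)
  from this[of \<tau> p q] this[of "\<lambda>v. \<tau> (prod.swap v)" q p] show ?thesis by auto
qed

lemma minors_vanish_mono:
  assumes "minors_vanish \<tau> p q s" "p' \<le> p" "q' \<le> q"
  shows "minors_vanish \<tau> p' q' s"
  unfolding minors_vanish_def by (intro allI impI minors_vanishD[OF assms(1)]) (use assms in fastforce)+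

text \<open>One more row raises the rank by at most one. Expand along the new row if the minor uses
  it and along any row otherwise; by injectivity of \<open>f\<close> the cofactors then live in the
  first \<open>p\<close> rows.\<close>

lemma minors_vanish_Suc_row:
  assumes "minors_vanish \<tau> p q s"
  shows "minors_vanish \<tau> (Suc p) q (Suc s)"
  unfolding minors_vanish_def
proof (intro allI impI)
  fix f h :: "nat \<Rightarrow> nat"
  assume fh: "\<forall>i<Suc s. f i \<in> {1..Suc p} \<and> h i \<in> {1..q}"
  show "gen_minor \<tau> (Suc s) f h = 0"
  proof (cases "inj_on f {..<Suc s}")
    case False
    then show ?thesis by (rule gen_minor_eq_0_if_not_inj)
  next
    case True
    obtain k where k: "k < Suc s" "\<And>i. i < Suc s \<Longrightarrow> i \<noteq> k \<Longrightarrow> f i \<noteq> Suc p"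
    proof (cases "\<exists>k<Suc s. f k = Suc p")
      case True
      then show ?thesis using that \<open>inj_on f _\<close> unfolding inj_on_def by (metis lessThan_iff)
    qed (use that in blast)
    have "gen_minor \<tau> s (f \<circ> insert_index k) (h \<circ> insert_index j) = 0" for j
    proof (rule minors_vanishD[OF assms])
      fix i assume i: "i < s"
      have "insert_index k i < Suc s" "insert_index k i \<noteq> k" "insert_index j i < Suc s"
        using i by (auto simp: insert_index_def)
      with k(2) fh show "(f \<circ> insert_index k) i \<in> {1..p}" "(h \<circ> insert_index j) i \<in> {1..q}"
        by (auto simp: le_Suc_eq)
    qed
    then show ?thesis by (simp add: gen_minor_expand_row[OF k(1)])
  qed
qed

lemma minors_vanish_Suc_col:
  "minors_vanish \<tau> p q s \<Longrightarrow> minors_vanish \<tau> p (Suc q) (Suc s)"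
  using minors_vanish_Suc_row[of "\<lambda>v. \<tau> (prod.swap v)" q p s] by (simp add: minors_vanish_swap)

lemma minors_vanish_add_row: "minors_vanish \<tau> p q s \<Longrightarrow> minors_vanish \<tau> (p + k) q (s + k)"
  by (induction k) (auto dest: minors_vanish_Suc_row)

lemma minors_vanish_add_col: "minors_vanish \<tau> p q s \<Longrightarrow> minors_vanish \<tau> p (q + k) (s + k)"
  by (induction k) (auto dest: minors_vanish_Suc_col)

text \<open>Truncated subtraction lets one statement cover blocks that grow in one direction and
  shrink in the other.\<close>

lemma minors_vanish_add:
  assumes "minors_vanish \<tau> p q s" "s + (p' - p) + (q' - q) \<le> s'"
  shows "minors_vanish \<tau> p' q' s'"
proof -
  \<comment> \<open>The slack in the size is spent on extra rows, which monotonicity drops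
    again.\<close>
  let ?e = "s' - (s + (p' - p) + (q' - q))"
  have "minors_vanish \<tau> (p + ((p' - p) + ?e)) (q + (q' - q)) (s + ((p' - p) + ?e) + (q' - q))"
    by (intro minors_vanish_add_col minors_vanish_add_row assms)
  moreover have "s + ((p' - p) + ?e) + (q' - q) = s'" using assms(2) by simp
  ultimately show ?thesis by (auto elim: minors_vanish_mono)
qed

lemma minors_vanish_few_rows:
  assumes "p < s"
  shows "minors_vanish \<tau> p q s"
  unfolding minors_vanish_def
proof (intro allI impI gen_minor_eq_0_if_not_inj notI)
  fix f h :: "nat \<Rightarrow> nat"
  assume fh: "\<forall>i<s. f i \<in> {1..p} \<and> h i \<in> {1..q}" and "inj_on f {..<s}"
  then have "card {..<s} \<le> card {1..p}"
    by (intro card_inj_on_le[of f]) auto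
  with assms show False by simp
qed

lemma minors_vanish_few_cols: "q < s \<Longrightarrow> minors_vanish \<tau> p q s"
  using minors_vanish_few_rows[of q s "\<lambda>v. \<tau> (prod.swap v)" p] by (simp add: minors_vanish_swap)

lemma gen_minor_zero_row:
  assumes "k < s" "\<And>j. j < s \<Longrightarrow> \<tau> (f k, h j) = 0"
  shows "gen_minor \<tau> s f h = 0"
proof -
  obtain s' where s: "s = Suc s'" using assms(1) by (cases s) auto
  show ?thesis
    unfolding s by (subst gen_minor_expand_row[of k]) (use assms s in auto)
qed

text \<open>A nonzero minor has a dot in each of its rows, and its rows are distinct, so the block
  contains at least \<open>s\<close> dots.\<close>

lemma minors_vanish_few_dots:
  fixes D :: "(nat \<times> nat) set"
  defines "\<delta> \<equiv> \<lambda>v. of_bool (v \<in> D) :: 'a::comm_ring_1"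
  assumes "finite D" "card (D \<inter> {1..p} \<times> {1..q}) < s"
  shows "minors_vanish \<delta> p q s"
  unfolding minors_vanish_def
proof (intro allI impI)
  fix f h :: "nat \<Rightarrow> nat"
  assume fh: "\<forall>i<s. f i \<in> {1..p} \<and> h i \<in> {1..q}"
  show "gen_minor \<delta> s f h = 0"
  proof (rule ccontr)
    assume nz: "gen_minor \<delta> s f h \<noteq> 0"
    then have inj: "inj_on f {..<s}" using gen_minor_eq_0_if_not_inj by blast
    have "\<exists>j<s. (f i, h j) \<in> D" if "i < s" for i
    proof (rule ccontr)
      assume "\<not> (\<exists>j<s. (f i, h j) \<in> D)"
      with that have "gen_minor \<delta> s f h = 0"
        by (intro gen_minor_zero_row[of i]) (auto simp: \<delta>_def)
      with nz show False ..
    qed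
    then obtain c where c: "\<And>i. i < s \<Longrightarrow> c i < s \<and> (f i, h (c i)) \<in> D" by metis
    have "card {..<s} \<le> card (D \<inter> {1..p} \<times> {1..q})"
      using c fh inj assms(2)
      by (intro card_inj_on_le[of "\<lambda>i. (f i, h (c i))"]) (auto simp: inj_on_def)
    with assms(3) show False by simp
  qed
qed

text \<open>The matrix is a permutation matrix, hence orthogonal: the determinants of it and of its
  transpose multiply to 1.\<close>

lemma gen_minor_permutation_neq_0:
  fixes \<tau> :: "nat \<times> nat \<Rightarrow> 'a::comm_ring_1"
  assumes "\<And>i j. i < s \<Longrightarrow> j < s \<Longrightarrow> \<tau> (f i, h j) = of_bool (h j = h' i)"
    and "inj_on h {..<s}" "inj_on h' {..<s}" "h' ` {..<s} \<subseteq> h ` {..<s}"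
  shows "gen_minor \<tau> s f h \<noteq> 0"
proof -
  let ?W = "mat s s (\<lambda>(i, j). \<tau> (f i, h j))"
  have "?W * transpose_mat ?W = 1\<^sub>m s"
  proof (intro eq_matI)
    fix i k assume "i < dim_row (1\<^sub>m s)" "k < dim_col (1\<^sub>m s :: 'a mat)"
    then have ik: "i < s" "k < s" by auto
    from ik have "h' i \<in> h ` {..<s}" using assms(4) by blast
    then obtain j where j: "j < s" "h j = h' i" by (metis imageE lessThan_iff)
    have "(?W * transpose_mat ?W) $$ (i, k) = (\<Sum>j = 0..<s. \<tau> (f i, h j) * \<tau> (f k, h j))"
      using ik by (simp add: scalar_prod_def)
    also have "\<dots> = (\<Sum>j' = 0..<s. of_bool (j' = j \<and> i = k))"
    proof (intro sum.cong refl)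
      fix j' assume "j' \<in> {0..<s}"
      then have j': "j' < s" by simp
      have "h j' = h' i \<longleftrightarrow> j' = j" "h' i = h' k \<longleftrightarrow> i = k"
        using inj_onD[OF assms(2), of j' j] inj_onD[OF assms(3), of i k] ik j j' by auto
      then show "\<tau> (f i, h j') * \<tau> (f k, h j') = of_bool (j' = j \<and> i = k)"
        using ik j' by (cases "j' = j") (simp_all add: assms(1) flip: j(2))
    qed
    also have "\<dots> = (1\<^sub>m s :: 'a mat) $$ (i, k)"
      using ik j(1) by (cases "i = k") (simp_all add: of_bool_def)
    finally show "(?W * transpose_mat ?W) $$ (i, k) = 1\<^sub>m s $$ (i, k)" .
  qed auto
  moreover have "det (?W * transpose_mat ?W) = det ?W * det (transpose_mat ?W)"
    by (rule det_mult[of _ s]) auto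
  ultimately have "det ?W * det (transpose_mat ?W) = 1"
    by simp
  then show ?thesis unfolding gen_minor_def by (metis mult_zero_left zero_neq_one)
qed

text \<open>Given a nonvanishing \<open>s\<close>-minor, row \<open>Suc p\<close> is a linear combination of the rows of that minor.\<close>

lemma minors_vanish_corner:
  fixes \<tau> :: "nat \<times> nat \<Rightarrow> 'a::field"
  assumes v1: "minors_vanish \<tau> p (Suc q) (Suc s)" and v2: "minors_vanish \<tau> (Suc p) q (Suc s)"
    and f: "\<And>i. i < s \<Longrightarrow> f i \<in> {1..p}" and h: "\<And>i. i < s \<Longrightarrow> h i \<in> {1..q}"
    and g: "gen_minor \<tau> s f h \<noteq> 0"
    and d: "gen_minor \<tau> (Suc s) (f(s := Suc p)) (h(s := Suc q)) = 0"
  shows "minors_vanish \<tau> (Suc p) (Suc q) (Suc s)"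
proof -
  define \<tau>' where "\<tau>' = (\<lambda>v. \<tau> (prod.swap v))"
  \<comment> \<open>\<open>C i\<close> is the cofactor of row \<open>i\<close> in the last column of
    the bordered minor. It does not depend on the entries of that column, so the same coefficients
    work for every column \<open>j\<close>; \<open>C s\<close> is the given nonvanishing
    minor.\<close>
  define C where "C i = (-1) ^ (s + i) *
    gen_minor \<tau>' s (h \<circ> insert_index s) (f(s := Suc p) \<circ> insert_index i)" for i
  define c where "c i = - C i / C s" for i
  have "gen_minor \<tau>' s (h \<circ> insert_index s) (f(s := Suc p) \<circ> insert_index s) = gen_minor \<tau>' s h f"
    by (rule gen_minor_cong) (auto simp: insert_index_def)
  then have Cs: "C s \<noteq> 0"
    using g by (simp add: C_def \<tau>'_def gen_minor_swap)
  have row: "\<tau> (Suc p, j) = (\<Sum>i<s. c i * \<tau> (f i, j))" if j: "j \<in> {1..Suc q}" for j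
  proof -
    have "gen_minor \<tau> (Suc s) (f(s := Suc p)) (h(s := j)) = 0"
    proof (cases "j = Suc q")
      case False
      show ?thesis
        by (rule minors_vanishD[OF v2]) (use f h j False in \<open>auto simp: less_Suc_eq le_SucI\<close>)
    qed (simp add: d)
    then have "gen_minor \<tau>' (Suc s) (h(s := j)) (f(s := Suc p)) = 0"
      by (simp add: \<tau>'_def gen_minor_swap)
    then have "(\<Sum>i<Suc s. \<tau>' (j, (f(s := Suc p)) i) * C i) = 0"
      by (simp add: gen_minor_row_linear C_def)
    then have "\<tau> (Suc p, j) * C s = - (\<Sum>i<s. \<tau> (f i, j) * C i)"
      by (simp add: \<tau>'_def eq_neg_iff_add_eq_0 add.commute)
    then have "\<tau> (Suc p, j) = - (\<Sum>i<s. \<tau> (f i, j) * C i) / C s"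
      using Cs by (simp add: field_simps)
    then show ?thesis
      by (simp add: c_def sum_divide_distrib sum_negf[symmetric] mult.commute)
  qed
  have "gen_minor \<tau> (Suc s) f' h' = 0"
    if "\<forall>i<Suc s. f' i \<in> {1..Suc p} \<and> h' i \<in> {1..Suc q}" for f' h'
    using that
  \<comment> \<open>Row \<open>Suc p\<close> may occur several times. Replacing one occurrence by
    the combination of the rows \<open>f i\<close> lowers the count, and with no occurrence left the
    minor lies in the first \<open>p\<close> rows.\<close>
  proof (induction "card {k. k < Suc s \<and> f' k = Suc p}" arbitrary: f')
    case 0
    then have "\<forall>i<Suc s. f' i \<in> {1..p} \<and> h' i \<in> {1..Suc q}"
      by (auto simp: le_Suc_eq)
    then show ?case by (intro minors_vanishD[OF v1]) auto
  next
    case (Suc n)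
    then have "{k. k < Suc s \<and> f' k = Suc p} \<noteq> {}" by (metis card.empty nat.distinct(1))
    then obtain k where k: "k < Suc s" "f' k = Suc p" by blast
    let ?K = "\<lambda>j. (-1) ^ (k + j) * gen_minor \<tau> s (f' \<circ> insert_index k) (h' \<circ> insert_index j)"
    have IH: "gen_minor \<tau> (Suc s) (f'(k := f i)) h' = 0" if i: "i < s" for i
    proof (rule Suc.hyps(1))
      have "{k'. k' < Suc s \<and> (f'(k := f i)) k' = Suc p} = {k. k < Suc s \<and> f' k = Suc p} - {k}"
        using f[OF i] by auto
      then show "n = card {k'. k' < Suc s \<and> (f'(k := f i)) k' = Suc p}"
        using Suc.hyps(2) k by simp
      show "\<forall>i'<Suc s. (f'(k := f i)) i' \<in> {1..Suc p} \<and> h' i' \<in> {1..Suc q}"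
        using Suc.prems f[OF i] by auto
    qed
    have "gen_minor \<tau> (Suc s) f' h' = (\<Sum>j<Suc s. \<tau> (Suc p, h' j) * ?K j)"
      using gen_minor_expand_row[OF k(1), of \<tau> f' h'] k(2) by simp
    also have "\<dots> = (\<Sum>j<Suc s. \<Sum>i<s. c i * (\<tau> (f i, h' j) * ?K j))"
    proof (intro sum.cong refl)
      fix j assume "j \<in> {..<Suc s}"
      then have "h' j \<in> {1..Suc q}" using Suc.prems by blast
      then show "\<tau> (Suc p, h' j) * ?K j = (\<Sum>i<s. c i * (\<tau> (f i, h' j) * ?K j))"
        by (simp only: row sum_distrib_right mult.assoc)
    qed
    also have "\<dots> = (\<Sum>i<s. c i * (\<Sum>j<Suc s. \<tau> (f i, h' j) * ?K j))"
      by (subst sum.swap) (simp only: sum_distrib_left)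
    also have "\<dots> = (\<Sum>i<s. c i * gen_minor \<tau> (Suc s) (f'(k := f i)) h')"
      by (simp only: gen_minor_row_linear[OF k(1)])
    also have "\<dots> = 0" by (simp add: IH)
    finally show ?case .
  qed
  then show ?thesis unfolding minors_vanish_def by blast
qed

text \<open>Swapping two values so that \<open>s\<close> becomes a fixed point strictly increases
  the sum; what remains is a permutation of fewer indices.\<close>

lemma rearrangement_strict:
  fixes f h :: "nat \<Rightarrow> nat"
  assumes "strict_mono_on {..<s} f" "strict_mono_on {..<s} h" "\<sigma> permutes {..<s}" "\<sigma> \<noteq> id"
  shows "(\<Sum>i<s. f i * h (\<sigma> i)) < (\<Sum>i<s. f i * h i)"
  using assms
proof (induction s arbitrary: \<sigma>)
  case 0
  then show ?case by simp
next
  case (Suc s)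
  have mono: "strict_mono_on {..<s} f" "strict_mono_on {..<s} h"
    using Suc.prems(1,2) by (auto simp: strict_mono_on_def)
  have le: "(\<Sum>i<s. f i * h (\<rho> i)) \<le> (\<Sum>i<s. f i * h i)" if "\<rho> permutes {..<s}" for \<rho>
    using Suc.IH[OF mono that] by (cases "\<rho> = id") (simp, meson less_imp_le)
  have restrict: "\<rho> permutes {..<s}" if "\<rho> permutes {..<Suc s}" "\<rho> s = s" for \<rho>
    using permutes_superset[OF that(1), of "{..<s}"] that(2) by (auto simp: less_Suc_eq)
  show ?case
  proof (cases "\<sigma> s = s")
    case True
    then show ?thesis using Suc.IH[OF mono restrict] Suc.prems by simp
  next
    case False
    define j where "j = inv_into UNIV \<sigma> s"
    have \<sigma>j: "\<sigma> j = s" using Suc.prems(3) by (simp add: j_def permutes_inverses)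
    have j: "j < s"
      using Suc.prems(3) False \<sigma>j by (metis lessThan_iff less_SucE permutes_not_in lessI)
    have \<sigma>s: "\<sigma> s < s"
      using permutes_in_image[OF Suc.prems(3), of s] False by simp
    define \<rho> where "\<rho> = \<sigma> \<circ> transpose j s"
    have \<rho>: "\<rho> permutes {..<Suc s}"
      unfolding \<rho>_def using Suc.prems(3) j by (intro permutes_compose permutes_swap_id) auto
    have \<rho>s: "\<rho> s = s" "\<rho> j = \<sigma> s" using \<sigma>j by (auto simp: \<rho>_def)
    have \<rho>o: "\<rho> i = \<sigma> i" if "i \<noteq> j" "i \<noteq> s" for i using that by (simp add: \<rho>_def transpose_def)
    have split: "(\<Sum>i<Suc s. f i * h (\<phi> i)) = f s * h (\<phi> s) + f j * h (\<phi> j) + (\<Sum>i\<in>{..<s} - {j}. f i * h (\<phi> i))" for \<phi>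
      using j by (simp add: sum.remove[of "{..<s}" j])
    have eq: "(\<Sum>i\<in>{..<s} - {j}. f i * h (\<sigma> i)) = (\<Sum>i\<in>{..<s} - {j}. f i * h (\<rho> i))"
      by (rule sum.cong) (auto simp: \<rho>o)
    have fl: "f j < f s" and hl: "h (\<sigma> s) < h s"
      using Suc.prems(1,2) j \<sigma>s by (auto simp: strict_mono_on_def)
    then obtain a b where ab: "f s = f j + a" "a > 0" "h s = h (\<sigma> s) + b" "b > 0"
      by (metis less_imp_add_positive)
    have "f s * h (\<sigma> s) + f j * h s < f s * h s + f j * h (\<sigma> s)"
      by (simp add: ab algebra_simps)
    then have "(\<Sum>i<Suc s. f i * h (\<sigma> i)) < (\<Sum>i<Suc s. f i * h (\<rho> i))"
      unfolding split eq by (simp add: \<sigma>j \<rho>s)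
    also have "\<dots> \<le> (\<Sum>i<Suc s. f i * h i)"
      using le[OF restrict[OF \<rho> \<rho>s(1)]] by (simp add: \<rho>s)
    finally show ?thesis .
  qed
qed

section \<open>Diagonal chains and reduction\<close>

text \<open>Additive weights serve two purposes: the weight \<open>i * j\<close> makes reduction
  terminate, and indicator weights give row and column degrees.\<close>

definition monom_weight :: "(nat \<times> nat \<Rightarrow> nat) \<Rightarrow> zmonom \<Rightarrow> nat" where
  "monom_weight w m = (\<Sum>v\<in>Poly_Mapping.keys m. Poly_Mapping.lookup m v * w v)"

lemma monom_weight_0 [simp]: "monom_weight w 0 = 0"
  by (simp add: monom_weight_def)

lemma monom_weight_single [simp]: "monom_weight w (Poly_Mapping.single v e) = e * w v"
  by (cases "e = 0") (simp_all add: monom_weight_def)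

lemma monom_weight_add [simp]: "monom_weight w (a + b) = monom_weight w a + monom_weight w b"
  unfolding monom_weight_def
  by (rule setsum_keys_plus_distrib[where f = "\<lambda>v e. e * w v"]) (auto simp: algebra_simps)

lemma monom_weight_sum: "monom_weight w (sum f A) = (\<Sum>a\<in>A. monom_weight w (f a))"
  by (induction A rule: infinite_finite_induct) auto

definition chain_monom :: "nat \<Rightarrow> (nat \<Rightarrow> nat) \<Rightarrow> (nat \<Rightarrow> nat) \<Rightarrow> zmonom" where
  "chain_monom s f h = (\<Sum>i<s. Poly_Mapping.single (f i, h i) 1)"

lemma monom_weight_chain: "monom_weight w (chain_monom s f h) = (\<Sum>i<s. w (f i, h i))"
  by (simp add: chain_monom_def monom_weight_sum)

lemma lookup_chain_monom:
  assumes "inj_on f {..<s}"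
  shows "Poly_Mapping.lookup (chain_monom s f h) v = of_bool (\<exists>i<s. (f i, h i) = v)"
proof -
  have "Poly_Mapping.lookup (chain_monom s f h) v = (\<Sum>i<s. of_bool ((f i, h i) = v))"
    unfolding chain_monom_def lookup_sum by (intro sum.cong) (auto simp: lookup_single when_def)
  also have "\<dots> = of_bool (\<exists>i<s. (f i, h i) = v)"
  proof (cases "\<exists>i<s. (f i, h i) = v")
    case True
    then obtain i where i: "i < s" "(f i, h i) = v" by blast
    have "(\<Sum>j<s. of_bool ((f j, h j) = v)) = (\<Sum>j<s. of_bool (j = i) :: nat)"
    proof (intro sum.cong refl)
      fix j assume "j \<in> {..<s}"
      then have "(f j, h j) = v \<longleftrightarrow> j = i"
        using i inj_onD[OF assms, of j i] by auto
      then show "of_bool ((f j, h j) = v) = (of_bool (j = i) :: nat)" by simp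
    qed
    also have "\<dots> = 1" using i(1) by (simp add: of_bool_def)
    finally show ?thesis using True by simp
  qed (simp add: of_bool_def)
  finally show ?thesis .
qed

lemma keys_chain_monom: "Poly_Mapping.keys (chain_monom s f h) \<subseteq> (\<lambda>i. (f i, h i)) ` {..<s}"
proof -
  have "Poly_Mapping.keys (chain_monom s f h) \<subseteq>
    (\<Union>i\<in>{..<s}. Poly_Mapping.keys (Poly_Mapping.single (f i, h i) (1::nat)))"
    unfolding chain_monom_def by (rule keys_sum)
  then show ?thesis by auto
qed

definition chain :: "nat \<Rightarrow> nat \<Rightarrow> nat \<Rightarrow> (nat \<Rightarrow> nat) \<Rightarrow> (nat \<Rightarrow> nat) \<Rightarrow> bool" where
  "chain p q s f h \<longleftrightarrow> strict_mono_on {..<s} f \<and> strict_mono_on {..<s} h \<and>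
     (\<forall>i<s. f i \<in> {1..p} \<and> h i \<in> {1..q})"

lemma chain_inj:
  assumes "chain p q s f h"
  shows "inj_on f {..<s}" "inj_on h {..<s}"
  using assms by (auto simp: chain_def strict_mono_on_imp_inj_on)

text \<open>Diagonal terms are squarefree, so whether one of them divides \<open>m\<close> depends
  only on the support of \<open>m\<close>.\<close>

definition chain_divides :: "(nat \<times> nat \<times> nat) set \<Rightarrow> zmonom \<Rightarrow> bool" where
  "chain_divides S m \<longleftrightarrow> (\<exists>(p, q, s)\<in>S. \<exists>f h. chain p q s f h \<and>
     (\<forall>i<s. (f i, h i) \<in> Poly_Mapping.keys m))"

lemma chain_dividesI:
  "(p, q, s) \<in> S \<Longrightarrow> chain p q s f h \<Longrightarrow> (\<And>i. i < s \<Longrightarrow> (f i, h i) \<in> Poly_Mapping.keys m) \<Longrightarrow>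
    chain_divides S m"
  unfolding chain_divides_def by blast

lemma chain_dividesE:
  assumes "chain_divides S m"
  obtains p q s f h where "(p, q, s) \<in> S" "chain p q s f h"
    "\<And>i. i < s \<Longrightarrow> (f i, h i) \<in> Poly_Mapping.keys m"
  using assms unfolding chain_divides_def by blast

lemma chain_divides_factor:
  assumes "chain p q s f h" "\<And>i. i < s \<Longrightarrow> (f i, h i) \<in> Poly_Mapping.keys m"
  shows "m = (m - chain_monom s f h) + chain_monom s f h"
proof -
  have "Poly_Mapping.lookup (chain_monom s f h) v \<le> Poly_Mapping.lookup m v" for v
    using assms(2) by (auto simp: lookup_chain_monom[OF chain_inj(1)[OF assms(1)]] in_keys_iff Suc_le_eq)
  then show ?thesis
    by (intro poly_mapping_eqI) (simp add: lookup_add minus_poly_mapping.rep_eq)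
qed

lemma chain_divides_mono:
  assumes "chain_divides S m" "S \<subseteq> S'" "Poly_Mapping.keys m \<subseteq> Poly_Mapping.keys m'"
  shows "chain_divides S' m'"
  using assms(1) by (rule chain_dividesE) (rule chain_dividesI, use assms(2,3) in auto)

lemma keys_add_monom:
  "Poly_Mapping.keys (a + b :: zmonom) = Poly_Mapping.keys a \<union> Poly_Mapping.keys b"
  by (auto simp: in_keys_iff lookup_add)

section \<open>Terms of generic minors and reduction modulo diagonal terms\<close>

definition zv :: "nat \<times> nat \<Rightarrow> 'k::field zpoly" where
  "zv v = Poly_Mapping.single (Poly_Mapping.single v 1) 1"

lemma prod_zv: "(\<Prod>i<s. zv (f i, h i)) = (Poly_Mapping.single (chain_monom s f h) 1 :: 'k::field zpoly)"
  by (induction s) (simp_all add: chain_monom_def zv_def mult_single add.commute)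

text \<open>The Leibniz formula with the identity split off. For reduction it suffices to contain
  the support of the rest, whatever cancels there.\<close>

lemma gen_minor_zv:
  assumes f: "strict_mono_on {..<s} f" and h: "strict_mono_on {..<s} h"
  obtains r :: "'k::field zpoly" where
    "gen_minor zv s f h = Poly_Mapping.single (chain_monom s f h) 1 + r"
    "\<And>k. k \<in> Poly_Mapping.keys r \<Longrightarrow>
       \<exists>\<sigma>. \<sigma> permutes {..<s} \<and> \<sigma> \<noteq> id \<and> k = chain_monom s f (h \<circ> \<sigma>)"
proof -
  let ?t = "\<lambda>\<sigma>. signof \<sigma> * Poly_Mapping.single (chain_monom s f (h \<circ> \<sigma>)) 1 :: 'k zpoly"
  let ?P = "{\<sigma>. \<sigma> permutes {..<s}}"
  have "gen_minor zv s f h = (\<Sum>\<sigma>\<in>?P. signof \<sigma> * (\<Prod>i<s. zv (f i, h (\<sigma> i)) :: 'k zpoly))"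
    unfolding gen_minor_def lessThan_atLeast0
    by (subst det_def'[of _ s]) (auto intro!: sum.cong prod.cong simp: permutes_in_image)
  also have "\<dots> = (\<Sum>\<sigma>\<in>?P. ?t \<sigma>)"
  proof (intro sum.cong refl)
    fix \<sigma>
    show "signof \<sigma> * (\<Prod>i<s. zv (f i, h (\<sigma> i)) :: 'k zpoly) = ?t \<sigma>"
      using prod_zv[of f "h \<circ> \<sigma>" s, where 'k = 'k] by simp
  qed
  also have "\<dots> = ?t id + (\<Sum>\<sigma>\<in>?P - {id}. ?t \<sigma>)"
    by (rule sum.remove) (auto simp: finite_permutations permutes_id)
  finally have 1: "gen_minor zv s f h = Poly_Mapping.single (chain_monom s f h) 1 + (\<Sum>\<sigma>\<in>?P - {id}. ?t \<sigma>)"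
    by simp
  have "Poly_Mapping.keys (\<Sum>\<sigma>\<in>?P - {id}. ?t \<sigma>) \<subseteq> (\<Union>\<sigma>\<in>?P - {id}. Poly_Mapping.keys (?t \<sigma>))"
    by (rule keys_sum)
  also have "\<dots> \<subseteq> (\<Union>\<sigma>\<in>?P - {id}. {chain_monom s f (h \<circ> \<sigma>)})"
    by (intro UN_mono order_refl) (auto simp: sign_def in_keys_iff lookup_single when_def split: if_splits)
  finally show thesis using that 1 by blast
qed

abbreviation diag_weight :: "zmonom \<Rightarrow> nat" where
  "diag_weight \<equiv> monom_weight (\<lambda>(i, j). i * j)"

lemma diag_weight_less:
  assumes "strict_mono_on {..<s} f" "strict_mono_on {..<s} h" "\<sigma> permutes {..<s}" "\<sigma> \<noteq> id"
  shows "diag_weight (chain_monom s f (h \<circ> \<sigma>)) < diag_weight (chain_monom s f h)"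
  using rearrangement_strict[OF assms] by (simp add: monom_weight_chain)

lemma poly_sum_singles:
  "f = (\<Sum>m\<in>Poly_Mapping.keys f. Poly_Mapping.single m (Poly_Mapping.lookup f m))"
proof (rule poly_mapping_eqI)
  fix k
  have "Poly_Mapping.lookup (\<Sum>m\<in>Poly_Mapping.keys f. Poly_Mapping.single m (Poly_Mapping.lookup f m)) k =
     (\<Sum>m\<in>Poly_Mapping.keys f. if m = k then Poly_Mapping.lookup f m else 0)"
    unfolding lookup_sum by (intro sum.cong refl) (simp add: lookup_single when_def)
  then show "Poly_Mapping.lookup f k =
      Poly_Mapping.lookup (\<Sum>m\<in>Poly_Mapping.keys f. Poly_Mapping.single m (Poly_Mapping.lookup f m)) k"
    by (simp add: in_keys_iff)
qed

text \<open>\<open>J\<close> is what one reduces modulo; \<open>Z\<close> confines the monomials,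
  and \<open>Q\<close> relates a monomial to those it reduces to. The three uses take for
  \<open>J\<close> the polynomials vanishing on \<open>points S\<close>, those vanishing at a
  generic point (with \<open>Q\<close> descent in a term order), and those of the ideal vanishing at
  a chosen point (with \<open>Q\<close> equality of multidegrees).\<close>

locale reduction =
  fixes S :: "(nat \<times> nat \<times> nat) set" and J :: "'k::field zpoly set" and Z :: "zmonom set"
    and Q :: "zmonom \<Rightarrow> zmonom \<Rightarrow> bool"
  assumes J_0: "0 \<in> J" and J_add: "f \<in> J \<Longrightarrow> g \<in> J \<Longrightarrow> f + g \<in> J"
    and J_scale: "f \<in> J \<Longrightarrow> Poly_Mapping.single 0 a * f \<in> J"
    and J_minor: "(p, q, s) \<in> S \<Longrightarrow> chain p q s f' h' \<Longrightarrow> x + chain_monom s f' h' \<in> Z \<Longrightarrow>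
      Poly_Mapping.single x 1 * gen_minor zv s f' h' \<in> J"
    and Q_refl: "m \<in> Z \<Longrightarrow> Q m m"
    and Q_trans: "Q m m' \<Longrightarrow> Q m' m'' \<Longrightarrow> Q m m''"
    and Q_step: "(p, q, s) \<in> S \<Longrightarrow> chain p q s f' h' \<Longrightarrow> x + chain_monom s f' h' \<in> Z \<Longrightarrow>
      k \<in> Poly_Mapping.keys (gen_minor zv s f' h' :: 'k zpoly) \<Longrightarrow>
      x + k \<in> Z \<and> Q (x + chain_monom s f' h') (x + k)"
begin

lemma J_sum: "(\<And>a. a \<in> A \<Longrightarrow> f a \<in> J) \<Longrightarrow> sum f A \<in> J"
  by (induction A rule: infinite_finite_induct) (simp_all add: J_0 J_add)

lemma reduce_sum:
  fixes r :: "'k zpoly"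
  assumes "\<And>k. k \<in> Poly_Mapping.keys r \<Longrightarrow>
      \<exists>g. Poly_Mapping.single k 1 - g \<in> J \<and> (\<forall>v\<in>Poly_Mapping.keys g. P k v)"
  shows "\<exists>g. r - g \<in> J \<and> (\<forall>v\<in>Poly_Mapping.keys g. \<exists>k\<in>Poly_Mapping.keys r. P k v)"
proof -
  have "\<forall>k\<in>Poly_Mapping.keys r. \<exists>g. Poly_Mapping.single k 1 - g \<in> J \<and> (\<forall>v\<in>Poly_Mapping.keys g. P k v)"
    using assms by blast
  then obtain G where G: "\<forall>k\<in>Poly_Mapping.keys r. Poly_Mapping.single k 1 - G k \<in> J \<and>
      (\<forall>v\<in>Poly_Mapping.keys (G k). P k v)"
    by (rule bchoice[THEN exE])
  let ?c = "\<lambda>k. Poly_Mapping.single 0 (Poly_Mapping.lookup r k) :: 'k zpoly"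
  let ?g = "\<Sum>k\<in>Poly_Mapping.keys r. ?c k * G k"
  have "(\<Sum>k\<in>Poly_Mapping.keys r. Poly_Mapping.single k (Poly_Mapping.lookup r k)) =
      (\<Sum>k\<in>Poly_Mapping.keys r. ?c k * Poly_Mapping.single k 1)"
    by (simp add: mult_single)
  with poly_sum_singles have "r = (\<Sum>k\<in>Poly_Mapping.keys r. ?c k * Poly_Mapping.single k 1)"
    by (rule trans)
  then have "r - ?g = (\<Sum>k\<in>Poly_Mapping.keys r. ?c k * Poly_Mapping.single k 1) - ?g"
    by (rule arg_cong)
  also have "\<dots> = (\<Sum>k\<in>Poly_Mapping.keys r. ?c k * (Poly_Mapping.single k 1 - G k))"
    by (simp only: right_diff_distrib sum_subtractf)
  also have "\<dots> \<in> J"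
    by (rule J_sum, rule J_scale) (use G in blast)
  finally have "r - ?g \<in> J" .
  moreover have "\<exists>k\<in>Poly_Mapping.keys r. P k v" if v: "v \<in> Poly_Mapping.keys ?g" for v
  proof -
    have "v \<in> (\<Union>k\<in>Poly_Mapping.keys r. Poly_Mapping.keys (?c k * G k))"
      by (rule subsetD[OF keys_sum v])
    then obtain k where k: "k \<in> Poly_Mapping.keys r" "v \<in> Poly_Mapping.keys (?c k * G k)" by blast
    have "Poly_Mapping.keys (?c k * G k) \<subseteq> Poly_Mapping.keys (G k)"
      using keys_mult[of "?c k" "G k"] by (auto split: if_splits)
    with k G show ?thesis by blast
  qed
  ultimately show ?thesis by blast
qed

text \<open>Replacing a diagonal term by the other terms of its minor lowers the natural number
  \<open>diag_weight\<close>, so the process stops for every choice of \<open>Q\<close>.\<close>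

lemma reduce_monom:
  assumes "m \<in> Z"
  shows "\<exists>g. Poly_Mapping.single m 1 - g \<in> J \<and>
    (\<forall>v\<in>Poly_Mapping.keys g. \<not> chain_divides S v \<and> v \<in> Z \<and> Q m v)"
  using assms
proof (induction "diag_weight m" arbitrary: m rule: less_induct)
  case less
  show ?case
  proof (cases "chain_divides S m")
    case False
    with less.prems J_0 Q_refl show ?thesis
      by (intro exI[of _ "Poly_Mapping.single m 1"]) simp
  next
    case True
    then obtain p q s f h where c: "(p, q, s) \<in> S" "chain p q s f h"
        "\<And>i. i < s \<Longrightarrow> (f i, h i) \<in> Poly_Mapping.keys m"
      by (rule chain_dividesE) blast
    define x where "x = m - chain_monom s f h"
    have m: "m = x + chain_monom s f h"
      unfolding x_def by (rule chain_divides_factor[OF c(2,3)])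
    have mono: "strict_mono_on {..<s} f" "strict_mono_on {..<s} h" using c(2) by (auto simp: chain_def)
    obtain r :: "'k zpoly" where r: "gen_minor zv s f h = Poly_Mapping.single (chain_monom s f h) 1 + r"
      "\<And>k. k \<in> Poly_Mapping.keys r \<Longrightarrow> \<exists>\<sigma>. \<sigma> permutes {..<s} \<and> \<sigma> \<noteq> id \<and> k = chain_monom s f (h \<circ> \<sigma>)"
      by (rule gen_minor_zv[OF mono]) blast
    have wt: "diag_weight k < diag_weight (chain_monom s f h)" if "k \<in> Poly_Mapping.keys r" for k
      using r(2)[OF that] diag_weight_less[OF mono] by blast
    have key: "k \<in> Poly_Mapping.keys (gen_minor zv s f h :: 'k zpoly)" if "k \<in> Poly_Mapping.keys r" for k
    proof -
      have "k \<noteq> chain_monom s f h" using wt[OF that] by blast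
      then show ?thesis using that by (simp add: r(1) in_keys_iff lookup_add lookup_single when_def)
    qed
    let ?r = "- (Poly_Mapping.single x 1 * r)"
    have keysr: "\<exists>k'\<in>Poly_Mapping.keys r. k = x + k'" if "k \<in> Poly_Mapping.keys ?r" for k
      using that keys_mult[of "Poly_Mapping.single x 1" r] by (auto simp: in_keys_iff)
    have step: "diag_weight k < diag_weight m \<and> k \<in> Z \<and> Q m k" if k: "k \<in> Poly_Mapping.keys ?r" for k
    proof -
      obtain k' where k': "k' \<in> Poly_Mapping.keys r" "k = x + k'" using keysr[OF k] by blast
      have "x + chain_monom s f h \<in> Z" using less.prems m by simp
      from Q_step[OF c(1,2) this key[OF k'(1)]] wt[OF k'(1)] show ?thesis
        using m k'(2) by simp
    qed
    have "\<exists>g. ?r - g \<in> J \<and> (\<forall>v\<in>Poly_Mapping.keys g. \<exists>k\<in>Poly_Mapping.keys ?r.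
        \<not> chain_divides S v \<and> v \<in> Z \<and> Q k v)"
      by (rule reduce_sum) (use less.hyps step in blast)
    then obtain g where g: "?r - g \<in> J" "\<And>v. v \<in> Poly_Mapping.keys g \<Longrightarrow> \<exists>k\<in>Poly_Mapping.keys ?r.
        \<not> chain_divides S v \<and> v \<in> Z \<and> Q k v"
      by blast
    have "Poly_Mapping.single m 1 = Poly_Mapping.single x 1 * gen_minor zv s f h + ?r"
      unfolding r(1) by (simp add: m distrib_left mult_single)
    then have "Poly_Mapping.single m 1 - g = Poly_Mapping.single x 1 * gen_minor zv s f h + (?r - g)"
      by (simp add: add_diff_eq)
    moreover have "Poly_Mapping.single x 1 * gen_minor zv s f h \<in> J"
      by (rule J_minor[OF c(1,2)]) (use less.prems m in simp)
    ultimately have "Poly_Mapping.single m 1 - g \<in> J"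
      by (simp only: J_add[OF _ g(1)])
    moreover have "\<not> chain_divides S v \<and> v \<in> Z \<and> Q m v" if "v \<in> Poly_Mapping.keys g" for v
      using g(2)[OF that] step Q_trans by blast
    ultimately show ?thesis by blast
  qed
qed

lemma reduce_poly:
  assumes "Poly_Mapping.keys f \<subseteq> Z"
  shows "\<exists>g. f - g \<in> J \<and>
    (\<forall>v\<in>Poly_Mapping.keys g. \<exists>m\<in>Poly_Mapping.keys f. \<not> chain_divides S v \<and> v \<in> Z \<and> Q m v)"
  by (rule reduce_sum) (use reduce_monom assms in blast)

end

section \<open>Generic points\<close>

definition mval :: "(nat \<times> nat \<Rightarrow> 'a::comm_ring_1) \<Rightarrow> zmonom \<Rightarrow> 'a" where
  "mval \<tau> m = (\<Prod>v\<in>Poly_Mapping.keys m. \<tau> v ^ Poly_Mapping.lookup m v)"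

lemma mval_superset:
  assumes "finite A" "Poly_Mapping.keys m \<subseteq> A"
  shows "mval \<tau> m = (\<Prod>v\<in>A. \<tau> v ^ Poly_Mapping.lookup m v)"
  unfolding mval_def using assms
  by (intro prod.mono_neutral_left) (auto simp: in_keys_iff)

lemma mval_add: "mval \<tau> (a + b) = mval \<tau> a * mval \<tau> b"
proof -
  let ?A = "Poly_Mapping.keys a \<union> Poly_Mapping.keys b"
  have "mval \<tau> (a + b) = (\<Prod>v\<in>?A. \<tau> v ^ Poly_Mapping.lookup (a + b) v)"
    by (rule mval_superset) (auto simp: keys_add_monom)
  also have "\<dots> = (\<Prod>v\<in>?A. \<tau> v ^ Poly_Mapping.lookup a v) * (\<Prod>v\<in>?A. \<tau> v ^ Poly_Mapping.lookup b v)"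
    by (simp add: lookup_add power_add prod.distrib)
  also have "(\<Prod>v\<in>?A. \<tau> v ^ Poly_Mapping.lookup a v) = mval \<tau> a"
    by (rule mval_superset[symmetric]) auto
  also have "(\<Prod>v\<in>?A. \<tau> v ^ Poly_Mapping.lookup b v) = mval \<tau> b"
    by (rule mval_superset[symmetric]) auto
  finally show ?thesis .
qed

lemma mval_single [simp]: "mval \<tau> (Poly_Mapping.single v e) = \<tau> v ^ e"
  by (cases "e = 0") (simp_all add: mval_def)

lemma mval_0 [simp]: "mval \<tau> 0 = 1"
  by (simp add: mval_def)

lemma mval_cong:
  "(\<And>v. v \<in> Poly_Mapping.keys m \<Longrightarrow> \<tau> v = \<tau>' v) \<Longrightarrow> mval \<tau> m = mval \<tau>' m"
  unfolding mval_def by (rule prod.cong) auto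

text \<open>Points take values in the fraction field, which contains the generic point.\<close>

definition peval :: "(nat \<times> nat \<Rightarrow> 'k::field zpoly fract) \<Rightarrow> 'k zpoly \<Rightarrow> 'k zpoly fract" where
  "peval \<tau> f = (\<Sum>m\<in>Poly_Mapping.keys f.
     to_fract (Poly_Mapping.single 0 (Poly_Mapping.lookup f m)) * mval \<tau> m)"

lemma peval_0 [simp]: "peval \<tau> 0 = 0"
  by (simp add: peval_def)

lemma peval_single [simp]:
  "peval \<tau> (Poly_Mapping.single m c) = to_fract (Poly_Mapping.single 0 c) * mval \<tau> m"
  by (cases "c = 0") (simp_all add: peval_def)

lemma peval_add: "peval \<tau> (f + g) = peval \<tau> f + peval \<tau> g"
  unfolding peval_def
  by (rule setsum_keys_plus_distrib[where f = "\<lambda>m c. to_fract (Poly_Mapping.single 0 c) * mval \<tau> m"])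
     (simp_all add: single_add distrib_right)

lemma peval_sum: "peval \<tau> (sum f A) = (\<Sum>a\<in>A. peval \<tau> (f a))"
  by (induction A rule: infinite_finite_induct) (simp_all add: peval_add)

lemma peval_mult: "peval \<tau> (f * g) = peval \<tau> f * peval \<tau> g"
proof -
  let ?F = "\<lambda>m. Poly_Mapping.single m (Poly_Mapping.lookup f m)"
  let ?G = "\<lambda>m. Poly_Mapping.single m (Poly_Mapping.lookup g m)"
  have 1: "f * g = (\<Sum>a\<in>Poly_Mapping.keys f. \<Sum>b\<in>Poly_Mapping.keys g. ?F a * ?G b)"
    unfolding sum_product[symmetric] by (simp flip: poly_sum_singles)
  have 2: "peval \<tau> (?F a * ?G b) = peval \<tau> (?F a) * peval \<tau> (?G b)" for a b
  proof -
    have "to_fract (Poly_Mapping.single 0 (Poly_Mapping.lookup f a * Poly_Mapping.lookup g b)) =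
       to_fract (Poly_Mapping.single (0::zmonom) (Poly_Mapping.lookup f a)) *
       to_fract (Poly_Mapping.single 0 (Poly_Mapping.lookup g b))"
      by (simp add: mult_single flip: to_fract_mult)
    then show ?thesis by (simp add: mult_single mval_add ac_simps)
  qed
  have "peval \<tau> (f * g) = (\<Sum>a\<in>Poly_Mapping.keys f. peval \<tau> (?F a)) * (\<Sum>b\<in>Poly_Mapping.keys g. peval \<tau> (?G b))"
    by (simp only: 1 peval_sum 2 sum_product)
  also have "\<dots> = peval \<tau> f * peval \<tau> g"
    by (simp only: peval_sum[symmetric] poly_sum_singles[symmetric])
  finally show ?thesis .
qed

lemma peval_1 [simp]: "peval \<tau> 1 = 1"
  using peval_single[of \<tau> 0 1] by simp

lemma peval_hom: "comm_ring_hom (peval \<tau>)"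
  by unfold_locales (simp_all add: peval_add peval_mult)

lemma peval_zv [simp]: "peval \<tau> (zv v) = \<tau> v"
  by (simp add: zv_def)

lemma peval_uminus: "peval \<tau> (- f) = - peval \<tau> f"
  using peval_add[of \<tau> f "- f"] by (simp add: eq_neg_iff_add_eq_0 add.commute)

lemma peval_diff: "peval \<tau> (f - g) = peval \<tau> f - peval \<tau> g"
  using peval_add[of \<tau> f "- g"] by (simp add: peval_uminus)

lemma peval_power: "peval \<tau> (f ^ k) = peval \<tau> f ^ k"
  by (induction k) (simp_all add: peval_mult)

lemma peval_gen_minor: "peval \<tau> (gen_minor \<rho> s f h) = gen_minor (\<lambda>v. peval \<tau> (\<rho> v)) s f h"
  by (rule gen_minor_hom[OF peval_hom, symmetric])

lemma peval_gen_minor_zv [simp]: "peval \<tau> (gen_minor zv s f h) = gen_minor \<tau> s f h"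
  by (simp add: peval_gen_minor)

lemma peval_cong:
  "(\<And>m v. m \<in> Poly_Mapping.keys f \<Longrightarrow> v \<in> Poly_Mapping.keys m \<Longrightarrow> \<tau> v = \<tau>' v) \<Longrightarrow>
    peval \<tau> f = peval \<tau>' f"
  unfolding peval_def by (intro sum.cong refl arg_cong2[where f = "(*)"] mval_cong) auto

lemma mval_zv: "mval zv m = (Poly_Mapping.single m 1 :: 'k::field zpoly)"
proof -
  have p: "zv v ^ e = (Poly_Mapping.single (Poly_Mapping.single v e) 1 :: 'k zpoly)" for v e
    by (induction e) (simp_all add: zv_def mult_single flip: single_add)
  have q: "(\<Prod>v\<in>A. Poly_Mapping.single (a v) 1) = (Poly_Mapping.single (sum a A) 1 :: 'k zpoly)"
    for a :: "nat \<times> nat \<Rightarrow> zmonom" and A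
    by (induction A rule: infinite_finite_induct) (simp_all add: mult_single)
  show ?thesis
    unfolding mval_def p q by (simp flip: poly_sum_singles)
qed

lemma to_fract_power: "to_fract (x ^ e) = to_fract x ^ e"
  by (induction e) simp_all

lemma to_fract_prod: "to_fract (prod f A) = (\<Prod>a\<in>A. to_fract (f a))"
  by (induction A rule: infinite_finite_induct) simp_all

lemma to_fract_sum: "to_fract (sum f A) = (\<Sum>a\<in>A. to_fract (f a))"
  by (induction A rule: infinite_finite_induct) simp_all

text \<open>The embedding into the fraction field is injective, so the tuple of variables is the
  generic point for no conditions at all.\<close>

lemma peval_generic: "peval (\<lambda>v. to_fract (zv v)) f = to_fract f"
proof -
  have 1: "mval (\<lambda>v. to_fract (zv v)) m = to_fract (Poly_Mapping.single m 1 :: 'a zpoly)" for m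
    by (simp add: to_fract_prod to_fract_power mval_def flip: mval_zv)
  have "peval (\<lambda>v. to_fract (zv v)) f = to_fract (\<Sum>m\<in>Poly_Mapping.keys f. Poly_Mapping.single m (Poly_Mapping.lookup f m))"
    unfolding peval_def 1 by (simp add: to_fract_sum mult_single flip: to_fract_mult)
  then show ?thesis by (simp flip: poly_sum_singles)
qed

section \<open>Points satisfying rank conditions and genericity\<close>

definition points :: "(nat \<times> nat \<times> nat) set \<Rightarrow> (nat \<times> nat \<Rightarrow> 'k::field zpoly fract) set" where
  "points S = {\<tau>. \<forall>(p, q, s)\<in>S. minors_vanish \<tau> p q s}"

lemma pointsD: "\<tau> \<in> points S \<Longrightarrow> (p, q, s) \<in> S \<Longrightarrow> minors_vanish \<tau> p q s"
  by (auto simp: points_def)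

lemma points_antimono: "S \<subseteq> S' \<Longrightarrow> points S' \<subseteq> points S"
  by (auto simp: points_def)

text \<open>The second clause is linear independence of the values of standard monomials. Since
  reduction shows that these span modulo the polynomials vanishing on \<open>points S\<close>, this
  is genericity in the usual sense, as \<open>generic_point_transfer\<close> states.\<close>

definition generic_point :: "(nat \<times> nat \<times> nat) set \<Rightarrow> (nat \<times> nat \<Rightarrow> 'k::field zpoly fract) \<Rightarrow> bool" where
  "generic_point S \<sigma> \<longleftrightarrow> \<sigma> \<in> points S \<and>
     (\<forall>f. peval \<sigma> f = 0 \<longrightarrow> (\<forall>m\<in>Poly_Mapping.keys f. \<not> chain_divides S m) \<longrightarrow> f = 0)"

text \<open>Modulo polynomials vanishing on all of \<open>points S\<close>, \<open>f\<close> equals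
  a standard combination \<open>g\<close>. Vanishing at \<open>\<sigma>\<close> forces
  \<open>g = 0\<close>.\<close>

lemma generic_point_transfer:
  assumes "generic_point S \<sigma>" "peval \<sigma> f = 0" "\<tau> \<in> points S"
  shows "peval \<tau> f = 0"
proof -
  interpret reduction S "{f. \<forall>\<tau>\<in>points S. peval \<tau> f = 0}" UNIV "\<lambda>_ _. True"
  proof (unfold_locales, goal_cases)
    case (4 p q s f' h' x)
    have "gen_minor \<tau> s f' h' = 0" if "\<tau> \<in> points S" for \<tau>
      by (rule minors_vanishD[OF pointsD[OF that 4(1)]]) (use 4(2) in \<open>auto simp: chain_def\<close>)
    then show ?case by (auto simp: peval_mult)
  qed (simp_all add: peval_add peval_mult)
  obtain g where g: "\<And>\<tau>. \<tau> \<in> points S \<Longrightarrow> peval \<tau> (f - g) = 0"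
      "\<And>v. v \<in> Poly_Mapping.keys g \<Longrightarrow> \<not> chain_divides S v"
    using reduce_poly[of f] by blast
  have "peval \<sigma> g = 0"
    using g(1)[of \<sigma>] assms(1,2) by (simp add: generic_point_def peval_diff)
  then have "g = 0"
    using assms(1) g(2) by (simp add: generic_point_def)
  then show ?thesis using g(1)[OF assms(3)] by simp
qed

section \<open>Solving for the variable of a southeast corner\<close>

definition clear_var :: "nat \<times> nat \<Rightarrow> zmonom \<Rightarrow> zmonom" where
  "clear_var y m = Poly_Mapping.update y 0 m"

lemma lookup_clear_var: "Poly_Mapping.lookup (clear_var y m) v = (if v = y then 0 else Poly_Mapping.lookup m v)"
  by (simp add: clear_var_def lookup_update)

lemma keys_clear_var: "Poly_Mapping.keys (clear_var y m) = Poly_Mapping.keys m - {y}"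
  by (auto simp: in_keys_iff lookup_clear_var split: if_splits)

lemma clear_var_add: "clear_var y m + Poly_Mapping.single y (Poly_Mapping.lookup m y) = m"
  by (rule poly_mapping_eqI) (auto simp: lookup_add lookup_clear_var lookup_single when_def)

lemma mval_clear_var: "mval \<tau> m = mval \<tau> (clear_var y m) * \<tau> y ^ Poly_Mapping.lookup m y"
  using mval_add[of \<tau> "clear_var y m" "Poly_Mapping.single y (Poly_Mapping.lookup m y)"]
  by (simp add: clear_var_add)

lemma clear_var_inj:
  "clear_var y m = clear_var y m' \<Longrightarrow> Poly_Mapping.lookup m y = Poly_Mapping.lookup m' y \<Longrightarrow> m = m'"
  by (metis clear_var_add)

text \<open>If \<open>-r/g\<close> is the value of \<open>y\<close> and \<open>f\<close> vanishes, then clearing denominators and passing to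
  a point where \<open>g\<close> vanishes but \<open>r\<close> does not leaves only the leading coefficient of \<open>f\<close> in \<open>y\<close>.\<close>

lemma leading_coeff_vanishes:
  fixes f g r :: "'k::field zpoly" and y :: "nat \<times> nat"
  assumes f: "peval (\<sigma>(y := - peval \<sigma> r / peval \<sigma> g)) f = 0"
    and g: "peval \<sigma> g \<noteq> 0" "peval \<tau> g = 0" and r: "peval \<tau> r \<noteq> 0"
    and transfer: "\<And>f. peval \<sigma> f = 0 \<Longrightarrow> peval \<tau> f = 0"
    and d: "\<And>m. m \<in> Poly_Mapping.keys f \<Longrightarrow> Poly_Mapping.lookup m y \<le> d"
  shows "peval \<tau> (\<Sum>m\<in>{m\<in>Poly_Mapping.keys f. Poly_Mapping.lookup m y = d}.
    Poly_Mapping.single (clear_var y m) (Poly_Mapping.lookup f m)) = 0"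
proof -
  let ?e = "\<lambda>m. Poly_Mapping.lookup m y"
  let ?K = "Poly_Mapping.keys f"
  let ?t = "\<lambda>m. Poly_Mapping.single (clear_var y m) (Poly_Mapping.lookup f m)"
  define u where "u = - peval \<sigma> r / peval \<sigma> g"
  have u: "- peval \<sigma> r = peval \<sigma> g * u" using g(1) by (simp add: u_def)
  let ?\<sigma> = "\<sigma>(y := u)"
  \<comment> \<open>\<open>H\<close> is \<open>f\<close> with \<open>- r / g\<close> substituted for
    \<open>y\<close>, multiplied by \<open>g ^ d\<close> so that it is a polynomial and can be
    transferred to \<open>\<tau>\<close>.\<close>
  define H where "H = (\<Sum>m\<in>?K. ?t m * (- r) ^ ?e m * g ^ (d - ?e m))"
  have "peval \<sigma> H = (\<Sum>m\<in>?K. peval \<sigma> g ^ d *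
     (to_fract (Poly_Mapping.single 0 (Poly_Mapping.lookup f m)) * mval ?\<sigma> m))"
    unfolding H_def peval_sum
  proof (intro sum.cong refl)
    fix m assume m: "m \<in> ?K"
    have mv: "mval ?\<sigma> (clear_var y m) = mval \<sigma> (clear_var y m)"
      by (rule mval_cong) (simp add: keys_clear_var)
    have "peval \<sigma> g ^ d = peval \<sigma> g ^ ?e m * peval \<sigma> g ^ (d - ?e m)"
      using d[OF m] by (simp flip: power_add)
    then show "peval \<sigma> (?t m * (- r) ^ ?e m * g ^ (d - ?e m)) = peval \<sigma> g ^ d *
      (to_fract (Poly_Mapping.single 0 (Poly_Mapping.lookup f m)) * mval ?\<sigma> m)"
      by (simp add: peval_mult peval_power peval_uminus mval_clear_var[of ?\<sigma> m y] mv u power_mult_distrib)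
  qed
  also have "\<dots> = peval \<sigma> g ^ d * peval ?\<sigma> f"
    by (simp add: peval_def sum_distrib_left)
  finally have "peval \<sigma> H = 0" using f by (simp add: u_def)
  then have "peval \<tau> H = 0" by (rule transfer)
  \<comment> \<open>At \<open>\<tau>\<close> a positive power of \<open>g\<close> is zero, so only
    exponent \<open>d\<close> survives.\<close>
  moreover have "peval \<tau> H = (\<Sum>m\<in>?K. if ?e m = d then peval \<tau> (?t m) * (- peval \<tau> r) ^ d else 0)"
    unfolding H_def peval_sum
  proof (intro sum.cong refl)
    fix m assume m: "m \<in> ?K"
    show "peval \<tau> (?t m * (- r) ^ ?e m * g ^ (d - ?e m)) = (if ?e m = d then peval \<tau> (?t m) * (- peval \<tau> r) ^ d else 0)"
      using d[OF m] g(2) by (simp add: peval_mult peval_power peval_uminus power_0_left)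
  qed
  moreover have "\<dots> = (\<Sum>m\<in>{m\<in>?K. ?e m = d}. peval \<tau> (?t m) * (- peval \<tau> r) ^ d)"
    by (rule sum.inter_filter[symmetric]) simp
  moreover have "\<dots> = peval \<tau> (\<Sum>m\<in>{m\<in>?K. ?e m = d}. ?t m) * (- peval \<tau> r) ^ d"
    by (simp only: peval_sum sum_distrib_right)
  ultimately show ?thesis using r by simp
qed

lemma chain_extend:
  assumes "chain p q s f h"
  shows "chain (Suc p) (Suc q) (Suc s) (f(s := Suc p)) (h(s := Suc q))"
  using assms unfolding chain_def strict_mono_on_def
  by (auto simp: less_Suc_eq le_imp_less_Suc intro: le_SucI)

text \<open>Standardness passes to the smaller sets. If \<open>y\<close> does not occur in a
  standard \<open>F\<close>, then \<open>F\<close> is also standard for \<open>N\<close>. Otherwise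
  its leading coefficient in \<open>y\<close> is standard for \<open>insert (p, q, s) N\<close>,
  since a chain for \<open>(p, q, s)\<close> followed by \<open>y\<close> is a chain for the corner.
  In both cases genericity of the smaller set gives zero.\<close>

lemma generic_point_step:
  fixes \<sigma>N \<sigma>C :: "nat \<times> nat \<Rightarrow> 'k::field zpoly fract" and p q :: nat
  defines "y \<equiv> (Suc p, Suc q)"
  assumes N: "N = insert (p, Suc q, Suc s) (insert (Suc p, q, Suc s) S0)"
    and \<sigma>N: "generic_point N \<sigma>N" and \<sigma>C: "generic_point (insert (p, q, s) N) \<sigma>C"
    and corner: "\<And>p' q' s'. (p', q', s') \<in> S0 \<Longrightarrow> \<not> (Suc p \<le> p' \<and> Suc q \<le> q')"
    and ch: "chain p q s f h"
    and g: "gen_minor \<sigma>N s f h \<noteq> 0"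
    and r: "gen_minor (\<sigma>C(y := 0)) (Suc s) (f(s := Suc p)) (h(s := Suc q)) \<noteq> 0"
  shows "\<exists>\<sigma> :: nat \<times> nat \<Rightarrow> 'k zpoly fract. generic_point (insert (Suc p, Suc q, Suc s) S0) \<sigma>"
proof -
  let ?f = "f(s := Suc p)" and ?h = "h(s := Suc q)"
  let ?S = "insert (Suc p, Suc q, Suc s) S0"
  define G :: "'k zpoly" where "G = gen_minor zv s f h"
  define R :: "'k zpoly" where "R = gen_minor (zv(y := 0)) (Suc s) ?f ?h"
  have G: "peval \<tau> G = gen_minor \<tau> s f h" for \<tau> by (simp add: G_def)
  have R: "peval \<tau> R = gen_minor (\<tau>(y := 0)) (Suc s) ?f ?h" for \<tau>
    unfolding R_def peval_gen_minor by (rule gen_minor_cong) simp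
  define c where "c = - peval \<sigma>N R / peval \<sigma>N G"
  define \<sigma> where "\<sigma> = \<sigma>N(y := c)"
  have fh: "f i \<in> {1..p}" "h i \<in> {1..q}" if "i < s" for i
    using ch that by (auto simp: chain_def)
  have van: "minors_vanish \<sigma> p' q' s'" if "(p', q', s') \<in> N" "\<not> (Suc p \<le> p' \<and> Suc q \<le> q')" for p' q' s'
  proof -
    have "minors_vanish \<sigma> p' q' s' = minors_vanish \<sigma>N p' q' s'"
      by (rule minors_vanish_cong) (use that(2) in \<open>auto simp: \<sigma>_def y_def\<close>)
    then show ?thesis using that(1) \<sigma>N by (auto simp: generic_point_def points_def)
  qed
  have "gen_minor \<sigma> s f h = gen_minor \<sigma>N s f h"
  proof (rule gen_minor_cong)
    fix i j assume "i < s" "j < s"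
    then have "f i \<noteq> Suc p" using fh(1)[of i] by auto
    then show "\<sigma> (f i, h j) = \<sigma>N (f i, h j)" by (simp add: \<sigma>_def y_def)
  qed
  then have g\<sigma>: "gen_minor \<sigma> s f h = peval \<sigma>N G" by (simp add: G)
  have "\<sigma>(y := 0) = \<sigma>N(y := 0)" by (simp add: \<sigma>_def)
  then have r\<sigma>: "gen_minor (\<sigma>(y := 0)) (Suc s) ?f ?h = peval \<sigma>N R" by (simp add: R)
  have "gen_minor \<sigma> (Suc s) ?f ?h = \<sigma> (?f s, ?h s) * gen_minor \<sigma> s ?f ?h
      + gen_minor (\<sigma>((?f s, ?h s) := 0)) (Suc s) ?f ?h"
    by (rule gen_minor_corner) (use fh in force)+
  also have "gen_minor \<sigma> s ?f ?h = gen_minor \<sigma> s f h"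
    by (rule gen_minor_cong) simp
  also have "\<sigma> (?f s, ?h s) = c"
    by (simp add: \<sigma>_def y_def)
  also have "\<sigma>((?f s, ?h s) := 0) = \<sigma>(y := 0)"
    by (simp add: y_def)
  finally have "gen_minor \<sigma> (Suc s) ?f ?h = c * peval \<sigma>N G + peval \<sigma>N R"
    by (simp only: r\<sigma> g\<sigma>)
  also have "\<dots> = 0"
    using g by (simp add: c_def G)
  finally have det0: "gen_minor \<sigma> (Suc s) ?f ?h = 0" .
  \<comment> \<open>The choice of \<open>c\<close> kills a single minor;
    \<open>minors_vanish_corner\<close> and the conditions in \<open>N\<close> extend this to all
    minors of the corner block.\<close>
  have "minors_vanish \<sigma> (Suc p) (Suc q) (Suc s)"
  proof (rule minors_vanish_corner[OF _ _ fh _ det0])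
    show "minors_vanish \<sigma> p (Suc q) (Suc s)" "minors_vanish \<sigma> (Suc p) q (Suc s)"
      by (rule van; simp add: N)+
    show "gen_minor \<sigma> s f h \<noteq> 0" using g g\<sigma> G by simp
  qed
  moreover have "minors_vanish \<sigma> p' q' s'" if "(p', q', s') \<in> S0" for p' q' s'
    by (rule van) (use that corner N in auto)
  ultimately have pts: "\<sigma> \<in> points ?S" by (auto simp: points_def)
  \<comment> \<open>The two conditions of \<open>N\<close> outside \<open>S0\<close> have the size
    of the corner condition on smaller blocks.\<close>
  have N_S: "chain_divides ?S m" if "chain_divides N m" for m
    using that
  proof (rule chain_dividesE)
    fix p' q' s' f' h'
    assume *: "(p', q', s') \<in> N" "chain p' q' s' f' h'" "\<And>i. i < s' \<Longrightarrow> (f' i, h' i) \<in> Poly_Mapping.keys m"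
    show ?thesis
    proof (cases "(p', q', s') \<in> S0")
      case True
      then show ?thesis by (intro chain_dividesI[OF _ *(2,3)]) auto
    next
      case False
      then have "s' = Suc s" "p' \<le> Suc p" "q' \<le> Suc q" using *(1) N by auto
      then have "chain (Suc p) (Suc q) (Suc s) f' h'" using *(2) by (auto simp: chain_def)
      then show ?thesis using *(3) \<open>s' = _\<close> by (intro chain_dividesI) auto
    qed
  qed
  have "F = 0" if F: "peval \<sigma> F = 0" "\<forall>m\<in>Poly_Mapping.keys F. \<not> chain_divides ?S m" for F
  proof (rule ccontr)
    assume "F \<noteq> 0"
    then have ne: "Poly_Mapping.keys F \<noteq> {}" by simp
    define d where "d = Max ((\<lambda>m. Poly_Mapping.lookup m y) ` Poly_Mapping.keys F)"
    have d: "Poly_Mapping.lookup m y \<le> d" if "m \<in> Poly_Mapping.keys F" for m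
      unfolding d_def using that by (intro Max_ge) auto
    have "d \<in> (\<lambda>m. Poly_Mapping.lookup m y) ` Poly_Mapping.keys F"
      unfolding d_def using ne by (intro Max_in) auto
    then obtain m0 where m0: "m0 \<in> Poly_Mapping.keys F" "Poly_Mapping.lookup m0 y = d" by auto
    show False
    proof (cases "d = 0")
      case True
      have "peval \<sigma> F = peval \<sigma>N F"
      proof (rule peval_cong)
        fix m v assume "m \<in> Poly_Mapping.keys F" "v \<in> Poly_Mapping.keys m"
        then show "\<sigma> v = \<sigma>N v" using d[of m] True by (auto simp: \<sigma>_def in_keys_iff)
      qed
      then have "peval \<sigma>N F = 0" using F(1) by simp
      moreover have "\<forall>m\<in>Poly_Mapping.keys F. \<not> chain_divides N m" using F(2) N_S by blast
      ultimately show False using \<sigma>N \<open>F \<noteq> 0\<close> unfolding generic_point_def by blast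
    next
      case False
      let ?T = "{m\<in>Poly_Mapping.keys F. Poly_Mapping.lookup m y = d}"
      let ?L = "\<Sum>m\<in>?T. Poly_Mapping.single (clear_var y m) (Poly_Mapping.lookup F m)"
      have "peval \<sigma>C ?L = 0"
      proof (rule leading_coeff_vanishes[where r = R and g = G and \<sigma> = \<sigma>N])
        show "peval (\<sigma>N(y := - peval \<sigma>N R / peval \<sigma>N G)) F = 0"
          using F(1) by (simp add: \<sigma>_def c_def)
        show "peval \<sigma>N G \<noteq> 0" "peval \<sigma>C R \<noteq> 0" using g r by (simp_all add: G R)
        have "minors_vanish \<sigma>C p q s"
          using \<sigma>C by (auto simp: generic_point_def points_def)
        then show "peval \<sigma>C G = 0" unfolding G by (rule minors_vanishD) (use fh in auto)
        show "peval \<sigma>C H = 0" if "peval \<sigma>N H = 0" for H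
          using \<sigma>C points_antimono[of N "insert (p, q, s) N"]
          by (intro generic_point_transfer[OF \<sigma>N that]) (auto simp: generic_point_def)
      qed (rule d)
      \<comment> \<open>Here \<open>k\<close> is a monomial \<open>m\<close> of \<open>F\<close>
        with \<open>y\<close> removed, and \<open>y\<close> divides \<open>m\<close> because
        \<open>d\<close> is positive. A forbidden chain in \<open>k\<close> yields one in
        \<open>m\<close>.\<close>
      moreover have "\<not> chain_divides (insert (p, q, s) N) k" if k: "k \<in> Poly_Mapping.keys ?L" for k
      proof
        assume cd: "chain_divides (insert (p, q, s) N) k"
        have "k \<in> (\<Union>m\<in>?T. Poly_Mapping.keys (Poly_Mapping.single (clear_var y m) (Poly_Mapping.lookup F m)))"
          by (rule subsetD[OF keys_sum k])
        then obtain m where m: "m \<in> Poly_Mapping.keys F" "Poly_Mapping.lookup m y = d" "k = clear_var y m"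
          by (auto split: if_splits)
        have km: "Poly_Mapping.keys k \<subseteq> Poly_Mapping.keys m" by (auto simp: m(3) keys_clear_var)
        have ym: "y \<in> Poly_Mapping.keys m" using False m(2) by (simp add: in_keys_iff)
        from cd have "chain_divides ?S m"
        proof (rule chain_dividesE)
          fix p' q' s' f' h'
          assume *: "(p', q', s') \<in> insert (p, q, s) N" "chain p' q' s' f' h'"
            "\<And>i. i < s' \<Longrightarrow> (f' i, h' i) \<in> Poly_Mapping.keys k"
          show ?thesis
          proof (cases "(p', q', s') \<in> N")
            case True
            then have "chain_divides N m" using * km by (intro chain_dividesI) auto
            then show ?thesis by (rule N_S)
          next
            case False
            then have e: "p' = p" "q' = q" "s' = s" using *(1) by auto
            have "chain (Suc p) (Suc q) (Suc s) (f'(s := Suc p)) (h'(s := Suc q))"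
              using *(2) unfolding e by (rule chain_extend)
            then show ?thesis
              by (rule chain_dividesI[rotated]) (use *(3) km ym e y_def in \<open>auto simp: less_Suc_eq\<close>)
          qed
        qed
        with F(2) m(1) show False by blast
      qed
      ultimately have L: "?L = 0" using \<sigma>C by (simp add: generic_point_def)
      \<comment> \<open>\<open>clear_var y\<close> is injective on monomials of equal degree in
        \<open>y\<close>, so nothing cancels in the leading coefficient.\<close>
      have "Poly_Mapping.lookup ?L (clear_var y m0) = (\<Sum>m\<in>?T. if m = m0 then Poly_Mapping.lookup F m0 else 0)"
        unfolding lookup_sum
      proof (intro sum.cong refl)
        fix m assume "m \<in> ?T"
        then have "clear_var y m = clear_var y m0 \<longleftrightarrow> m = m0"
          using clear_var_inj[of y m m0] m0(2) by auto
        then show "Poly_Mapping.lookup (Poly_Mapping.single (clear_var y m) (Poly_Mapping.lookup F m)) (clear_var y m0)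
           = (if m = m0 then Poly_Mapping.lookup F m0 else 0)"
          by (auto simp: lookup_single when_def)
      qed
      also have "\<dots> = Poly_Mapping.lookup F m0" using m0 by simp
      finally show False using L m0(1) by (simp add: in_keys_iff)
    qed
  qed
  with pts show ?thesis unfolding generic_point_def by blast
qed

text \<open>Sizes are positive because the empty minor is 1: a condition of size 0 has no
  points.\<close>

definition ladder :: "(nat \<times> nat \<times> nat) set \<Rightarrow> bool" where
  "ladder S \<longleftrightarrow> finite S \<and> (\<forall>(p, q, s)\<in>S. 0 < s) \<and>
     (\<forall>(p, q, s)\<in>S. \<forall>(p', q', s')\<in>S. \<not> (p < p' \<and> q < q'))"

lemma ladderD:
  assumes "ladder S"
  shows "finite S" "(p, q, s) \<in> S \<Longrightarrow> 0 < s"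
    "(p, q, s) \<in> S \<Longrightarrow> (p', q', s') \<in> S \<Longrightarrow> \<not> (p < p' \<and> q < q')"
  using assms unfolding ladder_def by fast+

definition region :: "(nat \<times> nat \<times> nat) set \<Rightarrow> (nat \<times> nat) set" where
  "region S = (\<Union>(p, q, s)\<in>S. {1..p} \<times> {1..q})"

lemma points_insert:
  "\<tau> \<in> points (insert (p, q, s) S) \<longleftrightarrow> minors_vanish \<tau> p q s \<and> \<tau> \<in> points S"
  by (auto simp: points_def)

text \<open>Either the block is too small for a nonzero minor of this size, or another condition
  implies this one because every added row or column raises the rank by at most one.\<close>

definition redundant :: "(nat \<times> nat \<times> nat) set \<Rightarrow> nat \<times> nat \<times> nat \<Rightarrow> bool" where
  "redundant S t \<longleftrightarrow> (case t of (p, q, s) \<Rightarrow> p < s \<or> q < s \<or>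
     (\<exists>(p', q', s')\<in>S - {t}. s' + (p - p') + (q - q') \<le> s))"

lemma redundantI:
  assumes "(p', q', s') \<in> S" "(p', q', s') \<noteq> (p, q, s)" "s' + (p - p') + (q - q') \<le> s"
  shows "redundant S (p, q, s)"
proof -
  have "\<exists>(p', q', s')\<in>S - {(p, q, s)}. s' + (p - p') + (q - q') \<le> s"
    by (rule bexI[of _ "(p', q', s')"]) (use assms in auto)
  then show ?thesis by (simp add: redundant_def)
qed

text \<open>A redundant condition holds automatically, and dropping it can only enlarge the set of
  standard monomials, so linear independence is inherited.\<close>

lemma generic_point_redundant:
  assumes "t \<in> S" "redundant S t" "generic_point (S - {t}) \<sigma>"
  shows "generic_point S \<sigma>"
proof -
  obtain p q s where t: "t = (p, q, s)" by (cases t)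
  have pts: "minors_vanish \<sigma> p' q' s'" if "(p', q', s') \<in> S - {t}" for p' q' s'
    using assms(3) that unfolding generic_point_def by (blast dest: pointsD)
  consider "p < s" | "q < s" | p' q' s' where "(p', q', s') \<in> S - {t}" "s' + (p - p') + (q - q') \<le> s"
    using assms(2) unfolding redundant_def t by auto
  then have "minors_vanish \<sigma> p q s"
    by cases (auto intro: minors_vanish_few_rows minors_vanish_few_cols minors_vanish_add[OF pts])
  then have "\<sigma> \<in> points S"
    using pts unfolding points_def t by blast
  moreover have "chain_divides S m" if "chain_divides (S - {t}) m" for m
    using that by (rule chain_divides_mono) auto
  ultimately show ?thesis using assms(3) unfolding generic_point_def by blast
qed

lemma generic_point_empty: "generic_point {} (\<lambda>v. to_fract (zv v :: 'k::field zpoly))"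
  by (simp add: generic_point_def points_def peval_generic)

text \<open>The corner step for \<open>s = 0\<close>, treated apart because \<open>(p, q, 0)\<close>
  would have no points. The new minor is \<open>y\<close> itself: standard monomials avoid
  \<open>y\<close>, and its value becomes 0.\<close>

lemma generic_point_variable:
  fixes \<sigma> :: "nat \<times> nat \<Rightarrow> 'k::field zpoly fract" and p q :: nat
  assumes N: "N = insert (p, Suc q, 1) (insert (Suc p, q, 1) S0)" and \<sigma>: "generic_point N \<sigma>"
    and corner: "\<And>p' q' s'. (p', q', s') \<in> S0 \<Longrightarrow> \<not> (Suc p \<le> p' \<and> Suc q \<le> q')"
  shows "generic_point (insert (Suc p, Suc q, 1) S0) (\<sigma>((Suc p, Suc q) := 0))"
proof -
  let ?y = "(Suc p, Suc q)" and ?S = "insert (Suc p, Suc q, 1) S0"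
  let ?\<sigma> = "\<sigma>(?y := 0)"
  have pts: "minors_vanish \<sigma> p' q' s'" if "(p', q', s') \<in> N" for p' q' s'
    using \<sigma> that unfolding generic_point_def by (blast dest: pointsD)
  have "minors_vanish ?\<sigma> (Suc p) (Suc q) 1"
    unfolding minors_vanish_def
  proof (intro allI impI)
    fix f h :: "nat \<Rightarrow> nat" assume "\<forall>i<1. f i \<in> {1..Suc p} \<and> h i \<in> {1..Suc q}"
    then have fh: "f 0 \<in> {1..Suc p}" "h 0 \<in> {1..Suc q}" by auto
    have "\<sigma> (f 0, h 0) = 0" if "(f 0, h 0) \<noteq> ?y"
    proof -
      have "gen_minor \<sigma> 1 f h = 0"
      proof (cases "f 0 = Suc p")
        case True
        then show ?thesis using fh that
          by (intro minors_vanishD[OF pts[of "Suc p" q 1]]) (auto simp: N)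
      next
        case False
        then show ?thesis using fh that
          by (intro minors_vanishD[OF pts[of p "Suc q" 1]]) (auto simp: N)
      qed
      then show ?thesis by (simp add: gen_minor_1)
    qed
    then show "gen_minor ?\<sigma> 1 f h = 0" by (simp add: gen_minor_1)
  qed
  moreover have "minors_vanish ?\<sigma> p' q' s'" if "(p', q', s') \<in> S0" for p' q' s'
  proof -
    have "minors_vanish ?\<sigma> p' q' s' = minors_vanish \<sigma> p' q' s'"
      by (rule minors_vanish_cong) (use corner[OF that] in auto)
    then show ?thesis using pts that by (simp add: N)
  qed
  ultimately have "?\<sigma> \<in> points ?S" by (auto simp: points_def)
  moreover have "F = 0" if F: "peval ?\<sigma> F = 0" "\<forall>m\<in>Poly_Mapping.keys F. \<not> chain_divides ?S m" for F
  proof -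
    have y: "?y \<notin> Poly_Mapping.keys m" if "m \<in> Poly_Mapping.keys F" for m
    proof
      assume "?y \<in> Poly_Mapping.keys m"
      then have "chain_divides ?S m"
        by (intro chain_dividesI[of "Suc p" "Suc q" 1 _ "\<lambda>_. Suc p" "\<lambda>_. Suc q"])
          (auto simp: chain_def strict_mono_on_def)
      with F(2) that show False by blast
    qed
    have "peval ?\<sigma> F = peval \<sigma> F"
      by (rule peval_cong) (use y in auto)
    moreover have "chain_divides ?S m" if "chain_divides N m" for m
      using that
    proof (rule chain_dividesE)
      fix p' q' s' f' h'
      assume *: "(p', q', s') \<in> N" "chain p' q' s' f' h'" "\<And>i. i < s' \<Longrightarrow> (f' i, h' i) \<in> Poly_Mapping.keys m"
      show ?thesis
      proof (cases "(p', q', s') \<in> S0")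
        case True
        then show ?thesis by (intro chain_dividesI[OF _ *(2,3)]) auto
      next
        case False
        then have "s' = 1" "p' \<le> Suc p" "q' \<le> Suc q" using *(1) N by auto
        then have "chain (Suc p) (Suc q) 1 f' h'" using *(2) by (auto simp: chain_def)
        then show ?thesis using *(3) \<open>s' = _\<close>
          by (intro chain_dividesI[of "Suc p" "Suc q" 1 _ f' h']) auto
      qed
    qed
    ultimately show ?thesis using F \<sigma> unfolding generic_point_def by (metis (no_types, lifting))
  qed
  ultimately show ?thesis unfolding generic_point_def by blast
qed

section \<open>Zero-one matrices witnessing nonvanishing at a corner\<close>

lemma card_dots_rows:
  assumes "inj_on fst D" "fst ` D \<subseteq> {a<..}"
  shows "card (D \<inter> {1..p} \<times> {1..q}) \<le> p - a"
proof -
  have "card (D \<inter> {1..p} \<times> {1..q}) \<le> card {a<..p}"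
    using assms by (intro card_inj_on_le[of fst]) (auto intro: inj_on_subset)
  then show ?thesis by simp
qed

lemma card_dots_cols:
  assumes "inj_on snd D" "snd ` D \<subseteq> {a<..}"
  shows "card (D \<inter> {1..p} \<times> {1..q}) \<le> q - a"
proof -
  have "card (D \<inter> {1..p} \<times> {1..q}) \<le> card {a<..q}"
    using assms by (intro card_inj_on_le[of snd]) (auto intro: inj_on_subset)
  then show ?thesis by simp
qed

definition dots :: "(nat \<times> nat) set \<Rightarrow> nat \<times> nat \<Rightarrow> 'a::zero_neq_one" where
  "dots D v = of_bool (v \<in> D)"

lemma minors_vanish_dots:
  "finite D \<Longrightarrow> card (D \<inter> {1..p} \<times> {1..q}) < s \<Longrightarrow>
    minors_vanish (dots D :: nat \<times> nat \<Rightarrow> 'a::comm_ring_1) p q s"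
  using minors_vanish_few_dots[of D p q s, where 'a = 'a] by (simp add: dots_def[abs_def])

text \<open>A polynomial that is nonzero at some point of \<open>points N\<close> is nonzero at the
  generic point, by \<open>generic_point_transfer\<close>. So one 0/1 matrix is needed for
  \<open>g\<close> and one for \<open>r\<close>. The dots are packed into the last rows and columns
  of the corner block, where other blocks meet them least.\<close>

lemma generic_point_corner:
  fixes p q s :: nat and \<sigma>N \<sigma>C :: "nat \<times> nat \<Rightarrow> 'k::field zpoly fract"
  defines "t \<equiv> (Suc p, Suc q, Suc s)"
  assumes S: "ladder (insert t S0)" and t: "t \<notin> S0" "\<not> redundant (insert t S0) t"
    and corner: "\<And>p' q' s'. (p', q', s') \<in> S0 \<Longrightarrow> \<not> (Suc p \<le> p' \<and> Suc q \<le> q')"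
    and N: "N = insert (p, Suc q, Suc s) (insert (Suc p, q, Suc s) S0)" and s: "0 < s"
    and \<sigma>N: "generic_point N \<sigma>N" and \<sigma>C: "generic_point (insert (p, q, s) N) \<sigma>C"
  shows "\<exists>\<sigma> :: nat \<times> nat \<Rightarrow> 'k zpoly fract. generic_point (insert t S0) \<sigma>"
proof -
  define f h where "f i = Suc (p - s + i)" and "h i = Suc (q - s + i)" for i
  have sp: "s \<le> p" "s \<le> q" using t(2) unfolding redundant_def t_def by auto
  \<comment> \<open>Nonredundancy of the corner says that every other block contains fewer than
    \<open>s'\<close> of the rows, or fewer than \<open>s'\<close> of the columns, that carry
    dots.\<close>
  have bound: "p' - (p - s) < s' \<and> p' \<le> p \<or> q' - (q - s) < s' \<and> q' \<le> q"
    if S0: "(p', q', s') \<in> S0" for p' q' s'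
  proof -
    have "0 < s'" and l: "\<not> (p' < Suc p \<and> q' < Suc q)"
      using ladderD(2)[OF S, of p' q' s'] ladderD(3)[OF S, of p' q' s' "Suc p" "Suc q" "Suc s"] S0
      by (auto simp: t_def)
    have "(p', q', s') \<noteq> t" using S0 t(1) by auto
    with t(2) S0 have nr: "\<not> s' + (Suc p - p') + (Suc q - q') \<le> Suc s"
      unfolding redundant_def t_def by auto
    from corner[OF S0] l consider "p' \<le> p" "q < q'" | "p < p'" "q' \<le> q" by linarith
    then show ?thesis
    proof cases
      case 1
      with nr sp \<open>0 < s'\<close> show ?thesis by (intro disjI1) linarith
    next
      case 2
      with nr sp \<open>0 < s'\<close> show ?thesis by (intro disjI2) linarith
    qed
  qed
  have vanS0: "minors_vanish (dots D :: nat \<times> nat \<Rightarrow> 'k zpoly fract) p' q' s'"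
    if D: "finite D" "inj_on fst D" "inj_on snd D" "fst ` D \<subseteq> {p - s<..}" "snd ` D \<subseteq> {q - s<..}"
      and S0: "(p', q', s') \<in> S0" for D p' q' s'
    using bound[OF S0] card_dots_rows[OF D(2,4), of p' q'] card_dots_cols[OF D(3,5), of p' q'] D(1)
    by (intro minors_vanish_dots) auto

  have ch: "chain p q s f h"
    using sp by (auto simp: chain_def f_def h_def strict_mono_on_def)
  \<comment> \<open>The formulas for \<open>f\<close> and \<open>h\<close> already give the corner
    row and column at index \<open>s\<close>.\<close>
  have fs: "f(s := Suc p) = f" and hs: "h(s := Suc q) = h"
    using sp by (auto simp: f_def h_def)

  \<comment> \<open>The identity on the last \<open>s\<close> rows and columns of the
    \<open>p\<close> x \<open>q\<close> block: \<open>g\<close> takes the value 1, and there are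
    only \<open>s\<close> dots.\<close>
  define A where "A = (\<lambda>i. (f i, h i)) ` {..<s}"
  have A: "finite A" "inj_on fst A" "inj_on snd A" "fst ` A \<subseteq> {p - s<..}" "snd ` A \<subseteq> {q - s<..}"
    by (auto simp: A_def f_def h_def inj_on_def)
  have cA: "card (A \<inter> X) \<le> s" for X
  proof -
    have "card (A \<inter> X) \<le> card A" by (intro card_mono) (auto simp: A(1))
    also have "\<dots> \<le> s" unfolding A_def using card_image_le[of "{..<s}"] by fastforce
    finally show ?thesis .
  qed
  have "(dots A :: nat \<times> nat \<Rightarrow> 'k zpoly fract) \<in> points S0"
    unfolding points_def using vanS0[OF A] by blast
  then have ptsA: "(dots A :: nat \<times> nat \<Rightarrow> 'k zpoly fract) \<in> points N"
    unfolding N points_insert by (intro conjI minors_vanish_dots A(1) le_imp_less_Suc cA)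
  have "gen_minor (dots A :: nat \<times> nat \<Rightarrow> 'k zpoly fract) s f h \<noteq> 0"
  proof (rule gen_minor_permutation_neq_0[where h' = h])
    fix i j assume "i < s" "j < s"
    then show "(dots A :: nat \<times> nat \<Rightarrow> 'k zpoly fract) (f i, h j) = of_bool (h j = h i)"
      by (auto simp: dots_def A_def f_def)
  next
    show "inj_on h {..<s}" "inj_on h {..<s}" by (simp_all add: h_def inj_on_def)
  qed auto
  with generic_point_transfer[OF \<sigma>N _ ptsA, of "gen_minor zv s f h"]
  have g: "gen_minor \<sigma>N s f h \<noteq> 0" unfolding peval_gen_minor_zv by blast

  \<comment> \<open>The identity of size \<open>s + 1\<close> with its last two columns swapped:
    dots at \<open>(p, Suc q)\<close> and \<open>(Suc p, q)\<close> instead of \<open>(p, q)\<close>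
    and the corner. The large minor stays nonzero with \<open>y = 0\<close>, while the
    \<open>p\<close> x \<open>q\<close> block keeps only \<open>s - 1\<close> dots.\<close>
  define h' where "h' = h \<circ> transpose (s - 1) s"
  have h': "h' s = q" "h' (s - 1) = Suc q" "\<And>i. i < s - 1 \<Longrightarrow> h' i = h i"
    using s sp by (auto simp: h'_def h_def transpose_def)
  have injh: "inj h" by (auto simp: h_def inj_on_def)
  have injh': "inj h'" unfolding h'_def using injh by (intro inj_compose) auto
  define B where "B = (\<lambda>i. (f i, h' i)) ` {..s}"
  have B: "finite B" "inj_on fst B" "inj_on snd B" "fst ` B \<subseteq> {p - s<..}" "snd ` B \<subseteq> {q - s<..}"
    using inj_eq[OF injh'] by (simp_all add: B_def f_def inj_on_def image_subset_iff h'_def h_def)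
  have fsp: "f s = Suc p" using sp by (simp add: f_def)
  have "i \<in> {..<s}" if "i \<le> s" "f i \<le> p" for i
    using that fsp by (cases "i = s") auto
  then have "B \<inter> {1..p} \<times> {1..Suc q} \<subseteq> (\<lambda>i. (f i, h' i)) ` {..<s}"
    unfolding B_def by auto
  from card_mono[OF _ this] have c1: "card (B \<inter> {1..p} \<times> {1..Suc q}) < Suc s"
    using card_image_le[of "{..<s}" "\<lambda>i. (f i, h' i)"] by simp
  have "i \<in> {..s} - {s - 1}" if "i \<le> s" "h' i \<le> q" for i
    using that h'(2) by auto
  then have "B \<inter> {1..Suc p} \<times> {1..q} \<subseteq> (\<lambda>i. (f i, h' i)) ` ({..s} - {s - 1})"
    unfolding B_def by auto
  from card_mono[OF _ this] have c2: "card (B \<inter> {1..Suc p} \<times> {1..q}) < Suc s"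
    using card_image_le[of "{..s} - {s - 1}" "\<lambda>i. (f i, h' i)"] by simp
  have "i \<in> {..<s - 1}" if "i \<le> s" "h' i \<le> q" "f i \<le> p" for i
  proof -
    have "i \<noteq> s" using fsp that by auto
    moreover have "i \<noteq> s - 1" using h'(2) that by auto
    ultimately show ?thesis using that by auto
  qed
  then have "B \<inter> {1..p} \<times> {1..q} \<subseteq> (\<lambda>i. (f i, h' i)) ` {..<s - 1}"
    unfolding B_def by auto
  from card_mono[OF _ this] have c3: "card (B \<inter> {1..p} \<times> {1..q}) < s"
    using card_image_le[of "{..<s - 1}" "\<lambda>i. (f i, h' i)"] s by simp
  have "(dots B :: nat \<times> nat \<Rightarrow> 'k zpoly fract) \<in> points S0"
    unfolding points_def using vanS0[OF B] by blast
  then have ptsB: "(dots B :: nat \<times> nat \<Rightarrow> 'k zpoly fract) \<in> points (insert (p, q, s) N)"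
    unfolding N points_insert by (intro conjI minors_vanish_dots B(1) c1 c2 c3)
  have "(Suc p, Suc q) \<notin> B"
  proof
    assume "(Suc p, Suc q) \<in> B"
    then obtain i where i: "f i = Suc p" "h' i = Suc q" by (auto simp: B_def)
    have "i = s" using i(1) sp by (simp add: f_def)
    with h'(1) i(2) show False by simp
  qed
  then have B0: "(dots B)((Suc p, Suc q) := 0) = (dots B :: nat \<times> nat \<Rightarrow> 'k zpoly fract)"
    by (auto simp: dots_def)
  have "gen_minor (dots B :: nat \<times> nat \<Rightarrow> 'k zpoly fract) (Suc s) f h \<noteq> 0"
  proof (rule gen_minor_permutation_neq_0[where h' = h'])
    fix i j assume "i < Suc s" "j < Suc s"
    then show "(dots B :: nat \<times> nat \<Rightarrow> 'k zpoly fract) (f i, h j) = of_bool (h j = h' i)"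
      by (auto simp: dots_def B_def f_def)
  next
    show "inj_on h {..<Suc s}" "inj_on h' {..<Suc s}"
      using injh injh' by (auto intro: inj_on_subset)
    show "h' ` {..<Suc s} \<subseteq> h ` {..<Suc s}"
      by (auto simp: h'_def transpose_def)
  qed
  moreover have ev: "peval \<tau> (gen_minor (zv((Suc p, Suc q) := 0)) (Suc s) f h) = gen_minor (\<tau>((Suc p, Suc q) := 0)) (Suc s) f h"
    for \<tau> :: "nat \<times> nat \<Rightarrow> 'k zpoly fract"
    unfolding peval_gen_minor by (rule gen_minor_cong) simp
  ultimately have r: "gen_minor (\<sigma>C((Suc p, Suc q) := 0)) (Suc s) f h \<noteq> 0"
    using generic_point_transfer[OF \<sigma>C _ ptsB, of "gen_minor (zv((Suc p, Suc q) := 0)) (Suc s) f h"]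
    unfolding ev B0 by blast
  show ?thesis
    unfolding t_def by (rule generic_point_step[OF N \<sigma>N \<sigma>C corner ch g]) (simp_all add: fs hs r)
qed

text \<open>The induction is lexicographic. Dropping a redundant condition reduces the number of
  conditions without enlarging the region; passing to \<open>N\<close> or \<open>C\<close> removes
  the corner position from the region, although it may add conditions.\<close>

lemma ladder_generic_point:
  assumes "ladder S"
  shows "\<exists>\<sigma> :: nat \<times> nat \<Rightarrow> 'k::field zpoly fract. generic_point S \<sigma>"
  using assms
proof (induction S rule: wf_induct_rule[OF wf_measures[of "[\<lambda>S. card (region S), card]"]])
  case (1 S)
  note IH = "1.IH" and S = "1.prems"
  have finS: "finite S" and fin_region: "finite (region S)"
    using ladderD(1)[OF S] by (auto simp: region_def)
  show ?case
  proof (cases "S = {}")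
    case True
    then show ?thesis using generic_point_empty by auto
  next
    case False
    show ?thesis
    proof (cases "\<exists>t\<in>S. redundant S t")
      case True
      then obtain t where t: "t \<in> S" "redundant S t" by blast
      have "card (region (S - {t})) \<le> card (region S)"
        using fin_region by (intro card_mono) (auto simp: region_def)
      moreover have "card (S - {t}) < card S"
        using finS t(1) by (rule card_Diff1_less)
      moreover have "ladder (S - {t})"
        using S by (auto simp: ladder_def)
      ultimately have "\<exists>\<sigma> :: nat \<times> nat \<Rightarrow> 'k zpoly fract. generic_point (S - {t}) \<sigma>"
        using IH[of "S - {t}"] by (cases "card (region (S - {t})) = card (region S)") simp_all
      with generic_point_redundant[OF t] show ?thesis by blast
    next
      case nonred: False
      \<comment> \<open>A box with \<open>p + q\<close> maximal is a southeast corner.\<close>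
      define size where "size t = fst t + fst (snd t)" for t :: "nat \<times> nat \<times> nat"
      have "Max (size ` S) \<in> size ` S" using finS False by (intro Max_in) auto
      then obtain t where t: "t \<in> S" "size t = Max (size ` S)" by auto
      have tmax: "size t' \<le> size t" if "t' \<in> S" for t'
        unfolding t(2) using finS that by (intro Max_ge) auto
      obtain p q s where t_eq: "t = (Suc p, Suc q, Suc s)"
      proof -
        obtain p' q' s' where t': "t = (p', q', s')" by (cases t)
        have "s' \<le> p'" "s' \<le> q'" using nonred t(1) by (auto simp: redundant_def t')
        moreover have "0 < s'" using ladderD(2)[OF S, of p' q' s'] t(1) by (simp add: t')
        ultimately show thesis using that[of "p' - 1" "q' - 1" "s' - 1"] t' by simp
      qed
      define S0 where "S0 = S - {t}"
      have St: "S = insert t S0" "t \<notin> S0" using t(1) by (auto simp: S0_def)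
      have corner: "\<not> (Suc p \<le> p' \<and> Suc q \<le> q')" if t': "(p', q', s') \<in> S0" for p' q' s'
      proof
        assume "Suc p \<le> p' \<and> Suc q \<le> q'"
        moreover have "p' + q' \<le> Suc p + Suc q"
          using tmax[of "(p', q', s')"] t' by (simp add: St size_def t_eq)
        ultimately have e: "p' = Suc p" "q' = Suc q" by auto
        show False
        \<comment> \<open>For two conditions on the same box, the one of larger size is
          redundant.\<close>
        proof (cases "s' \<le> Suc s")
          case True
          then have "redundant S t"
            unfolding t_eq using t' e St(2) by (intro redundantI[of p' q' s']) (auto simp: S0_def t_eq)
          with nonred t(1) show False by blast
        next
          case False
          then have "redundant S (p', q', s')"
            using t(1) e by (intro redundantI[of "Suc p" "Suc q" "Suc s"]) (auto simp: t_eq)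
          with nonred t' show False by (auto simp: S0_def)
        qed
      qed
      define N where "N = insert (p, Suc q, Suc s) (insert (Suc p, q, Suc s) S0)"
      define C where "C = insert (p, q, s) N"
      have fin0: "finite S0" using finS by (simp add: S0_def)
      have ladder0: "\<not> (p1 < p2 \<and> q1 < q2)" if "(p1, q1, s1) \<in> S" "(p2, q2, s2) \<in> S" for p1 q1 s1 p2 q2 s2
        by (rule ladderD(3)[OF S that])
      \<comment> \<open>A box of \<open>S0\<close> is neither strictly northwest nor weakly
        southeast of the corner. This leaves just enough room to move the corner by one step north,
        west or both.\<close>
      have near: "\<not> (a < p' \<and> b < q') \<and> \<not> (p' < a \<and> q' < b)"
        if S0: "(p', q', s') \<in> S0" and ab: "a \<in> {p, Suc p}" "b \<in> {q, Suc q}" for p' q' s' a b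
      proof -
        have "\<not> (p' < Suc p \<and> q' < Suc q)"
          by (rule ladder0[of _ _ s' _ _ "Suc s"]) (use S0 t(1) in \<open>simp_all add: S0_def t_eq\<close>)
        with corner[OF S0] ab show ?thesis by auto
      qed
      have pos0: "0 < s'" if "(p', q', s') \<in> S0" for p' q' s'
        using ladderD(2)[OF S, of p' q' s'] that by (auto simp: St(1))
      have ladder0': "\<not> (p1 < p2 \<and> q1 < q2)" if "(p1, q1, s1) \<in> S0" "(p2, q2, s2) \<in> S0" for p1 q1 s1 p2 q2 s2
        by (rule ladder0[of _ _ s1 _ _ s2]) (use that in \<open>simp_all add: St(1)\<close>)
      have memC: "(p', q', s') \<in> S0 \<or> p' \<in> {p, Suc p} \<and> q' \<in> {q, Suc q} \<and> (p' = p \<or> q' = q)"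
        if "(p', q', s') \<in> C" for p' q' s'
        using that unfolding C_def N_def by simp blast
      have chainC: "\<not> (p1 < p2 \<and> q1 < q2)" if m: "(p1, q1, s1) \<in> C" "(p2, q2, s2) \<in> C" for p1 q1 s1 p2 q2 s2
      proof (cases "(p1, q1, s1) \<in> S0")
        case S1: True
        show ?thesis
        proof (cases "(p2, q2, s2) \<in> S0")
          case True
          with S1 show ?thesis by (rule ladder0')
        next
          case False
          then show ?thesis using near[OF S1, of p2 q2] memC[OF m(2)] by blast
        qed
      next
        case S1: False
        show ?thesis
        proof (cases "(p2, q2, s2) \<in> S0")
          case True
          then show ?thesis using near[OF True, of p1 q1] memC[OF m(1)] S1 by blast
        next
          case False
          then show ?thesis using memC[OF m(1)] memC[OF m(2)] S1 by auto
        qed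
      qed
      have "N \<subseteq> C" by (auto simp: C_def)
      have posN: "0 < s'" if "(p', q', s') \<in> N" for p' q' s'
        using that pos0 by (auto simp: N_def)
      have ladderN: "ladder N"
        unfolding ladder_def
      proof (intro conjI)
        show "finite N" using fin0 by (simp add: N_def)
      qed (use chainC posN \<open>N \<subseteq> C\<close> in blast)+
      have ladderC: "ladder C" if "0 < s"
        unfolding ladder_def
      proof (intro conjI)
        show "finite C" using fin0 by (simp add: N_def C_def)
        show "\<forall>(p, q, s)\<in>C. 0 < s" using posN that by (auto simp: C_def)
      qed (use chainC in blast)
      have "region C \<subseteq> region S - {(Suc p, Suc q)}"
      proof
        fix v assume "v \<in> region C"
        then obtain p' q' s' where v: "(p', q', s') \<in> C" "v \<in> {1..p'} \<times> {1..q'}"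
          by (auto simp: region_def)
        have "(p', q', s') \<in> S0 \<or> p' \<le> Suc p \<and> q' \<le> Suc q \<and> (p' \<le> p \<or> q' \<le> q)"
          using memC[OF v(1)] by auto
        then show "v \<in> region S - {(Suc p, Suc q)}"
        proof
          assume s0: "(p', q', s') \<in> S0"
          then have "v \<noteq> (Suc p, Suc q)" using corner[OF s0] v(2) by auto
          moreover have "v \<in> region S" using s0 v(2) unfolding region_def St(1) by blast
          ultimately show ?thesis by blast
        next
          assume le: "p' \<le> Suc p \<and> q' \<le> Suc q \<and> (p' \<le> p \<or> q' \<le> q)"
          then have "v \<in> {1..Suc p} \<times> {1..Suc q}" "v \<noteq> (Suc p, Suc q)" using v(2) by auto
          moreover have "{1..Suc p} \<times> {1..Suc q} \<subseteq> region S"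
            using t(1) unfolding region_def t_eq by blast
          ultimately show ?thesis by blast
        qed
      qed
      moreover have "(Suc p, Suc q) \<in> region S"
        using t(1) unfolding region_def t_eq by (intro UN_I[of "(Suc p, Suc q, Suc s)"]) auto
      ultimately have cardC: "card (region C) < card (region S)"
        using fin_region by (intro psubset_card_mono) auto
      have "finite (region C)"
        by (rule finite_subset[OF _ fin_region]) (use \<open>region C \<subseteq> _\<close> in blast)
      moreover have "region N \<subseteq> region C"
        unfolding region_def using \<open>N \<subseteq> C\<close> by blast
      ultimately have "card (region N) \<le> card (region C)" by (rule card_mono)
      then have cardN: "card (region N) < card (region S)" using cardC by simp
      obtain \<sigma>N :: "nat \<times> nat \<Rightarrow> 'k zpoly fract" where \<sigma>N: "generic_point N \<sigma>N"
        using IH[OF _ ladderN] cardN by auto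
      show ?thesis
      proof (cases "s = 0")
        case True
        then have "generic_point (insert (Suc p, Suc q, 1) S0) (\<sigma>N((Suc p, Suc q) := 0))"
          using corner by (intro generic_point_variable[OF _ \<sigma>N]) (auto simp: N_def)
        then show ?thesis using True by (auto simp: St(1) t_eq)
      next
        case False
        obtain \<sigma>C :: "nat \<times> nat \<Rightarrow> 'k zpoly fract" where \<sigma>C: "generic_point C \<sigma>C"
          using IH[OF _ ladderC] cardC False by auto
        have "\<not> redundant S t" using nonred t(1) by blast
        then show ?thesis
          using generic_point_corner[of p q s S0 N \<sigma>N \<sigma>C] S St corner \<sigma>N \<sigma>C False
          by (simp add: t_eq N_def C_def)
      qed
    qed
  qed
qed

section \<open>Diagrams of permutations\<close>

context
  fixes n :: nat and \<pi> :: "nat \<Rightarrow> nat"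
  assumes \<pi>: "\<pi> permutes {1..n}"
begin

lemma perm_inv: "\<pi> (inv_into UNIV \<pi> b) = b" "inv_into UNIV \<pi> (\<pi> a) = a"
  using \<pi> by (simp_all add: permutes_inverses)

lemma perm_le_iff: "\<pi> a \<in> {1..n} \<longleftrightarrow> a \<in> {1..n}" "inv_into UNIV \<pi> a \<in> {1..n} \<longleftrightarrow> a \<in> {1..n}"
  using permutes_in_image[OF \<pi>] permutes_in_image[OF permutes_inv[OF \<pi>]] by auto

lemma inv_perm_Suc_pos: "0 < inv_into UNIV \<pi> (Suc q)"
proof (rule ccontr)
  assume "\<not> 0 < inv_into UNIV \<pi> (Suc q)"
  then have "\<pi> 0 = Suc q" using perm_inv(1)[of "Suc q"] by simp
  moreover have "\<pi> 0 = 0" using permutes_not_in[OF \<pi>] by simp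
  ultimately show False by simp
qed

lemma perm_rank_Suc_row: "perm_rank \<pi> (Suc p) q = perm_rank \<pi> p q + of_bool (\<pi> (Suc p) \<le> q)"
proof -
  have "{i. 1 \<le> i \<and> i \<le> Suc p \<and> \<pi> i \<le> q} =
    (if \<pi> (Suc p) \<le> q then insert (Suc p) else id) {i. 1 \<le> i \<and> i \<le> p \<and> \<pi> i \<le> q}"
    by (auto simp: le_Suc_eq)
  moreover have "finite {i. 1 \<le> i \<and> i \<le> p \<and> \<pi> i \<le> q}"
    by (rule finite_subset[of _ "{..p}"]) auto
  ultimately show ?thesis unfolding perm_rank_def by auto
qed

lemma perm_rank_Suc_col:
  "perm_rank \<pi> p (Suc q) = perm_rank \<pi> p q + of_bool (inv_into UNIV \<pi> (Suc q) \<le> p)"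
proof -
  let ?a = "inv_into UNIV \<pi> (Suc q)"
  have a: "i = ?a \<longleftrightarrow> \<pi> i = Suc q" for i using perm_inv by metis
  have "{i. 1 \<le> i \<and> i \<le> p \<and> \<pi> i \<le> Suc q} =
    (if ?a \<le> p then insert ?a else id) {i. 1 \<le> i \<and> i \<le> p \<and> \<pi> i \<le> q}"
    using inv_perm_Suc_pos[of q] by (auto simp: le_Suc_eq perm_inv simp flip: a)
  moreover have "finite {i. 1 \<le> i \<and> i \<le> p \<and> \<pi> i \<le> q}"
    by (rule finite_subset[of _ "{..p}"]) auto
  moreover have "?a \<notin> {i. 1 \<le> i \<and> i \<le> p \<and> \<pi> i \<le> q}" by (simp add: perm_inv)
  ultimately show ?thesis unfolding perm_rank_def by auto
qed

lemma perm_rank_mono: "p \<le> p' \<Longrightarrow> q \<le> q' \<Longrightarrow> perm_rank \<pi> p q \<le> perm_rank \<pi> p' q'"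
  unfolding perm_rank_def
  by (rule card_mono) (auto intro: finite_subset[of _ "{..p'}"])

lemma perm_diagramD:
  assumes "(p, q) \<in> perm_diagram n \<pi>"
  shows "p \<in> {1..n}" "q \<in> {1..n}" "q < \<pi> p" "p < inv_into UNIV \<pi> q"
  using assms by (auto simp: perm_diagram_def)

text \<open>The bound \<open>n\<close> comes for free: outside \<open>{1..n}\<close> the permutation
  is the identity, and the two inequalities would contradict each other.\<close>

lemma perm_diagramI:
  assumes "0 < p" "0 < q" "q < \<pi> p" "p < inv_into UNIV \<pi> q"
  shows "(p, q) \<in> perm_diagram n \<pi>"
proof -
  have "p \<in> {1..n}"
  proof (rule ccontr)
    assume p: "p \<notin> {1..n}"
    then have "inv_into UNIV \<pi> q \<notin> {1..n}" using assms(1,4) by auto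
    then have "inv_into UNIV \<pi> q = q" using perm_le_iff(2) permutes_not_in[OF permutes_inv[OF \<pi>]] by blast
    moreover have "\<pi> p = p" using permutes_not_in[OF \<pi> p] .
    ultimately show False using assms(3,4) by simp
  qed
  moreover have "q \<in> {1..n}"
  proof (rule ccontr)
    assume q: "q \<notin> {1..n}"
    then have "\<pi> p \<notin> {1..n}" using assms(2,3) by auto
    then have "\<pi> p = p" using perm_le_iff(1) permutes_not_in[OF \<pi>] by blast
    moreover have "inv_into UNIV \<pi> q = q" using permutes_not_in[OF permutes_inv[OF \<pi>] q] .
    ultimately show False using assms(3,4) by simp
  qed
  ultimately show ?thesis using assms by (simp add: perm_diagram_def)
qed

text \<open>The dot of column \<open>q\<close> lies below row \<open>p\<close>, so the box below can
  leave the diagram only if the dot of row \<open>Suc p\<close> is weakly west of column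
  \<open>q\<close>. The eastern neighbour is symmetric.\<close>

lemma essential_setD:
  assumes "(p, q) \<in> essential_set n \<pi>"
  shows "(p, q) \<in> perm_diagram n \<pi>" "\<pi> (Suc p) \<le> q" "inv_into UNIV \<pi> (Suc q) \<le> p"
proof -
  have D: "(p, q) \<in> perm_diagram n \<pi>" "(Suc p, q) \<notin> perm_diagram n \<pi>" "(p, Suc q) \<notin> perm_diagram n \<pi>"
    using assms by (auto simp: essential_set_def)
  note d = perm_diagramD[OF D(1)]
  show "(p, q) \<in> perm_diagram n \<pi>" by fact
  show "\<pi> (Suc p) \<le> q"
  proof (rule ccontr)
    assume *: "\<not> \<pi> (Suc p) \<le> q"
    then have "inv_into UNIV \<pi> q \<noteq> Suc p" using perm_inv(1)[of q] by auto
    then have "(Suc p, q) \<in> perm_diagram n \<pi>" using d * by (intro perm_diagramI) auto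
    with D(2) show False ..
  qed
  show "inv_into UNIV \<pi> (Suc q) \<le> p"
  proof (rule ccontr)
    assume *: "\<not> inv_into UNIV \<pi> (Suc q) \<le> p"
    then have "\<pi> p \<noteq> Suc q" using perm_inv(2)[of p] by auto
    then have "(p, Suc q) \<in> perm_diagram n \<pi>" using d * by (intro perm_diagramI) auto
    with D(3) show False ..
  qed
qed

text \<open>Walking south and east inside the diagram never crosses a hook of a dot.\<close>

lemma ex_essential_southeast:
  assumes "(p, q) \<in> perm_diagram n \<pi>"
  shows "\<exists>i j. (i, j) \<in> essential_set n \<pi> \<and> p \<le> i \<and> q \<le> j \<and> perm_rank \<pi> i j = perm_rank \<pi> p q \<and>
    (\<forall>a\<le>p. q < \<pi> a \<longrightarrow> j < \<pi> a) \<and> (\<forall>b\<le>q. p < inv_into UNIV \<pi> b \<longrightarrow> i < inv_into UNIV \<pi> b)"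
  using assms
proof (induction "2 * n - p - q" arbitrary: p q rule: less_induct)
  case less
  note d = perm_diagramD[OF less.prems]
  consider "(p, q) \<in> essential_set n \<pi>" | "(Suc p, q) \<in> perm_diagram n \<pi>" | "(p, Suc q) \<in> perm_diagram n \<pi>"
    using less.prems by (auto simp: essential_set_def)
  then show ?case
  proof cases
    case 1
    then show ?thesis by blast
  next
    case 2
    note d' = perm_diagramD[OF 2]
    have "perm_rank \<pi> (Suc p) q = perm_rank \<pi> p q" using d' by (simp add: perm_rank_Suc_row)
    moreover have "2 * n - Suc p - q < 2 * n - p - q" using d d' by auto
    moreover have "Suc p < inv_into UNIV \<pi> b" if "b \<le> q" "p < inv_into UNIV \<pi> b" for b
    proof -
      have "inv_into UNIV \<pi> b \<noteq> Suc p" using perm_inv(1)[of b] d'(3) that(1) by auto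
      with that show ?thesis by simp
    qed
    ultimately show ?thesis using less.hyps[of "Suc p" q] 2 by (metis Suc_leD le_SucI)
  next
    case 3
    note d' = perm_diagramD[OF 3]
    have "perm_rank \<pi> p (Suc q) = perm_rank \<pi> p q" using d' by (simp add: perm_rank_Suc_col)
    moreover have "2 * n - p - Suc q < 2 * n - p - q" using d d' by auto
    moreover have "Suc q < \<pi> a" if "a \<le> p" "q < \<pi> a" for a
    proof -
      have "\<pi> a \<noteq> Suc q" using perm_inv(2)[of a] d'(4) that(1) by auto
      with that show ?thesis by simp
    qed
    ultimately show ?thesis using less.hyps[of p "Suc q"] 3 by (metis Suc_leD le_SucI)
  qed
qed

text \<open>Outside the diagram a dot lies weakly west in row \<open>p\<close> or weakly north in
  column \<open>q\<close>. Then the rank bound grows by one over the preceding block, just as much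
  as one more row or column allows. Inside the diagram an essential box further southeast has the
  same rank.\<close>

lemma rank_conditions_from_essential:
  assumes ess: "\<And>p q. (p, q) \<in> essential_set n \<pi> \<Longrightarrow> minors_vanish \<tau> p q (Suc (perm_rank \<pi> p q))"
  shows "minors_vanish \<tau> p q (Suc (perm_rank \<pi> p q))"
proof (induction "p + q" arbitrary: p q rule: less_induct)
  case less
  show ?case
  proof (cases "p = 0 \<or> q = 0")
    case True
    then show ?thesis by (auto intro: minors_vanish_few_rows minors_vanish_few_cols)
  next
    case False
    then obtain p' q' where pq: "p = Suc p'" "q = Suc q'" by (metis not0_implies_Suc)
    consider "\<pi> p \<le> q" | "inv_into UNIV \<pi> q \<le> p" | "(p, q) \<in> perm_diagram n \<pi>"
      using perm_diagramI[of p q] pq by linarith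
    then show ?thesis
    proof cases
      case 1
      then show ?thesis
        using minors_vanish_Suc_row[OF less(1)[of p' q]] by (simp add: pq perm_rank_Suc_row)
    next
      case 2
      then show ?thesis
        using minors_vanish_Suc_col[OF less(1)[of p q']] by (simp add: pq perm_rank_Suc_col)
    next
      case 3
      then obtain i j where "(i, j) \<in> essential_set n \<pi>" "p \<le> i" "q \<le> j" "perm_rank \<pi> i j = perm_rank \<pi> p q"
        using ex_essential_southeast by blast
      then show ?thesis using ess[of i j] by (auto intro: minors_vanish_mono)
    qed
  qed
qed

definition essential_conditions :: "(nat \<times> nat \<times> nat) set" where
  "essential_conditions = (\<lambda>(p, q). (p, q, Suc (perm_rank \<pi> p q))) ` essential_set n \<pi>"

text \<open>From a pattern \<open>a < b < c < d\<close>, slide the boxes \<open>(a, \<pi> b)\<close>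
  and \<open>(c, \<pi> d)\<close> southeast to essential ones; the first cannot reach row
  \<open>b\<close> or column \<open>\<pi> a\<close>, which keeps it strictly northwest. Conversely
  the dots of column \<open>Suc q\<close>, row \<open>Suc p\<close>, row \<open>p'\<close> and
  column \<open>q'\<close> form the pattern.\<close>

lemma vexillary_iff_essential_antichain:
  "vexillary n \<pi> \<longleftrightarrow>
    \<not> (\<exists>i j p q. (i, j) \<in> essential_set n \<pi> \<and> (p, q) \<in> essential_set n \<pi> \<and> i < p \<and> j < q)"
proof -
  have "\<exists>i j p q. (i, j) \<in> essential_set n \<pi> \<and> (p, q) \<in> essential_set n \<pi> \<and> i < p \<and> j < q"
    if "\<not> vexillary n \<pi>"
  proof -
    have "\<exists>a b c d. a \<in> {1..n} \<and> b \<in> {1..n} \<and> c \<in> {1..n} \<and> d \<in> {1..n} \<and> a < b \<and> b < c \<and> c < d \<and>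
        \<pi> b < \<pi> a \<and> \<pi> a < \<pi> d \<and> \<pi> d < \<pi> c"
      using that unfolding vexillary_def by blast
    then obtain a b c d where o: "a \<in> {1..n}" "b \<in> {1..n}" "c \<in> {1..n}" "d \<in> {1..n}" "a < b" "b < c" "c < d"
      "\<pi> b < \<pi> a" "\<pi> a < \<pi> d" "\<pi> d < \<pi> c"
      by (elim exE conjE)
    have pos: "0 < \<pi> b" "0 < \<pi> d" using o perm_le_iff(1)[of b] perm_le_iff(1)[of d] by auto
    have "(a, \<pi> b) \<in> perm_diagram n \<pi>" "(c, \<pi> d) \<in> perm_diagram n \<pi>"
      using o pos by (auto intro!: perm_diagramI simp: perm_inv)
    from ex_essential_southeast[OF this(1)] ex_essential_southeast[OF this(2)]
    obtain i j p q where ij: "(i, j) \<in> essential_set n \<pi>" "(\<forall>a'\<le>a. \<pi> b < \<pi> a' \<longrightarrow> j < \<pi> a')"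
        "(\<forall>b'\<le>\<pi> b. a < inv_into UNIV \<pi> b' \<longrightarrow> i < inv_into UNIV \<pi> b')"
      and pq: "(p, q) \<in> essential_set n \<pi>" "c \<le> p" "\<pi> d \<le> q"
      by blast
    have "j < \<pi> a" using ij(2) o by blast
    moreover have "i < b" using ij(3)[rule_format, of "\<pi> b"] o by (simp add: perm_inv)
    ultimately have "i < p" "j < q" using o pq by auto
    with ij(1) pq(1) show ?thesis by blast
  qed
  moreover have "\<not> vexillary n \<pi>"
    if e: "(p, q) \<in> essential_set n \<pi>" "(p', q') \<in> essential_set n \<pi>" "p < p'" "q < q'" for p q p' q'
  proof -
    note d = perm_diagramD[OF essential_setD(1)[OF e(1)]] and d' = perm_diagramD[OF essential_setD(1)[OF e(2)]]
    define a where "a = inv_into UNIV \<pi> (Suc q)"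
    define d where "d = inv_into UNIV \<pi> q'"
    have a: "\<pi> a = Suc q" "a \<le> p" "0 < a"
      using essential_setD(3)[OF e(1)] inv_perm_Suc_pos by (simp_all add: a_def perm_inv)
    have b: "\<pi> (Suc p) \<le> q" using essential_setD(2)[OF e(1)] .
    have dd: "\<pi> d = q'" "p' < d" using d' by (simp_all add: d_def perm_inv)
    have "d \<in> {1..n}" using d' perm_le_iff(2)[of q'] by (simp add: d_def)
    \<comment> \<open>The two boxes are not in adjacent rows or columns: a row equal to
      \<open>Suc p = p'\<close> would have its dot both weakly west of \<open>q\<close> and east of
      \<open>q'\<close>.\<close>
    moreover have "Suc p \<noteq> p'" using b d'(3) e(4) by auto
    moreover have "Suc q \<noteq> q'" using a(2) dd(2) e(3) by (auto simp: a_def d_def)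
    ultimately have "a \<in> {1..n} \<and> Suc p \<in> {1..n} \<and> p' \<in> {1..n} \<and> d \<in> {1..n} \<and> a < Suc p \<and> Suc p < p' \<and> p' < d \<and>
       \<pi> (Suc p) < \<pi> a \<and> \<pi> a < \<pi> d \<and> \<pi> d < \<pi> p'"
      using a b dd d d' e(3,4) by auto
    then show ?thesis unfolding vexillary_def by blast
  qed
  ultimately show ?thesis by blast
qed

lemma finite_essential_set: "finite (essential_set n \<pi>)"
  by (rule finite_subset[of _ "{1..n} \<times> {1..n}"]) (auto simp: essential_set_def perm_diagram_def)

lemma ladder_essential_conditions:
  assumes "vexillary n \<pi>"
  shows "ladder essential_conditions"
  unfolding ladder_def essential_conditions_def
  using assms finite_essential_set by (auto simp: vexillary_iff_essential_antichain)

end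

section \<open>Minors and ideals in the polynomial ring\<close>

lemma pick_image_strict_mono:
  assumes "strict_mono_on {..<s} f" "i < s"
  shows "pick (f ` {..<s}) i = f i"
proof -
  have "{a \<in> f ` {..<s}. a < f i} = f ` {..<i}"
    using assms by (auto simp: strict_mono_on_less)
  moreover have "card (f ` {..<i}) = i"
    using assms by (subst card_image) (auto intro: inj_on_subset[OF strict_mono_on_imp_inj_on])
  ultimately show ?thesis using pick_card_in_set[of "f i" "f ` {..<s}"] assms(2) by simp
qed

lemma zv_eq_zvar: "zv (i, j) = zvar i j"
  by (simp add: zv_def zvar_def)

text \<open>Index sets of size \<open>s\<close> correspond to increasing lists through
  \<open>pick\<close>; the shift by \<open>Suc\<close> converts matrix positions from 0 into
  variable indices from 1.\<close>

lemma square_submatrices_zmat: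
  "square_submatrices s (zmat p q :: 'k::field zpoly mat) =
     {mat s s (\<lambda>(i, j). zv (f i, h j)) | f h. chain p q s f h}"
proof (intro equalityI subsetI)
  fix A :: "'k zpoly mat" assume "A \<in> square_submatrices s (zmat p q)"
  then obtain I J where IJ: "A = submatrix (zmat p q) I J" "I \<subseteq> {0..<p}" "J \<subseteq> {0..<q}" "card I = s" "card J = s"
    by (auto simp: square_submatrices_def zmat_def)
  have "{i. i < p \<and> i \<in> I} = I" "{j. j < q \<and> j \<in> J} = J"
    using IJ(2,3) by auto
  then have c: "card {i. i < p \<and> i \<in> I} = s" "card {j. j < q \<and> j \<in> J} = s"
    using IJ(4,5) by simp_all
  have I: "pick I i \<in> {0..<p}" "pick J i \<in> {0..<q}" if "i < s" for i
    using that IJ pick_in_set[of i I] pick_in_set[of i J] by auto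
  have "A = mat s s (\<lambda>(i, j). zv (Suc (pick I i), Suc (pick J j)))"
    using I unfolding IJ(1) by (intro eq_matI) (auto simp: submatrix_def zmat_def c zv_eq_zvar)
  moreover have "chain p q s (\<lambda>i. Suc (pick I i)) (\<lambda>i. Suc (pick J i))"
    unfolding chain_def strict_mono_on_def
    using I IJ(4,5) pick_mono[of _ I] pick_mono[of _ J] by (auto simp: Suc_le_eq)
  ultimately show "A \<in> {mat s s (\<lambda>(i, j). zv (f i, h j)) | f h. chain p q s f h}"
    by (intro CollectI exI conjI)
next
  fix A :: "'k zpoly mat" assume "A \<in> {mat s s (\<lambda>(i, j). zv (f i, h j)) | f h. chain p q s f h}"
  then obtain f h where A: "A = mat s s (\<lambda>(i, j). zv (f i, h j))" and ch: "chain p q s f h" by blast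
  have fh: "f i \<in> {1..p}" "h i \<in> {1..q}" if "i < s" for i using ch that by (auto simp: chain_def)
  define f' h' where "f' i = f i - 1" and "h' i = h i - 1" for i
  have f': "f i = Suc (f' i)" "f' i < p" and h': "h i = Suc (h' i)" "h' i < q" if "i < s" for i
    using fh[OF that] by (auto simp: f'_def h'_def)
  have mono: "strict_mono_on {..<s} f'" "strict_mono_on {..<s} h'"
    using ch f'(1) h'(1) unfolding chain_def strict_mono_on_def by (metis lessThan_iff Suc_less_eq)+
  let ?I = "f' ` {..<s}" and ?J = "h' ` {..<s}"
  have card: "card ?I = s" "card ?J = s"
    using mono by (simp_all add: card_image strict_mono_on_imp_inj_on)
  have c: "{i. i < p \<and> i \<in> ?I} = ?I" "{j. j < q \<and> j \<in> ?J} = ?J"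
    using f' h' by auto
  have "A = submatrix (zmat p q) ?I ?J"
    unfolding A submatrix_def using f' h'
    by (intro eq_matI) (auto simp: zmat_def c card pick_image_strict_mono mono zv_eq_zvar)
  moreover have "?I \<subseteq> {0..<p}" "?J \<subseteq> {0..<q}" using f' h' by auto
  ultimately show "A \<in> square_submatrices s (zmat p q)"
    unfolding square_submatrices_def zmat_def using card by (simp add: zmat_def) blast
qed

lemma minors_zmat:
  "minors s (zmat p q :: 'k::field zpoly mat) = {gen_minor zv s f h | f h. chain p q s f h}"
  unfolding minors_def square_submatrices_zmat gen_minor_def by auto

lemma prod_list_diag_mat:
  "prod_list (diag_mat (mat s s (\<lambda>(i, j). zv (f i, h j)))) =
     (Poly_Mapping.single (chain_monom s f h) 1 :: 'k::field zpoly)"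
proof -
  have "prod_list (map (\<lambda>i. mat s s (\<lambda>(i, j). zv (f i, h j)) $$ (i, i)) [0..<s]) =
      (\<Prod>i\<in>set [0..<s]. mat s s (\<lambda>(i, j). zv (f i, h j)) $$ (i, i) :: 'k zpoly)"
    by (rule prod.distinct_set_conv_list[symmetric]) simp
  also have "\<dots> = (\<Prod>i<s. zv (f i, h i))"
    by (intro prod.cong) auto
  finally show ?thesis by (simp add: diag_mat_def prod_zv)
qed

lemma zmonoms_add: "a + b \<in> zmonoms n \<longleftrightarrow> a \<in> zmonoms n \<and> b \<in> zmonoms n"
  by (auto simp: zmonoms_def keys_add_monom)

lemma zmonoms_0 [simp]: "0 \<in> zmonoms n"
  by (simp add: zmonoms_def)

lemma carrier_zring: "f \<in> carrier (zring n) \<longleftrightarrow> Poly_Mapping.keys f \<subseteq> zmonoms n"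
  by (simp add: zring_def)

lemma zring_add_closed: "f \<in> carrier (zring n) \<Longrightarrow> g \<in> carrier (zring n) \<Longrightarrow> f + g \<in> carrier (zring n)"
  using keys_add[of f g] by (auto simp: carrier_zring)

lemma zring_mult_closed: "f \<in> carrier (zring n) \<Longrightarrow> g \<in> carrier (zring n) \<Longrightarrow> f * g \<in> carrier (zring n)"
  using keys_mult[of f g] zmonoms_add unfolding carrier_zring by blast

lemma zring_single: "m \<in> zmonoms n \<Longrightarrow> Poly_Mapping.single m c \<in> carrier (zring n)"
  by (simp add: carrier_zring)

lemma zring_uminus_closed: "f \<in> carrier (zring n) \<Longrightarrow> - f \<in> carrier (zring n)"
  by (auto simp: carrier_zring in_keys_iff)

lemma zring_sel [simp]:
  "x \<otimes>\<^bsub>zring n\<^esub> y = x * y" "x \<oplus>\<^bsub>zring n\<^esub> y = x + y" "\<zero>\<^bsub>zring n\<^esub> = 0" "\<one>\<^bsub>zring n\<^esub> = 1"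
  by (simp_all add: zring_def)

lemma cring_zring: "cring (zring n :: 'k::field zpoly ring)"
proof (intro cringI abelian_groupI comm_monoidI)
  fix x :: "'k zpoly" assume "x \<in> carrier (zring n)"
  then show "\<exists>y\<in>carrier (zring n). y \<oplus>\<^bsub>zring n\<^esub> x = \<zero>\<^bsub>zring n\<^esub>"
    by (intro bexI[of _ "- x"]) (simp_all add: zring_uminus_closed)
qed (simp_all add: zring_add_closed zring_mult_closed zring_single distrib_right distrib_left ac_simps,
     simp_all add: carrier_zring)

lemma zring_idealI:
  fixes I :: "'k::field zpoly set"
  assumes "I \<subseteq> carrier (zring n)" "0 \<in> I" "\<And>f g. f \<in> I \<Longrightarrow> g \<in> I \<Longrightarrow> f + g \<in> I"
    and mult: "\<And>f g. f \<in> I \<Longrightarrow> g \<in> carrier (zring n) \<Longrightarrow> g * f \<in> I"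
  shows "ideal I (zring n)"
proof -
  interpret cring "zring n :: 'k zpoly ring" by (rule cring_zring)
  have m1: "- 1 \<in> carrier (zring n :: 'k zpoly ring)"
    using zring_uminus_closed[of 1 n] one_closed by simp
  have inv: "\<ominus>\<^bsub>zring n\<^esub> f = - f" if "f \<in> carrier (zring n)" for f :: "'k zpoly"
    by (rule minus_equality) (use that zring_uminus_closed[OF that] in simp_all)
  show ?thesis
  proof (rule idealI)
    show "subgroup I (add_monoid (zring n))"
    proof (rule group.subgroupI)
      show "group (add_monoid (zring n :: 'k zpoly ring))" by (rule add.group_axioms)
      fix f assume f: "f \<in> I"
      then have "- 1 * f \<in> I" using mult m1 by blast
      then show "inv\<^bsub>add_monoid (zring n)\<^esub> f \<in> I"
        using inv[of f] f assms(1) by (auto simp: a_inv_def)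
    qed (use assms in auto)
  qed (use assms ring_axioms mult in \<open>auto simp: mult.commute\<close>)
qed

definition zideal :: "nat \<Rightarrow> 'k::field zpoly set \<Rightarrow> 'k zpoly set" where
  "zideal n G = Idl\<^bsub>zring n\<^esub> G"

lemma zideal_closed:
  fixes G :: "'k::field zpoly set"
  assumes "G \<subseteq> carrier (zring n)"
  shows "G \<subseteq> zideal n G" "zideal n G \<subseteq> carrier (zring n)" "0 \<in> zideal n G"
    "f \<in> zideal n G \<Longrightarrow> g \<in> zideal n G \<Longrightarrow> f + g \<in> zideal n G"
    "f \<in> zideal n G \<Longrightarrow> g \<in> carrier (zring n) \<Longrightarrow> g * f \<in> zideal n G"
proof -
  interpret cring "zring n :: 'k zpoly ring" by (rule cring_zring)
  interpret I: ideal "zideal n G" "zring n" unfolding zideal_def by (rule genideal_ideal[OF assms])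
  show "G \<subseteq> zideal n G" unfolding zideal_def by (rule genideal_self[OF assms])
  show "zideal n G \<subseteq> carrier (zring n)" by (rule I.a_subset)
  show "0 \<in> zideal n G" using I.zero_closed by simp
  show "f \<in> zideal n G \<Longrightarrow> g \<in> zideal n G \<Longrightarrow> f + g \<in> zideal n G" using I.a_closed by simp
  show "f \<in> zideal n G \<Longrightarrow> g \<in> carrier (zring n) \<Longrightarrow> g * f \<in> zideal n G" using I.I_l_closed by simp
qed

lemma zideal_minimal:
  fixes G I :: "'k::field zpoly set"
  assumes "ideal I (zring n)" "G \<subseteq> I"
  shows "zideal n G \<subseteq> I"
proof -
  interpret cring "zring n :: 'k zpoly ring" by (rule cring_zring)
  show ?thesis unfolding zideal_def by (rule genideal_minimal[OF assms])
qed

lemma kernel_ideal: "ideal {f \<in> carrier (zring n). peval \<sigma> f = 0} (zring n)"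
  by (rule zring_idealI) (auto simp: zring_add_closed zring_mult_closed peval_add peval_mult carrier_zring[of 0])

text \<open>The polynomials all of whose monomials are multiples of nonzero elements of
  \<open>T\<close> form an ideal that contains \<open>T\<close>.\<close>

lemma monomial_in_zideal:
  fixes T :: "'k::field zpoly set"
  assumes T: "\<And>t. t \<in> T \<Longrightarrow> \<exists>m c. t = Poly_Mapping.single m c \<and> m \<in> zmonoms n"
    and f: "f \<in> zideal n T" and k: "k \<in> Poly_Mapping.keys f"
  shows "\<exists>m c x. Poly_Mapping.single m c \<in> T \<and> c \<noteq> 0 \<and> k = x + m"
proof -
  let ?P = "\<lambda>k. \<exists>m c x. Poly_Mapping.single m c \<in> T \<and> c \<noteq> 0 \<and> k = x + m"
  let ?I = "{f \<in> carrier (zring n). \<forall>k\<in>Poly_Mapping.keys f. ?P k} :: 'k zpoly set"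
  have "ideal ?I (zring n)"
  proof (rule zring_idealI)
    fix f g :: "'k zpoly" assume "f \<in> ?I" "g \<in> ?I"
    then show "f + g \<in> ?I" using keys_add[of f g] zring_add_closed[of f n g] by blast
  next
    fix f g :: "'k zpoly" assume fg: "f \<in> ?I" "g \<in> carrier (zring n)"
    have "?P k" if k: "k \<in> Poly_Mapping.keys (g * f)" for k
    proof -
      obtain a b where ab: "b \<in> Poly_Mapping.keys f" "k = a + b" using k keys_mult[of g f] by blast
      then have "?P b" using fg(1) by simp
      then obtain m c x where "Poly_Mapping.single m c \<in> T" "c \<noteq> 0" "b = x + m"
        by (elim exE conjE)
      then show ?thesis using ab(2)
        by (intro exI[of _ m] exI[of _ c] exI[of _ "a + x"]) (simp add: add.assoc)
    qed
    with fg show "g * f \<in> ?I" using zring_mult_closed[of g n f] by blast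
  qed (auto simp: carrier_zring)
  moreover have "T \<subseteq> ?I"
  proof
    fix t assume t: "t \<in> T"
    then obtain m c where mc: "t = Poly_Mapping.single m c" "m \<in> zmonoms n"
      using T[OF t] by (elim exE conjE)
    have "?P k" if k: "k \<in> Poly_Mapping.keys t" for k
    proof -
      have "c \<noteq> 0" "k = 0 + m" using k unfolding mc(1) keys_single by (simp_all split: if_splits)
      then show ?thesis using t unfolding mc(1) by (intro exI[of _ m] exI[of _ c] exI[of _ 0] conjI)
    qed
    moreover have "t \<in> carrier (zring n)" unfolding mc(1) by (rule zring_single[OF mc(2)])
    ultimately show "t \<in> ?I" by (intro CollectI conjI ballI)
  qed
  ultimately have "zideal n T \<subseteq> ?I" by (rule zideal_minimal)
  with f k show ?thesis by blast
qed

section \<open>Term orders and leading monomials\<close>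

lemma term_orderD:
  assumes "term_order n R"
  shows "linear_order_on (zmonoms n) R" "a \<in> zmonoms n \<Longrightarrow> (0, a) \<in> R"
    "a \<in> zmonoms n \<Longrightarrow> b \<in> zmonoms n \<Longrightarrow> c \<in> zmonoms n \<Longrightarrow> (a, b) \<in> R \<Longrightarrow> (a + c, b + c) \<in> R"
    "a \<in> zmonoms n \<Longrightarrow> (a, a) \<in> R" "(a, b) \<in> R \<Longrightarrow> (b, c) \<in> R \<Longrightarrow> (a, c) \<in> R"
    "(a, b) \<in> R \<Longrightarrow> (b, a) \<in> R \<Longrightarrow> a = b"
    "a \<in> zmonoms n \<Longrightarrow> b \<in> zmonoms n \<Longrightarrow> (a, b) \<in> R \<or> (b, a) \<in> R"
proof -
  show lin: "linear_order_on (zmonoms n) R" using assms by (simp add: term_order_def)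
  show "a \<in> zmonoms n \<Longrightarrow> (0, a) \<in> R"
    "a \<in> zmonoms n \<Longrightarrow> b \<in> zmonoms n \<Longrightarrow> c \<in> zmonoms n \<Longrightarrow> (a, b) \<in> R \<Longrightarrow> (a + c, b + c) \<in> R"
    using assms by (simp_all add: term_order_def)
  have po: "partial_order_on (zmonoms n) R" and tot: "total_on (zmonoms n) R"
    using lin by (simp_all add: linear_order_on_def)
  have refl: "refl_on (zmonoms n) R" and tr: "trans R" and an: "antisym R"
    using po by (simp_all add: partial_order_on_def preorder_on_def)
  show r: "a \<in> zmonoms n \<Longrightarrow> (a, a) \<in> R" for a using refl by (rule refl_onD)
  show "(a, b) \<in> R \<Longrightarrow> (b, c) \<in> R \<Longrightarrow> (a, c) \<in> R" using tr by (rule transD)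
  show "(a, b) \<in> R \<Longrightarrow> (b, a) \<in> R \<Longrightarrow> a = b" using an by (rule antisymD)
  show "a \<in> zmonoms n \<Longrightarrow> b \<in> zmonoms n \<Longrightarrow> (a, b) \<in> R \<or> (b, a) \<in> R"
    using tot r by (cases "a = b") (auto simp: total_on_def)
qed

lemma lead_monom_eq:
  assumes R: "term_order n R" and m: "m \<in> Poly_Mapping.keys f" "\<And>k. k \<in> Poly_Mapping.keys f \<Longrightarrow> (k, m) \<in> R"
  shows "lead_monom R f = m"
  unfolding lead_monom_def
proof (rule the_equality)
  fix m' assume "m' \<in> Poly_Mapping.keys f \<and> (\<forall>k\<in>Poly_Mapping.keys f. (k, m') \<in> R)"
  then show "m' = m" using m term_orderD(6)[OF R] by blast
qed (use m in blast)

lemma lead_monom: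
  fixes f :: "'k::field zpoly"
  assumes R: "term_order n R" and f: "f \<noteq> 0" "Poly_Mapping.keys f \<subseteq> zmonoms n"
  shows "lead_monom R f \<in> Poly_Mapping.keys f" "k \<in> Poly_Mapping.keys f \<Longrightarrow> (k, lead_monom R f) \<in> R"
proof -
  have "\<exists>m\<in>K. \<forall>k\<in>K. (k, m) \<in> R" if "finite K" "K \<noteq> {}" "K \<subseteq> zmonoms n" for K
    using that
  proof (induction K rule: finite_ne_induct)
    case (singleton x)
    then show ?case using term_orderD(4)[OF R] by simp
  next
    case (insert x K)
    then obtain m where m: "m \<in> K" "\<And>k. k \<in> K \<Longrightarrow> (k, m) \<in> R" by auto
    have "(x, m) \<in> R \<or> (m, x) \<in> R" using term_orderD(7)[OF R] m(1) insert.prems by blast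
    then show ?case
    proof
      assume "(m, x) \<in> R"
      then have "(k, x) \<in> R" if "k \<in> K" for k using m(2)[OF that] term_orderD(5)[OF R] by blast
      moreover have "(x, x) \<in> R" using term_orderD(4)[OF R] insert.prems by blast
      ultimately show ?thesis by blast
    qed (use m in blast)
  qed
  from this[of "Poly_Mapping.keys f"] f obtain m where
    m: "m \<in> Poly_Mapping.keys f" "\<And>k. k \<in> Poly_Mapping.keys f \<Longrightarrow> (k, m) \<in> R"
    by auto
  have "lead_monom R f = m" by (rule lead_monom_eq[OF R m])
  then show "lead_monom R f \<in> Poly_Mapping.keys f" "k \<in> Poly_Mapping.keys f \<Longrightarrow> (k, lead_monom R f) \<in> R"
    using m by simp_all
qed

section \<open>Leading terms\<close>

lemma chain_mono: "chain p q s f h \<Longrightarrow> p \<le> p' \<Longrightarrow> q \<le> q' \<Longrightarrow> chain p' q' s f h"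
  by (fastforce simp: chain_def)

lemma keys_gen_minor:
  fixes k :: zmonom
  assumes "strict_mono_on {..<s} f" "strict_mono_on {..<s} h"
    and "k \<in> Poly_Mapping.keys (gen_minor zv s f h :: 'k::field zpoly)"
  shows "\<exists>\<sigma>. \<sigma> permutes {..<s} \<and> k = chain_monom s f (h \<circ> \<sigma>)"
proof -
  obtain r :: "'k zpoly" where r: "gen_minor zv s f h = Poly_Mapping.single (chain_monom s f h) 1 + r"
    "\<And>k. k \<in> Poly_Mapping.keys r \<Longrightarrow> \<exists>\<sigma>. \<sigma> permutes {..<s} \<and> \<sigma> \<noteq> id \<and> k = chain_monom s f (h \<circ> \<sigma>)"
    by (rule gen_minor_zv[OF assms(1,2)]) blast
  have "k \<in> Poly_Mapping.keys (Poly_Mapping.single (chain_monom s f h) (1::'k)) \<union> Poly_Mapping.keys r"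
    by (rule subsetD[OF keys_add assms(3)[unfolded r(1)]])
  then consider "k = chain_monom s f (h \<circ> id)" | "k \<in> Poly_Mapping.keys r" by auto
  then show ?thesis
  proof cases
    case 1
    then show ?thesis using permutes_id by blast
  next
    case 2
    from r(2)[OF this] show ?thesis by blast
  qed
qed

lemma chain_monom_zmonoms:
  assumes "\<And>i. i < s \<Longrightarrow> f i \<in> {1..n}" "\<And>i. i < s \<Longrightarrow> h i \<in> {1..n}"
  shows "chain_monom s f h \<in> zmonoms n"
  using keys_chain_monom[of s f h] assms unfolding zmonoms_def by blast

lemma gen_minor_carrier:
  assumes "chain n n s f h"
  shows "(gen_minor zv s f h :: 'k::field zpoly) \<in> carrier (zring n)"
  unfolding carrier_zring
proof
  fix k assume k: "k \<in> Poly_Mapping.keys (gen_minor zv s f h :: 'k zpoly)"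
  have ch: "strict_mono_on {..<s} f" "strict_mono_on {..<s} h" "\<And>i. i < s \<Longrightarrow> f i \<in> {1..n}"
    "\<And>i. i < s \<Longrightarrow> h i \<in> {1..n}"
    using assms by (auto simp: chain_def)
  obtain \<sigma> where \<sigma>: "\<sigma> permutes {..<s}" "k = chain_monom s f (h \<circ> \<sigma>)"
    using keys_gen_minor[OF ch(1,2) k] by blast
  have "\<sigma> i < s" if "i < s" for i using permutes_in_image[OF \<sigma>(1), of i] that by simp
  then show "k \<in> zmonoms n"
    unfolding \<sigma>(2) by (intro chain_monom_zmonoms) (use ch in auto)
qed

lemma diagonal_lead:
  assumes R: "diagonal_term_order TYPE('k::field) n R" and ch: "chain n n s f h"
  defines "g \<equiv> gen_minor zv s f h :: 'k zpoly"
  shows "lead_term R g = Poly_Mapping.single (chain_monom s f h) 1"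
    "k \<in> Poly_Mapping.keys g \<Longrightarrow> (k, chain_monom s f h) \<in> R"
proof -
  have R': "term_order n R" using R by (simp add: diagonal_term_order_def)
  let ?A = "mat s s (\<lambda>(i, j). zv (f i, h j)) :: 'k zpoly mat"
  have "?A \<in> square_submatrices s (zmat n n)"
    unfolding square_submatrices_zmat using ch by blast
  then have "lead_term R (det ?A) = prod_list (diag_mat ?A)"
    using R unfolding diagonal_term_order_def by blast
  then show lt: "lead_term R g = Poly_Mapping.single (chain_monom s f h) 1"
    by (simp add: g_def gen_minor_def prod_list_diag_mat)
  \<comment> \<open>The zero polynomial has leading term 0, which is not a diagonal term. Only for
    nonzero \<open>g\<close> is \<open>lead_monom\<close> determined.\<close>
  have "g \<noteq> 0"
  proof
    assume "g = 0"
    then have "Poly_Mapping.single (chain_monom s f h) 1 = (0 :: 'k zpoly)" using lt by (simp add: lead_term_def)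
    then have "Poly_Mapping.keys (Poly_Mapping.single (chain_monom s f h) 1 :: 'k zpoly) = {}" by simp
    then show False by simp
  qed
  moreover have "Poly_Mapping.keys g \<subseteq> zmonoms n"
    using gen_minor_carrier[OF ch] by (simp add: g_def carrier_zring)
  ultimately have lm: "lead_monom R g \<in> Poly_Mapping.keys g"
      "\<And>k. k \<in> Poly_Mapping.keys g \<Longrightarrow> (k, lead_monom R g) \<in> R"
    using lead_monom[OF R'] by blast+
  have "Poly_Mapping.keys (lead_term R g) = {lead_monom R g}"
    using \<open>g \<noteq> 0\<close> lm(1) by (simp add: lead_term_def in_keys_iff)
  then have "lead_monom R g = chain_monom s f h" unfolding lt by simp
  with lm(2) show "k \<in> Poly_Mapping.keys g \<Longrightarrow> (k, chain_monom s f h) \<in> R" by simp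
qed

text \<open>By the rearrangement inequality the weight \<open>i * j\<close> of \<open>z\<^sub>i\<^sub>j\<close> singles out diagonal terms.\<close>

definition weight_order :: "nat \<Rightarrow> zmonom rel" where
  "weight_order n = {(a, b). a \<in> zmonoms n \<and> b \<in> zmonoms n \<and>
     (diag_weight a < diag_weight b \<or> diag_weight a = diag_weight b \<and> a \<le> b)}"

text \<open>Ties are broken by the linear order on finitely supported functions over
  lexicographically ordered index pairs, which respects addition. The monomial 1 is least because
  indices starting at 1 give every variable positive weight.\<close>

lemma term_order_weight_order: "term_order n (weight_order n)"
proof -
  have pos: "a = 0 \<or> 0 < diag_weight a" if "a \<in> zmonoms n" for a
  proof (cases "a = 0")
    case False
    then have "Poly_Mapping.keys a \<noteq> {}" by simp
    then obtain v where v: "v \<in> Poly_Mapping.keys a" by blast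
    then have "v \<in> {1..n} \<times> {1..n}" using that by (auto simp: zmonoms_def)
    then have "0 < Poly_Mapping.lookup a v * (case v of (i, j) \<Rightarrow> i * j)"
      using v by (auto simp: in_keys_iff)
    also have "\<dots> \<le> diag_weight a"
      unfolding monom_weight_def using v by (intro member_le_sum) auto
    finally show ?thesis by blast
  qed simp
  have "linear_order_on (zmonoms n) (weight_order n)"
    unfolding linear_order_on_def partial_order_on_def preorder_on_def
  proof (intro conjI)
    show "refl_on (zmonoms n) (weight_order n)"
      by (auto simp: refl_on_def weight_order_def)
    show "trans (weight_order n)"
      by (rule transI) (auto simp: weight_order_def)
    show "antisym (weight_order n)"
      by (rule antisymI) (auto simp: weight_order_def)
    show "total_on (zmonoms n) (weight_order n)"
      by (auto simp: total_on_def weight_order_def)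
  qed (auto simp: weight_order_def)
  moreover have "(0, a) \<in> weight_order n" if "a \<in> zmonoms n" for a
    using pos[OF that] that by (auto simp: weight_order_def)
  moreover have "(a + c, b + c) \<in> weight_order n" if "(a, b) \<in> weight_order n" "c \<in> zmonoms n" for a b c
    using that by (auto simp: weight_order_def zmonoms_add intro: add_right_mono)
  ultimately show ?thesis unfolding term_order_def by blast
qed

text \<open>Existence of a diagonal order is what lets a statement about every such order imply the
  statement about some.\<close>

lemma diagonal_weight_order: "diagonal_term_order TYPE('k::field) n (weight_order n)"
  unfolding diagonal_term_order_def
proof (intro conjI allI ballI term_order_weight_order)
  fix s and A :: "'k zpoly mat" assume "A \<in> square_submatrices s (zmat n n)"
  then obtain f h where A: "A = mat s s (\<lambda>(i, j). zv (f i, h j))" and ch: "chain n n s f h"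
    unfolding square_submatrices_zmat by blast
  have mono: "strict_mono_on {..<s} f" "strict_mono_on {..<s} h" using ch by (auto simp: chain_def)
  let ?m = "chain_monom s f h"
  obtain r :: "'k zpoly" where r: "gen_minor zv s f h = Poly_Mapping.single ?m 1 + r"
    "\<And>k. k \<in> Poly_Mapping.keys r \<Longrightarrow> \<exists>\<sigma>. \<sigma> permutes {..<s} \<and> \<sigma> \<noteq> id \<and> k = chain_monom s f (h \<circ> \<sigma>)"
    by (rule gen_minor_zv[OF mono]) blast
  have wt: "diag_weight k < diag_weight ?m" if "k \<in> Poly_Mapping.keys r" for k
    using r(2)[OF that] diag_weight_less[OF mono] by blast
  then have "?m \<notin> Poly_Mapping.keys r" by blast
  then have l: "Poly_Mapping.lookup (gen_minor zv s f h :: 'k zpoly) ?m = 1"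
    by (simp add: r(1) lookup_add in_keys_iff)
  then have m: "?m \<in> Poly_Mapping.keys (gen_minor zv s f h :: 'k zpoly)" by (simp add: in_keys_iff)
  have zm: "Poly_Mapping.keys (gen_minor zv s f h :: 'k zpoly) \<subseteq> zmonoms n"
    using gen_minor_carrier[OF ch] by (simp add: carrier_zring)
  have "(k, ?m) \<in> weight_order n" if k: "k \<in> Poly_Mapping.keys (gen_minor zv s f h :: 'k zpoly)" for k
  proof -
    have "k = ?m \<or> k \<in> Poly_Mapping.keys r"
      using k unfolding r(1) in_keys_iff lookup_add lookup_single when_def by auto
    with wt zm k m show ?thesis by (auto simp: weight_order_def)
  qed
  with m have "lead_monom (weight_order n) (gen_minor zv s f h :: 'k zpoly) = ?m"
    by (rule lead_monom_eq[OF term_order_weight_order])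
  moreover have "gen_minor zv s f h \<noteq> (0 :: 'k zpoly)" using m by auto
  ultimately have "lead_term (weight_order n) (gen_minor zv s f h :: 'k zpoly) = Poly_Mapping.single ?m 1"
    using l by (simp add: lead_term_def)
  then show "lead_term (weight_order n) (det A) = prod_list (diag_mat A)"
    unfolding A prod_list_diag_mat gen_minor_def .
qed

lemma finite_minors: "finite (minors s (A :: 'a::comm_ring_1 mat))"
proof -
  have "square_submatrices s A \<subseteq> (\<lambda>(I, J). submatrix A I J) ` (Pow {0..<dim_row A} \<times> Pow {0..<dim_col A})"
    unfolding square_submatrices_def by auto
  then have "finite (square_submatrices s A)" by (rule finite_subset) simp
  then show ?thesis by (simp add: minors_def)
qed

section \<open>Vexillary permutations: essential minors form a Groebner basis\<close>

context
  fixes n :: nat and \<pi> :: "nat \<Rightarrow> nat"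
  assumes \<pi>: "\<pi> permutes {1..n}"
begin

lemma essential_conditions_iff:
  "(p, q, s) \<in> essential_conditions n \<pi> \<longleftrightarrow> (p, q) \<in> essential_set n \<pi> \<and> s = Suc (perm_rank \<pi> p q)"
  by (auto simp: essential_conditions_def[OF \<pi>])

lemma essential_minors_eq:
  "(essential_minors n \<pi> :: 'k::field zpoly set) =
    {gen_minor zv s f h | p q s f h. (p, q, s) \<in> essential_conditions n \<pi> \<and> chain p q s f h}"
proof (intro equalityI subsetI)
  fix g :: "'k zpoly" assume "g \<in> essential_minors n \<pi>"
  then obtain p q where pq: "(p, q) \<in> essential_set n \<pi>" "g \<in> minors (1 + perm_rank \<pi> p q) (zmat p q)"
    unfolding essential_minors_def by blast
  then obtain f h where "g = gen_minor zv (Suc (perm_rank \<pi> p q)) f h" "chain p q (Suc (perm_rank \<pi> p q)) f h"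
    unfolding minors_zmat by auto
  with pq(1) show "g \<in> {gen_minor zv s f h | p q s f h. (p, q, s) \<in> essential_conditions n \<pi> \<and> chain p q s f h}"
    unfolding essential_conditions_iff by blast
next
  fix g :: "'k zpoly"
  assume "g \<in> {gen_minor zv s f h | p q s f h. (p, q, s) \<in> essential_conditions n \<pi> \<and> chain p q s f h}"
  then obtain p q f h where *: "g = gen_minor zv (Suc (perm_rank \<pi> p q)) f h" "(p, q) \<in> essential_set n \<pi>"
      "chain p q (Suc (perm_rank \<pi> p q)) f h"
    unfolding essential_conditions_iff by blast
  then have "g \<in> minors (1 + perm_rank \<pi> p q) (zmat p q)"
    unfolding minors_zmat by auto
  with *(2) show "g \<in> essential_minors n \<pi>"
    unfolding essential_minors_def by blast
qed

lemma essential_set_bound: "(p, q) \<in> essential_set n \<pi> \<Longrightarrow> p \<in> {1..n} \<and> q \<in> {1..n}"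
  using perm_diagramD(1,2)[OF \<pi>] essential_setD(1)[OF \<pi>] by blast

lemma chain_essential:
  assumes "(p, q, s) \<in> essential_conditions n \<pi>" "chain p q s f h"
  shows "chain n n s f h"
  using essential_set_bound[of p q] assms by (intro chain_mono[OF assms(2)]) (auto simp: essential_conditions_iff)

definition schubert_generators :: "'k::field zpoly set" where
  "schubert_generators = (\<Union>p\<in>{1..n}. \<Union>q\<in>{1..n}. minors (1 + perm_rank \<pi> p q) (zmat p q))"

lemma schubert_generators:
  "(schubert_generators :: 'k::field zpoly set) \<subseteq> carrier (zring n)"
  "(schubert_ideal n \<pi> :: 'k zpoly set) = zideal n schubert_generators"
  "(essential_minors n \<pi> :: 'k zpoly set) \<subseteq> schubert_generators"
proof -
  show "(schubert_generators :: 'k zpoly set) \<subseteq> carrier (zring n)"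
  proof
    fix g :: "'k zpoly" assume "g \<in> schubert_generators"
    then obtain p q s f h where *: "p \<in> {1..n}" "q \<in> {1..n}" "chain p q s f h" "g = gen_minor zv s f h"
      unfolding schubert_generators_def minors_zmat by auto
    then have "chain n n s f h" by (intro chain_mono[OF *(3)]) auto
    then show "g \<in> carrier (zring n)" unfolding *(4) by (rule gen_minor_carrier)
  qed
  show "(schubert_ideal n \<pi> :: 'k zpoly set) = zideal n schubert_generators"
    by (simp add: schubert_ideal_def zideal_def schubert_generators_def)
  show "(essential_minors n \<pi> :: 'k zpoly set) \<subseteq> schubert_generators"
  proof
    fix g :: "'k zpoly" assume "g \<in> essential_minors n \<pi>"
    then obtain p q where "(p, q) \<in> essential_set n \<pi>" "g \<in> minors (1 + perm_rank \<pi> p q) (zmat p q)"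
      unfolding essential_minors_def by blast
    with essential_set_bound show "g \<in> schubert_generators"
      unfolding schubert_generators_def by blast
  qed
qed

lemmas schubert_ideal_closed = zideal_closed[OF schubert_generators(1), folded schubert_generators(2)]

lemma essential_minors_in_ideal: "essential_minors n \<pi> \<subseteq> schubert_ideal n \<pi>"
  using schubert_generators(3) schubert_ideal_closed(1) by blast

lemma lead_term_closed:
  assumes R: "term_order n R" and f: "f \<in> carrier (zring n)"
  shows "\<exists>m c. lead_term R f = Poly_Mapping.single m c \<and> m \<in> zmonoms n"
proof (cases "f = 0")
  case True
  then have "lead_term R f = Poly_Mapping.single 0 0 \<and> 0 \<in> zmonoms n" by (simp add: lead_term_def)
  then show ?thesis by blast
next
  case False
  then have "lead_monom R f \<in> zmonoms n"
    using lead_monom(1)[OF R False] f by (auto simp: carrier_zring)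
  with False show ?thesis unfolding lead_term_def by auto
qed

lemma lead_terms_carrier:
  assumes R: "term_order n R" and "F \<subseteq> carrier (zring n)"
  shows "lead_term R ` F \<subseteq> carrier (zring n)"
proof
  fix t assume "t \<in> lead_term R ` F"
  then obtain f where "f \<in> carrier (zring n)" "t = lead_term R f" using assms(2) by blast
  then show "t \<in> carrier (zring n)" using lead_term_closed[OF R] zring_single by metis
qed

text \<open>The kernel of evaluation is an ideal, so only the generators matter; they vanish because
  the essential conditions imply all rank conditions.\<close>

lemma schubert_ideal_vanishes:
  assumes \<sigma>: "\<sigma> \<in> points (essential_conditions n \<pi>)" and f: "f \<in> schubert_ideal n \<pi>"
  shows "peval \<sigma> f = 0"
proof -
  have "minors_vanish \<sigma> p q (Suc (perm_rank \<pi> p q))" for p q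
    by (rule rank_conditions_from_essential[OF \<pi>])
      (rule pointsD[OF \<sigma>], simp add: essential_conditions_iff)
  note van = this
  have "peval \<sigma> g = 0" if "g \<in> schubert_generators" for g
  proof -
    obtain p q f h where *: "chain p q (Suc (perm_rank \<pi> p q)) f h" "g = gen_minor zv (Suc (perm_rank \<pi> p q)) f h"
      using \<open>g \<in> schubert_generators\<close> unfolding schubert_generators_def minors_zmat by auto
    have "gen_minor \<sigma> (Suc (perm_rank \<pi> p q)) f h = 0"
      by (rule minors_vanishD[OF van]) (use *(1) in \<open>simp_all add: chain_def\<close>)
    then show ?thesis by (simp add: *(2))
  qed
  with subsetD[OF schubert_generators(1)]
  have "schubert_generators \<subseteq> {f \<in> carrier (zring n). peval \<sigma> f = 0}"
    by (intro subsetI CollectI conjI)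
  then have "schubert_ideal n \<pi> \<subseteq> {f \<in> carrier (zring n). peval \<sigma> f = 0}"
    unfolding schubert_generators(2) by (rule zideal_minimal[OF kernel_ideal])
  with f show ?thesis by blast
qed

text \<open>Suppose the leading monomial were standard. Reducing the rest of \<open>f\<close> modulo
  the kernel at the generic point only moves down in \<open>R\<close>, so the leading term survives
  in a standard combination that vanishes there, against genericity.\<close>

lemma lead_monom_divisible_if_vexillary:
  assumes vex: "vexillary n \<pi>" and R: "diagonal_term_order TYPE('k::field) n R"
    and f: "(f :: 'k zpoly) \<in> schubert_ideal n \<pi>" "f \<noteq> 0"
  shows "chain_divides (essential_conditions n \<pi>) (lead_monom R f)"
proof (rule ccontr)
  let ?S = "essential_conditions n \<pi>"
  define m where "m = lead_monom R f"
  assume "\<not> chain_divides ?S (lead_monom R f)"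
  then have nb: "\<not> chain_divides ?S m" by (simp add: m_def)
  have R': "term_order n R" using R by (simp add: diagonal_term_order_def)
  have fc: "Poly_Mapping.keys f \<subseteq> zmonoms n" using f(1) schubert_ideal_closed(2) carrier_zring by blast
  have m: "m \<in> Poly_Mapping.keys f" "\<And>k. k \<in> Poly_Mapping.keys f \<Longrightarrow> (k, m) \<in> R"
    unfolding m_def using lead_monom[OF R' f(2) fc] by blast+
  obtain \<sigma> :: "nat \<times> nat \<Rightarrow> 'k zpoly fract" where \<sigma>: "generic_point ?S \<sigma>"
    using ladder_generic_point[OF ladder_essential_conditions[OF \<pi> vex]] by blast
  then have pts: "\<sigma> \<in> points ?S" by (simp add: generic_point_def)
  have f0: "peval \<sigma> f = 0" by (rule schubert_ideal_vanishes[OF pts f(1)])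
  interpret reduction ?S "{f. peval \<sigma> f = 0}" "zmonoms n" "\<lambda>u v. (v, u) \<in> R"
  proof (unfold_locales, goal_cases)
    case (4 p q s f' h' x)
    have "gen_minor \<sigma> s f' h' = 0"
      by (rule minors_vanishD[OF pointsD[OF pts 4(1)]]) (use 4(2) in \<open>auto simp: chain_def\<close>)
    then show ?case by (simp add: peval_mult)
  next
    case (5 m)
    then show ?case by (rule term_orderD(4)[OF R'])
  next
    case (6 m m' m'')
    then show ?case using term_orderD(5)[OF R'] by blast
  next
    case (7 p q s f' h' x k)
    note ch = chain_essential[OF 7(1,2)]
    have x: "x \<in> zmonoms n" "chain_monom s f' h' \<in> zmonoms n" using 7(3) by (simp_all add: zmonoms_add)
    have k: "k \<in> zmonoms n" using gen_minor_carrier[OF ch] 7(4) carrier_zring by blast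
    have "(k + x, chain_monom s f' h' + x) \<in> R"
      by (rule term_orderD(3)[OF R' k x(2,1) diagonal_lead(2)[OF R ch 7(4)]])
    then show ?case using k x by (simp add: zmonoms_add add.commute)
  qed (simp_all add: peval_add peval_mult)
  define c where "c = Poly_Mapping.lookup f m"
  have c: "c \<noteq> 0" using m(1) by (simp add: c_def in_keys_iff)
  define f' where "f' = f - Poly_Mapping.single m c"
  have keys': "k \<in> Poly_Mapping.keys f \<and> k \<noteq> m" if "k \<in> Poly_Mapping.keys f'" for k
    using that by (auto simp: f'_def c_def in_keys_iff lookup_minus lookup_single when_def split: if_splits)
  obtain g where g: "peval \<sigma> (f' - g) = 0"
     "\<And>v. v \<in> Poly_Mapping.keys g \<Longrightarrow> \<exists>m\<in>Poly_Mapping.keys f'. \<not> chain_divides ?S v \<and> v \<in> zmonoms n \<and> (v, m) \<in> R"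
    using reduce_poly[of f'] keys' fc by blast
  let ?h = "Poly_Mapping.single m c + g"
  have "peval \<sigma> ?h = peval \<sigma> f"
    using g(1) by (simp add: f'_def peval_diff peval_add diff_eq_eq add.commute)
  then have "peval \<sigma> ?h = 0" using f0 by simp
  moreover have "\<not> chain_divides ?S k" if "k \<in> Poly_Mapping.keys ?h" for k
  proof -
    have "k = m \<or> k \<in> Poly_Mapping.keys g"
      using that keys_add[of "Poly_Mapping.single m c" g] by (auto split: if_splits)
    then show ?thesis using nb g(2) by blast
  qed
  ultimately have h0: "?h = 0" using \<sigma> unfolding generic_point_def by blast
  \<comment> \<open>Otherwise \<open>m\<close> would be at most some monomial of the tail, all of
    which are strictly below \<open>m\<close>.\<close>
  have "m \<notin> Poly_Mapping.keys g"
  proof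
    assume "m \<in> Poly_Mapping.keys g"
    then obtain m' where m': "m' \<in> Poly_Mapping.keys f'" "(m, m') \<in> R" using g(2) by blast
    then have "m' = m" using keys'[OF m'(1)] m(2)[of m'] term_orderD(6)[OF R'] by blast
    with keys'[OF m'(1)] show False by blast
  qed
  then have "Poly_Mapping.lookup ?h m = c" by (simp add: lookup_add in_keys_iff)
  with h0 c show False by simp
qed

lemma groebner_if_vexillary:
  assumes vex: "vexillary n \<pi>" and R: "diagonal_term_order TYPE('k::field) n R"
  shows "groebner_basis n R (essential_minors n \<pi> :: 'k zpoly set) (schubert_ideal n \<pi>)"
proof -
  let ?G = "essential_minors n \<pi> :: 'k zpoly set" and ?I = "schubert_ideal n \<pi> :: 'k zpoly set"
  have R': "term_order n R" using R by (simp add: diagonal_term_order_def)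
  have lI: "lead_term R ` ?I \<subseteq> carrier (zring n)"
    by (rule lead_terms_carrier[OF R' schubert_ideal_closed(2)])
  have GI: "?G \<subseteq> ?I" by (rule essential_minors_in_ideal)
  then have lG: "lead_term R ` ?G \<subseteq> carrier (zring n)" using lI by blast
  interpret cring "zring n :: 'k zpoly ring" by (rule cring_zring)
  have ideals: "ideal (zideal n (lead_term R ` ?I)) (zring n)" "ideal (zideal n (lead_term R ` ?G)) (zring n)"
    unfolding zideal_def by (intro genideal_ideal lI lG)+
  have "zideal n (lead_term R ` ?G) \<subseteq> zideal n (lead_term R ` ?I)"
    using zideal_closed(1)[OF lI] GI by (intro zideal_minimal[OF ideals(1)]) blast
  moreover have "zideal n (lead_term R ` ?I) \<subseteq> zideal n (lead_term R ` ?G)"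
  proof (rule zideal_minimal[OF ideals(2)], rule image_subsetI)
    fix f :: "'k zpoly" assume f: "f \<in> ?I"
    show "lead_term R f \<in> zideal n (lead_term R ` ?G)"
    proof (cases "f = 0")
      case True
      then show ?thesis using zideal_closed(3)[OF lG] by (simp add: lead_term_def)
    next
      case False
      let ?m = "lead_monom R f"
      have "chain_divides (essential_conditions n \<pi>) ?m"
        by (rule lead_monom_divisible_if_vexillary[OF vex R f False])
      then obtain p q s f' h' where c: "(p, q, s) \<in> essential_conditions n \<pi>" "chain p q s f' h'"
        "\<And>i. i < s \<Longrightarrow> (f' i, h' i) \<in> Poly_Mapping.keys ?m"
        by (rule chain_dividesE) blast
      define x where "x = ?m - chain_monom s f' h'"
      have m: "?m = x + chain_monom s f' h'"
        unfolding x_def by (rule chain_divides_factor[OF c(2,3)])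
      have "?m \<in> zmonoms n"
        using lead_monom(1)[OF R' False] f schubert_ideal_closed(2) carrier_zring by blast
      then have x: "x \<in> zmonoms n" using m zmonoms_add by metis
      let ?g = "gen_minor zv s f' h' :: 'k zpoly"
      have "?g \<in> ?G" using c(1,2) unfolding essential_minors_eq by blast
      then have "lead_term R ?g \<in> zideal n (lead_term R ` ?G)" using zideal_closed(1)[OF lG] by blast
      then have "Poly_Mapping.single x (Poly_Mapping.lookup f ?m) * lead_term R ?g \<in> zideal n (lead_term R ` ?G)"
        by (intro zideal_closed(5)[OF lG] zring_single x)
      also have "Poly_Mapping.single x (Poly_Mapping.lookup f ?m) * lead_term R ?g = lead_term R f"
        unfolding diagonal_lead(1)[OF R chain_essential[OF c(1,2)]]
        using False by (simp add: lead_term_def mult_single flip: m)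
      finally show ?thesis .
    qed
  qed
  moreover have "finite ?G"
    unfolding essential_minors_def using finite_essential_set[OF \<pi>] by (auto intro: finite_minors)
  ultimately show ?thesis
    using GI unfolding groebner_basis_def zideal_def by blast
qed

end

section \<open>Redundant leading terms for non-vexillary permutations\<close>

text \<open>The grading by row degrees and column degrees. Minors are homogeneous for it, because
  permuting the columns of a diagonal term changes neither.\<close>

definition same_multidegree :: "zmonom \<Rightarrow> zmonom \<Rightarrow> bool" where
  "same_multidegree u v \<longleftrightarrow>
     (\<forall>a. monom_weight (\<lambda>(i, j). of_bool (i = a)) u = monom_weight (\<lambda>(i, j). of_bool (i = a)) v) \<and>
     (\<forall>b. monom_weight (\<lambda>(i, j). of_bool (j = b)) u = monom_weight (\<lambda>(i, j). of_bool (j = b)) v)"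

lemma same_multidegree_permute:
  assumes "\<sigma> permutes {..<s}"
  shows "same_multidegree (chain_monom s f h) (chain_monom s f (h \<circ> \<sigma>))"
proof -
  have "(\<Sum>i<s. of_bool (h i = b) :: nat) = (\<Sum>i<s. of_bool (h (\<sigma> i) = b))" for b
    using sum.permute[OF assms, of "\<lambda>i. of_bool (h i = b)"] by (simp only: comp_def)
  then show ?thesis
    unfolding same_multidegree_def monom_weight_chain prod.case comp_def by blast
qed

lemma same_multidegree_add:
  "same_multidegree u v \<Longrightarrow> same_multidegree (x + u) (x + v)"
  by (simp add: same_multidegree_def)

lemma monom_weight_pos:
  "v \<in> Poly_Mapping.keys m \<Longrightarrow> 0 < w v \<Longrightarrow> 0 < monom_weight w m"
  unfolding monom_weight_def by (intro sum_pos2[of _ v]) (auto simp: in_keys_iff)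

lemma chain_monom_weight_image:
  assumes "0 < monom_weight w (chain_monom s f h)"
  obtains i where "i < s" "w (f i, h i) \<noteq> 0"
proof -
  have "\<exists>i<s. w (f i, h i) \<noteq> 0"
  proof (rule ccontr)
    assume "\<not> (\<exists>i<s. w (f i, h i) \<noteq> 0)"
    then have "(\<Sum>i<s. w (f i, h i)) = 0" by (intro sum.neutral) auto
    with assms show False by (simp only: monom_weight_chain)
  qed
  with that show thesis by blast
qed

lemma same_multidegree_rows_cols:
  assumes d: "same_multidegree (chain_monom s f h) m" and m: "(a, b) \<in> Poly_Mapping.keys m"
  shows "a \<in> f ` {..<s}" "b \<in> h ` {..<s}"
proof -
  have "0 < monom_weight (\<lambda>(i, j). of_bool (i = a)) (chain_monom s f h)"
    using monom_weight_pos[OF m, of "\<lambda>(i, j). of_bool (i = a)"] d by (simp add: same_multidegree_def)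
  then show "a \<in> f ` {..<s}"
    by (rule chain_monom_weight_image) (auto split: if_splits)
  have "0 < monom_weight (\<lambda>(i, j). of_bool (j = b)) (chain_monom s f h)"
    using monom_weight_pos[OF m, of "\<lambda>(i, j). of_bool (j = b)"] d by (simp add: same_multidegree_def)
  then show "b \<in> h ` {..<s}"
    by (rule chain_monom_weight_image) (auto split: if_splits)
qed

lemma keys_chain_monom_eq:
  assumes "inj_on f {..<s}" "i < s"
  shows "(f i, h i) \<in> Poly_Mapping.keys (x + chain_monom s f h)"
  using assms by (auto simp: keys_add_monom in_keys_iff lookup_chain_monom)

lemma strict_mono_on_image_unique:
  fixes f g :: "nat \<Rightarrow> nat"
  assumes f: "strict_mono_on {..<s} f" and g: "strict_mono_on {..<s} g" and sub: "f ` {..<s} \<subseteq> g ` {..<s}" and i: "i < s"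
  shows "f i = g i"
proof -
  have "card (f ` {..<s}) = s" "card (g ` {..<s}) = s"
    using f g by (simp_all add: card_image strict_mono_on_imp_inj_on)
  then have "f ` {..<s} = g ` {..<s}"
    using sub by (intro card_subset_eq) auto
  then show ?thesis
    using pick_image_strict_mono[OF f i] pick_image_strict_mono[OF g i] by simp
qed

lemma strict_mono_enumeration:
  fixes A :: "nat set"
  assumes "finite A" "card A = s"
  obtains f where "strict_mono_on {..<s} f" "f ` {..<s} = A"
    "\<And>k i. k < card {a \<in> A. a \<le> i} \<Longrightarrow> f k \<le> i"
proof
  show mono: "strict_mono_on {..<s} (pick A)"
    unfolding strict_mono_on_def using assms by (auto intro: pick_mono)
  have "pick A ` {..<s} \<subseteq> A" using assms pick_in_set_le by auto
  moreover have "card (pick A ` {..<s}) = card A"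
    using mono assms by (simp add: card_image strict_mono_on_imp_inj_on)
  ultimately show "pick A ` {..<s} = A" using assms by (intro card_subset_eq) auto
  fix k i assume k: "k < card {a \<in> A. a \<le> i}"
  show "pick A k \<le> i"
  proof (rule ccontr)
    assume "\<not> pick A k \<le> i"
    then have "card {a \<in> A. a \<le> i} \<le> card {a \<in> A. a < pick A k}"
      using assms by (intro card_mono) auto
    also have "card {a \<in> A. a \<le> i} \<le> card A" using assms by (intro card_mono) auto
    then have "card {a \<in> A. a < pick A k} = k" using k by (intro card_pick_le) simp
    finally show False using k by simp
  qed
qed

section \<open>Non-vexillary permutations: a leading monomial that is standard\<close>

context
  fixes n :: nat and \<pi> :: "nat \<Rightarrow> nat"
  assumes \<pi>: "\<pi> permutes {1..n}"
begin

text \<open>A minor of an essential box \<open>(p, q)\<close> that the remaining essential conditions do not force to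
  vanish although, by a box \<open>(i, j)\<close> strictly northwest of it, its diagonal term is redundant.\<close>

lemma ex_redundant_lead_minor:
  assumes ij: "(i, j) \<in> essential_set n \<pi>" and pq: "(p, q) \<in> essential_set n \<pi>" and lt: "i < p" "j < q"
  defines "s \<equiv> Suc (perm_rank \<pi> p q)" and "u \<equiv> Suc (perm_rank \<pi> i j)"
  obtains f h w where "chain p q s f h" "chain i j u f h" "u \<le> s"
    "(w :: nat \<times> nat \<Rightarrow> 'k::field zpoly fract) \<in> points (essential_conditions n \<pi> - {(p, q, s)})"
    "gen_minor w s f h \<noteq> 0"
proof -
  note d = perm_diagramD[OF \<pi> essential_setD(1)[OF \<pi> pq]]
  \<comment> \<open>The minor uses the rows and columns of the dots of \<pi> in the block, together
    with row \<open>p\<close> and column \<open>q\<close>. These are new because the box is in the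
    diagram, so the size is one more than the rank.\<close>
  define A where "A = {a. 1 \<le> a \<and> a \<le> p \<and> \<pi> a \<le> q}"
  have finA: "finite A" by (rule finite_subset[of _ "{..p}"]) (auto simp: A_def)
  have cardA: "card A = perm_rank \<pi> p q" by (simp add: A_def perm_rank_def)
  have inj: "inj \<pi>" using \<pi> by (rule permutes_inj)
  have pA: "p \<notin> A" using d by (simp add: A_def)
  have qA: "q \<notin> \<pi> ` A"
  proof
    assume "q \<in> \<pi> ` A"
    then obtain a where "a \<in> A" "\<pi> a = q" by blast
    then have "inv_into UNIV \<pi> q \<le> p" using perm_inv(2)[OF \<pi>, of a] by (auto simp: A_def)
    with d show False by simp
  qed
  have pos: "0 < \<pi> a" if "1 \<le> a" for a
  proof (rule ccontr)
    assume "\<not> 0 < \<pi> a"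
    moreover have "\<pi> 0 = 0" using permutes_not_in[OF \<pi>] by simp
    ultimately show False using injD[OF inj, of a 0] that by simp
  qed
  let ?A = "insert p A" and ?B = "insert q (\<pi> ` A)"
  have cA: "card ?A = s" using finA pA by (simp add: cardA s_def)
  have cB: "card ?B = s"
    using finA qA by (simp add: card_image[OF inj_on_subset[OF inj]] cardA s_def)
  obtain f where f: "strict_mono_on {..<s} f" "f ` {..<s} = ?A" "\<And>k i. k < card {a \<in> ?A. a \<le> i} \<Longrightarrow> f k \<le> i"
    by (rule strict_mono_enumeration[OF _ cA]) (use finA in auto)
  obtain h where h: "strict_mono_on {..<s} h" "h ` {..<s} = ?B" "\<And>k i. k < card {b \<in> ?B. b \<le> i} \<Longrightarrow> h k \<le> i"
    by (rule strict_mono_enumeration[OF _ cB]) (use finA in auto)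
  have fA: "f k \<in> ?A" if "k < s" for k using f(2) that by blast
  have hB: "h k \<in> ?B" if "k < s" for k using h(2) that by blast
  have A_sub: "?A \<subseteq> {1..p}" using d by (auto simp: A_def)
  have B_sub: "?B \<subseteq> {1..q}" using d pos by (auto simp: A_def Suc_le_eq)
  have chain: "chain p q s f h"
    unfolding chain_def using f(1) h(1) fA hB A_sub B_sub by blast
  \<comment> \<open>The dot of column \<open>Suc j\<close> lies in one of the first \<open>i\<close>
    rows, and \<open>Suc j <= q\<close>. With the dots of the block \<open>(i, j)\<close> this gives
    \<open>u\<close> rows of the minor; columns are symmetric, so the first \<open>u\<close>
    diagonal entries lie in that block.\<close>
  have rows: "u \<le> card {a \<in> ?A. a \<le> i}"
  proof -
    have "u = perm_rank \<pi> i (Suc j)"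
      using essential_setD(3)[OF \<pi> ij] by (simp add: u_def perm_rank_Suc_col[OF \<pi>])
    also have "\<dots> \<le> perm_rank \<pi> i q" by (rule perm_rank_mono[OF \<pi>]) (use lt in auto)
    also have "\<dots> \<le> card {a \<in> ?A. a \<le> i}"
      unfolding perm_rank_def using lt finA by (intro card_mono) (auto simp: A_def)
    finally show ?thesis .
  qed
  have cols: "u \<le> card {b \<in> ?B. b \<le> j}"
  proof -
    have "u = perm_rank \<pi> (Suc i) j"
      using essential_setD(2)[OF \<pi> ij] by (simp add: u_def perm_rank_Suc_row[OF \<pi>])
    also have "\<dots> \<le> perm_rank \<pi> p j" by (rule perm_rank_mono[OF \<pi>]) (use lt in auto)
    also have "\<dots> = card (\<pi> ` {a. 1 \<le> a \<and> a \<le> p \<and> \<pi> a \<le> j})"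
      unfolding perm_rank_def by (simp add: card_image[OF inj_on_subset[OF inj]])
    also have "\<dots> \<le> card {b \<in> ?B. b \<le> j}"
      using lt finA by (intro card_mono) (auto simp: A_def)
    finally show ?thesis .
  qed
  have us: "u \<le> s"
  proof -
    note rows
    also have "card {a \<in> ?A. a \<le> i} \<le> card ?A" by (rule card_mono) (use finA in auto)
    finally show ?thesis by (simp only: cA)
  qed
  have "f k \<in> {1..i} \<and> h k \<in> {1..j}" if "k < u" for k
    using f(3)[of k i] h(3)[of k j] rows cols that us fA[of k] hB[of k] A_sub B_sub by force
  then have chain': "chain i j u f h"
    using f(1) h(1) us unfolding chain_def strict_mono_on_def by auto

  \<comment> \<open>One extra dot at \<open>(p, q)\<close> makes the chosen minor nonzero while
    breaking no other essential condition.\<close>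
  define D where "D = insert (p, q) ((\<lambda>a. (a, \<pi> a)) ` A)"
  have finD: "finite D" using finA by (simp add: D_def)
  have cardD: "card D \<le> s"
    using card_insert_le_m1[of s "(\<lambda>a. (a, \<pi> a)) ` A" "(p, q)"] card_image_le[OF finA, of "\<lambda>a. (a, \<pi> a)"]
    by (simp add: D_def cardA s_def)
  have van: "minors_vanish (dots D :: nat \<times> nat \<Rightarrow> 'k zpoly fract) p' q' s'"
    if "(p', q', s') \<in> essential_conditions n \<pi>" "(p', q', s') \<noteq> (p, q, s)" for p' q' s'
  proof -
    from that have s': "s' = Suc (perm_rank \<pi> p' q')" and ne: "p' \<noteq> p \<or> q' \<noteq> q"
      by (auto simp: essential_conditions_iff[OF \<pi>] s_def)
    have "card (D \<inter> {1..p'} \<times> {1..q'}) \<le> perm_rank \<pi> p' q'"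
    \<comment> \<open>Another block containing \<open>(p, q)\<close> also sees the dot of row
      \<open>Suc p\<close> or of column \<open>Suc q\<close>, so its rank is at least
      \<open>s\<close>. A block without \<open>(p, q)\<close> sees only dots of \<pi>.\<close>
    proof (cases "p \<le> p' \<and> q \<le> q'")
      case True
      have "card (D \<inter> {1..p'} \<times> {1..q'}) \<le> card D" using finD by (intro card_mono) auto
      also have "\<dots> \<le> s" by (rule cardD)
      also have "s \<le> perm_rank \<pi> p' q'"
      proof (cases "p < p'")
        case True
        have "s = perm_rank \<pi> (Suc p) q"
          using essential_setD(2)[OF \<pi> pq] by (simp add: s_def perm_rank_Suc_row[OF \<pi>])
        also have "\<dots> \<le> perm_rank \<pi> p' q'"
          by (rule perm_rank_mono[OF \<pi>]) (use True \<open>p \<le> p' \<and> q \<le> q'\<close> in auto)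
        finally show ?thesis .
      next
        case False
        have "s = perm_rank \<pi> p (Suc q)"
          using essential_setD(3)[OF \<pi> pq] by (simp add: s_def perm_rank_Suc_col[OF \<pi>])
        also have "\<dots> \<le> perm_rank \<pi> p' q'"
          by (rule perm_rank_mono[OF \<pi>]) (use False \<open>p \<le> p' \<and> q \<le> q'\<close> ne in auto)
        finally show ?thesis .
      qed
      finally show ?thesis .
    next
      case False
      let ?A' = "{a. 1 \<le> a \<and> a \<le> p' \<and> \<pi> a \<le> q'}"
      have finA': "finite ?A'" by (rule finite_subset[of _ "{..p'}"]) auto
      have "D \<inter> {1..p'} \<times> {1..q'} \<subseteq> (\<lambda>a. (a, \<pi> a)) ` ?A'"
        using False by (auto simp: D_def)
      then have "card (D \<inter> {1..p'} \<times> {1..q'}) \<le> card ((\<lambda>a. (a, \<pi> a)) ` ?A')"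
        using finA' by (intro card_mono) auto
      also have "\<dots> \<le> perm_rank \<pi> p' q'"
        unfolding perm_rank_def by (rule card_image_le[OF finA'])
      finally show ?thesis .
    qed
    then show ?thesis
      unfolding s' by (intro minors_vanish_dots[OF finD]) simp
  qed
  have pts: "(dots D :: nat \<times> nat \<Rightarrow> 'k zpoly fract) \<in> points (essential_conditions n \<pi> - {(p, q, s)})"
    unfolding points_def using van by blast
  define \<beta> where "\<beta> a = (if a = p then q else \<pi> a)" for a
  have inj\<beta>: "inj_on \<beta> ?A"
  proof (rule inj_onI)
    fix a b assume ab: "a \<in> ?A" "b \<in> ?A" "\<beta> a = \<beta> b"
    have neq: "\<pi> c \<noteq> q" if "c \<in> ?A" "c \<noteq> p" for c using that qA by blast
    show "a = b"
    proof (cases "a = p")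
      case True
      then show ?thesis using neq[OF ab(2)] ab(3) by (simp add: \<beta>_def split: if_splits)
    next
      case False
      then have "b \<noteq> p" using neq[OF ab(1)] ab(3) by (auto simp: \<beta>_def)
      with False ab(3) show ?thesis using injD[OF inj, of a b] by (simp add: \<beta>_def)
    qed
  qed
  have D_iff: "(a, b) \<in> D \<longleftrightarrow> b = \<beta> a" if "a \<in> ?A" for a b
    using that pA by (auto simp: D_def \<beta>_def)
  have "gen_minor (dots D :: nat \<times> nat \<Rightarrow> 'k zpoly fract) s f h \<noteq> 0"
  proof (rule gen_minor_permutation_neq_0[where h' = "\<lambda>k. \<beta> (f k)"])
    show "(dots D :: nat \<times> nat \<Rightarrow> 'k zpoly fract) (f k, h l) = of_bool (h l = \<beta> (f k))"
      if "k < s" "l < s" for k l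
      using D_iff[OF fA[OF that(1)]] by (simp add: dots_def)
    show "inj_on h {..<s}" using h(1) by (rule strict_mono_on_imp_inj_on)
    have "inj_on (\<beta> \<circ> f) {..<s}"
      using strict_mono_on_imp_inj_on[OF f(1)] inj\<beta> by (intro comp_inj_on) (simp_all add: f(2))
    then show "inj_on (\<lambda>k. \<beta> (f k)) {..<s}" by (simp add: comp_def)
    have "\<beta> a \<in> ?B" if "a \<in> ?A" for a using that by (auto simp: \<beta>_def)
    then show "(\<lambda>k. \<beta> (f k)) ` {..<s} \<subseteq> h ` {..<s}" using fA h(2) by blast
  qed
  with that[OF chain chain' us pts] show thesis by blast
qed

text \<open>The reduced polynomial has a leading monomial standard for \<open>S'\<close>, so an
  essential minor whose leading term divides it would have to belong to \<open>(p, q)\<close>. In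
  this multidegree its diagonal must be that of the chosen minor, and this begins with a chain for
  \<open>(i, j)\<close>, a condition in \<open>S'\<close>.\<close>

lemma vexillary_if_groebner:
  assumes R: "diagonal_term_order TYPE('k::field) n R"
    and gb: "groebner_basis n R (essential_minors n \<pi> :: 'k zpoly set) (schubert_ideal n \<pi>)"
  shows "vexillary n \<pi>"
proof (rule ccontr)
  assume "\<not> vexillary n \<pi>"
  then obtain i j p q where ij: "(i, j) \<in> essential_set n \<pi>" and pq: "(p, q) \<in> essential_set n \<pi>" and lt: "i < p" "j < q"
    unfolding vexillary_iff_essential_antichain[OF \<pi>] by blast
  let ?G = "essential_minors n \<pi> :: 'k zpoly set" and ?I = "schubert_ideal n \<pi> :: 'k zpoly set"
  let ?S = "essential_conditions n \<pi>"
  define s where "s = Suc (perm_rank \<pi> p q)"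
  define u where "u = Suc (perm_rank \<pi> i j)"
  define S' where "S' = ?S - {(p, q, s)}"
  obtain f h and w :: "nat \<times> nat \<Rightarrow> 'k zpoly fract" where
    ch: "chain p q s f h" and chu: "chain i j u f h" and us: "u \<le> s"
    and w: "w \<in> points S'" and nz: "gen_minor w s f h \<noteq> 0"
    using ex_redundant_lead_minor[OF ij pq lt, where 'k = 'k] unfolding s_def u_def S'_def by metis
  have R': "term_order n R" using R by (simp add: diagonal_term_order_def)
  have GI: "?G \<subseteq> ?I" by (rule essential_minors_in_ideal[OF \<pi>])
  note I = schubert_ideal_closed[OF \<pi>]
  have ijS: "(i, j, u) \<in> S'"
    using ij lt by (simp add: S'_def u_def essential_conditions_iff[OF \<pi>])
  have minor_I: "gen_minor zv s' f' h' \<in> ?I" if "(p', q', s') \<in> ?S" "chain p' q' s' f' h'" for p' q' s' f' h'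
    using that GI unfolding essential_minors_eq[OF \<pi>] by blast
  \<comment> \<open>Membership in the ideal is kept for the reduced polynomial; vanishing at
    \<open>w\<close> preserves its nonzero value there and so its being nonzero.\<close>
  interpret reduction S' "{f \<in> ?I. peval w f = 0}" "zmonoms n" same_multidegree
  proof (unfold_locales, goal_cases)
    case 1
    then show ?case using I(3) by simp
  next
    case (2 f g)
    then show ?case by (simp add: peval_add I(4))
  next
    case (3 f a)
    then show ?case using I(5)[of f "Poly_Mapping.single 0 a"] by (simp add: peval_mult zring_single)
  next
    case (4 p' q' s' f' h' x)
    have "gen_minor w s' f' h' = 0"
      by (rule minors_vanishD[OF pointsD[OF w 4(1)]]) (use 4(2) in \<open>simp_all add: chain_def\<close>)
    moreover have "x \<in> zmonoms n" using 4(3) by (simp add: zmonoms_add)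
    moreover have "gen_minor zv s' f' h' \<in> ?I"
      by (rule minor_I[OF _ 4(2)]) (use 4(1) in \<open>simp add: S'_def\<close>)
    ultimately show ?case by (simp add: peval_mult I(5) zring_single)
  next
    case (5 m)
    then show ?case by (simp add: same_multidegree_def)
  next
    case (6 m m' m'')
    then show ?case by (simp add: same_multidegree_def)
  next
    case (7 p' q' s' f' h' x k)
    have "(p', q', s') \<in> ?S" using 7(1) by (simp add: S'_def)
    then have chn: "chain n n s' f' h'" by (rule chain_essential[OF \<pi> _ 7(2)])
    then have mono: "strict_mono_on {..<s'} f'" "strict_mono_on {..<s'} h'" by (simp_all add: chain_def)
    have "k \<in> zmonoms n" using gen_minor_carrier[OF chn] 7(4) carrier_zring by blast
    moreover have "same_multidegree (chain_monom s' f' h') k"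
      using keys_gen_minor[OF mono 7(4)] same_multidegree_permute by blast
    ultimately show ?case using 7(3) by (simp add: zmonoms_add same_multidegree_add)
  qed
  have pqS: "(p, q, s) \<in> ?S" using pq by (simp add: s_def essential_conditions_iff[OF \<pi>])
  have chn: "chain n n s f h" by (rule chain_essential[OF \<pi> pqS ch])
  then have mono: "strict_mono_on {..<s} f" "strict_mono_on {..<s} h" by (simp_all add: chain_def)
  let ?\<delta> = "gen_minor zv s f h :: 'k zpoly"
  have \<delta>: "?\<delta> \<in> ?I" by (rule minor_I[OF pqS ch])
  have "Poly_Mapping.keys ?\<delta> \<subseteq> zmonoms n" using gen_minor_carrier[OF chn] carrier_zring by blast
  from reduce_poly[OF this] obtain g where g: "?\<delta> - g \<in> ?I" "peval w (?\<delta> - g) = 0"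
    "\<And>v. v \<in> Poly_Mapping.keys g \<Longrightarrow>
      \<exists>m\<in>Poly_Mapping.keys ?\<delta>. \<not> chain_divides S' v \<and> v \<in> zmonoms n \<and> same_multidegree m v"
    by blast
  have "peval w g = gen_minor w s f h" using g(2) by (simp add: peval_diff)
  then have g0: "g \<noteq> 0" using nz by auto
  have "- (?\<delta> - g) \<in> ?I"
    using I(5)[OF g(1) zring_uminus_closed[OF zring_single[OF zmonoms_0, of 1]]] by simp
  then have "- (?\<delta> - g) + ?\<delta> \<in> ?I" using \<delta> by (rule I(4))
  then have gI: "g \<in> ?I" by simp
  have gz: "Poly_Mapping.keys g \<subseteq> zmonoms n" using gI I(2) carrier_zring by blast
  define m where "m = lead_monom R g"
  have m: "m \<in> Poly_Mapping.keys g" unfolding m_def by (rule lead_monom(1)[OF R' g0 gz])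
  obtain k where k: "k \<in> Poly_Mapping.keys ?\<delta>" "\<not> chain_divides S' m" "same_multidegree k m"
    using g(3)[OF m] by blast
  obtain \<sigma> where "\<sigma> permutes {..<s}" "k = chain_monom s f (h \<circ> \<sigma>)"
    using keys_gen_minor[OF mono k(1)] by blast
  then have md: "same_multidegree (chain_monom s f h) m"
    using k(3) same_multidegree_permute[of \<sigma> s f h] by (simp add: same_multidegree_def)
  have lI: "lead_term R ` ?I \<subseteq> carrier (zring n)"
    by (rule lead_terms_carrier[OF \<pi> R' I(2)])
  have "lead_term R g \<in> zideal n (lead_term R ` ?I)"
    using zideal_closed(1)[OF lI] gI by blast
  then have lg: "lead_term R g \<in> zideal n (lead_term R ` ?G)"
    using gb by (simp add: groebner_basis_def zideal_def)
  have mk: "m \<in> Poly_Mapping.keys (lead_term R g)"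
    using m g0 by (simp add: lead_term_def m_def[symmetric] in_keys_iff)
  have "\<exists>m c x. Poly_Mapping.single m c \<in> lead_term R ` ?G \<and> c \<noteq> 0 \<and> lead_monom R g = x + m"
  proof (rule monomial_in_zideal[OF _ lg])
    fix t assume "t \<in> lead_term R ` ?G"
    then obtain g' where "g' \<in> ?G" "t = lead_term R g'" by blast
    then show "\<exists>m c. t = Poly_Mapping.single m c \<and> m \<in> zmonoms n"
      using lead_term_closed[OF \<pi> R', of g'] GI I(2) by blast
  qed (use mk in \<open>simp add: m_def\<close>)
  then obtain m' c x g' where m': "Poly_Mapping.single m' c = lead_term R g'" "g' \<in> ?G" "c \<noteq> 0" "m = x + m'"
    unfolding m_def by blast
  obtain p1 q1 s1 f1 h1 where g': "g' = gen_minor zv s1 f1 h1" "(p1, q1, s1) \<in> ?S" "chain p1 q1 s1 f1 h1"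
    using m'(2) unfolding essential_minors_eq[OF \<pi>] by blast
  have "Poly_Mapping.single m' c = Poly_Mapping.single (chain_monom s1 f1 h1) 1"
    using m'(1) diagonal_lead(1)[OF R chain_essential[OF \<pi> g'(2,3)]] g'(1) by simp
  then have "Poly_Mapping.keys (Poly_Mapping.single m' c) = {chain_monom s1 f1 h1}" by simp
  then have mx: "m = x + chain_monom s1 f1 h1" using m'(3,4) by simp
  have keys1: "(f1 l, h1 l) \<in> Poly_Mapping.keys m" if "l < s1" for l
    unfolding mx by (rule keys_chain_monom_eq[OF chain_inj(1)[OF g'(3)] that])
  have "chain_divides S' m"
  proof (cases "(p1, q1, s1) \<in> S'")
    case True
    then show ?thesis by (rule chain_dividesI[OF _ g'(3) keys1])
  next
    case False
    then have s1: "s1 = s" using g'(2) by (simp add: S'_def)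
    \<comment> \<open>The monomial uses only the rows and columns of the chosen minor. There are
      \<open>s\<close> of each, so an increasing chain of length \<open>s\<close> must use them all
      in order.\<close>
    have sub: "f1 ` {..<s} \<subseteq> f ` {..<s}" "h1 ` {..<s} \<subseteq> h ` {..<s}"
      using same_multidegree_rows_cols[OF md keys1] s1 by auto
    have mono1: "strict_mono_on {..<s} f1" "strict_mono_on {..<s} h1"
      using g'(3) s1 by (simp_all add: chain_def)
    have "f1 l = f l" "h1 l = h l" if "l < s" for l
      by (rule strict_mono_on_image_unique[OF mono1(1) mono(1) sub(1) that]
          strict_mono_on_image_unique[OF mono1(2) mono(2) sub(2) that])+
    then have "(f l, h l) \<in> Poly_Mapping.keys m" if "l < u" for l
      using keys1[of l] that us s1 by simp
    then show ?thesis by (rule chain_dividesI[OF ijS chu])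
  qed
  with k(2) show False ..
qed

end

theorem mainTheorem2:
  fixes n :: nat and \<pi> :: "nat \<Rightarrow> nat"
  assumes "\<pi> permutes {1..n}"
  shows "((\<exists>R. diagonal_term_order TYPE('k::field) n R \<and>
             groebner_basis n R (essential_minors n \<pi> :: 'k zpoly set) (schubert_ideal n \<pi>))
          \<longleftrightarrow>
          (\<forall>R. diagonal_term_order TYPE('k) n R \<longrightarrow>
             groebner_basis n R (essential_minors n \<pi> :: 'k zpoly set) (schubert_ideal n \<pi>)))
       \<and> ((\<forall>R. diagonal_term_order TYPE('k) n R \<longrightarrow>
             groebner_basis n R (essential_minors n \<pi> :: 'k zpoly set) (schubert_ideal n \<pi>))
          \<longleftrightarrow> vexillary n \<pi>)"
proof -
  have "\<exists>R. diagonal_term_order TYPE('k) n R"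
    using diagonal_weight_order by blast
  then show ?thesis
    using vexillary_if_groebner[OF assms, where 'k = 'k] groebner_if_vexillary[OF assms, where 'k = 'k]
    by blast
qed

end
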